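(* Let $\hat\sigma_1\in C(\overline G\times I,C^1(I'))$, $\hat\sigma_2\in C(\overline G,C^2(I'\times I))$ and let $\psi\in C(\overline G,C^2(I,C^3(S)))$. Then the transport operator $$T\psi=-\mathcal H_2\big((\overline{\mathcal K}_2\psi)(x,\omega,\cdot,E)\big)(E)+\mathcal H_1\big((\overline{\mathcal K}_1\psi)(x,\omega,\cdot,E)\big)(E)+\omega\cdot\nabla_x\psi+\Sigma\psi-K_r\psi$$ can be expressed as $$\begin{aligned}(T\psi)(x,\omega,E)=&-\frac{\partial}{\partial E}\Big(\mathcal H_1\big((\overline{\mathcal K}_2\psi)(x,\omega,\cdot,E)\big)(E)\Big)-2\pi\,\hat\sigma_2(x,E,E)\frac{\partial\psi}{\partial E}(x,\omega,E)\\&-\hat\sigma_2(x,E,E)\,(\mathcal A\psi)(x,\omega,E)\\&+\mathrm{p.f.}\int_E^{E_m}\frac1{E'-E}\hat\sigma_2(x,E',E)\int_0^{2\pi}\Big\langle(\nabla_S\psi)(x,\gamma(E',E,\omega)(s),E'),\frac{\partial\gamma}{\partial E}(E',E,\omega)(s)\Big\rangle ds\,dE'\\&+\mathrm{p.f.}\int_E^{E_m}\frac1{E'-E}\frac{\partial\hat\sigma_2}{\partial E}(x,E',E)\int_0^{2\pi}\psi(x,\gamma(E',E,\omega)(s),E')\,ds\,dE'\\&+\mathcal H_1\big((\overline{\mathcal K}_1\psi)(x,\omega,\cdot,E)\big)(E)-2\pi\,\frac{\partial\hat\sigma_2}{\partial E'}(x,E,E)\psi(x,\omega,E)\\&+\omega\cdot\nabla_x\psi+\Sigma(x,\omega,E)\psi-(K_r\psi)(x,\omega,E),\end{aligned}$$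 where $(\mathcal A\psi)(x,\omega,E)=\sum_{|\alpha|\le2}a_\alpha(E,\omega)(\partial_\omega^\alpha\psi)(x,\omega,E)=-\pi\,(\partial_{E'}\mu)(E,E)\,(\Delta_S\psi)(x,\omega,E)$.
   Context: $G\subset\mathbb R^3$ is a bounded open set (with $\overline G$ a $C^1$-manifold with boundary), $S$ is the unit sphere of $\mathbb R^3$, $I=[E_0,E_m]$ with $0<E_0<E_m<\infty$; $I'$ is a copy of $I$ (the range of $E'$). A function $\hat\sigma_j=\hat\sigma_j(x,E',E)$ belongs to $C(\overline G\times I,C^1(I'))$ if $(x,E)\mapsto\hat\sigma_j(x,\cdot,E)$ is continuous with values in $C^1(I')$; the other spaces are read in the same way. $\partial/\partial E'$ and $\partial/\partial E$ applied to $\hat\sigma_2(x,E',E)$, $\mu(E',E)$, $\gamma(E',E,\omega)$ are partial derivatives in the first and the second energy argument; $(\partial_{E'}\mu)(E,E)$ etc. means evaluation at $E'=E$. For $E'\ge E$ put $\mu=\mu(E',E)=\sqrt{\frac{E(E'+2)}{E'(E+2)}}\in(0,1]$ and $$\gamma(E',E,\omega)(s)=R(\omega)\big(\sqrt{1-\mu^2}\cos s,\sqrt{1-\mu^2}\sin s,\mu\big),\quad s\in[0,2\pi],$$ where $R(\omega)$ is a rotation matrix (depending only on $\omega$) with $R(\omega)e_3=\omega$, $e_3=(0,0,1)$. It parametrizes $\{\omega'\in S:\omega'\cdot\omega=\mu(E',E)\}$. For $j=0,1,2$, $(\overline{\mathcal K}_j\psi)(x,\omega,E',E)=\hat\sigma_j(x,E',E)\int_0^{2\pi}\psi(x,\gamma(E',E,\omega)(s),E')\,ds$.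 The Hadamard finite part operators are $(\mathcal H_ju)(E)=\mathrm{p.f.}\int_E^{E_m}\frac{u(E')}{(E'-E)^j}dE'$, $j=1,2$, where $$\mathrm{p.f.}\int_x^b\frac{f(t)}{t-x}dt=\lim_{\epsilon\to0^+}\Big(\int_{x+\epsilon}^b\frac{f(t)}{t-x}dt+f(x^+)\ln\epsilon\Big),$$ $$\mathrm{p.f.}\int_x^b\frac{f(t)}{(t-x)^2}dt=\lim_{\epsilon\to0^+}\Big(\int_{x+\epsilon}^b\frac{f(t)}{(t-x)^2}dt+f'(x^+)\ln\epsilon-\frac1\epsilon f(x^+)\Big).$$ $\nabla_S$ is the gradient on $S$ (a tangent vector regarded as a vector of $\mathbb R^3$), $\langle\cdot,\cdot\rangle$ the Euclidean inner product of $\mathbb R^3$, $\Delta_S$ the Laplace–Beltrami operator on $S$. $\Sigma=\Sigma(x,\omega,E)$ is a given function (total cross section), and $K_r$ is the restricted collision operator $(K_r\psi)(x,\omega,E)=\int_I\chi(E',E)(\overline{\mathcal K}_0\psi)(x,\omega,E',E)\,dE'$, $\chi(E',E)=1$ if $E'>E$ and $0$ otherwise, with $\hat\sigma_0$ such that $K_r$ is a bounded operator on $L^2(G\times S\times I)$. The identity is for $E<E_m$. *)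

theory Defs
  imports "HOL-Analysis.Analysis"
begin

section \<open>Classes of continuously differentiable functions\<close>

text \<open>
  \<open>C^k\<close> functions on a set \<open>S\<close> that is either open or a compact box with interior. Derivatives are
  taken within \<open>S\<close>, hence are one-sided at boundary points of a box; on such sets they are unique.
\<close>

fun Ck_on :: "nat \<Rightarrow> 'a::euclidean_space set \<Rightarrow> ('a \<Rightarrow> 'b::real_normed_vector) \<Rightarrow> bool" where
  "Ck_on 0 S f \<longleftrightarrow> continuous_on S f"
| "Ck_on (Suc k) S f \<longleftrightarrow> f differentiable_on S \<and>
     (\<forall>b\<in>Basis. Ck_on k S (\<lambda>y. frechet_derivative f (at y within S) b))"

fun iter_deriv :: "'a::euclidean_space set \<Rightarrow> 'a list \<Rightarrow> ('a \<Rightarrow> 'b::real_normed_vector) \<Rightarrow> 'a \<Rightarrow> 'b" where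
  "iter_deriv S [] f = f"
| "iter_deriv S (b # bs) f = iter_deriv S bs (\<lambda>y. frechet_derivative f (at y within S) b)"

text \<open>
  Convergence, uniform over \<open>K \<subseteq> S\<close>, of all partial derivatives of order at most \<open>k\<close>. For \<open>C^k\<close>
  functions and \<open>K = S\<close> a compact box this is convergence in the norm of \<open>C^k(S)\<close>.
\<close>

definition tendsto_Ck ::
  "nat \<Rightarrow> 'a::euclidean_space set \<Rightarrow> 'a set \<Rightarrow> ('p \<Rightarrow> 'a \<Rightarrow> real) \<Rightarrow> ('a \<Rightarrow> real) \<Rightarrow> 'p filter \<Rightarrow> bool" where
  "tendsto_Ck k S K F f net \<longleftrightarrow>
     (\<forall>bs. set bs \<subseteq> Basis \<and> length bs \<le> k \<longrightarrow>
        uniform_limit K (\<lambda>p. iter_deriv S bs (F p)) (iter_deriv S bs f) net)"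

text \<open>The space \<open>C(A, C^k(S))\<close>, \<open>S\<close> a compact box.\<close>

definition C_into_Ck ::
  "'p::metric_space set \<Rightarrow> nat \<Rightarrow> 'a::euclidean_space set \<Rightarrow> ('p \<Rightarrow> 'a \<Rightarrow> real) \<Rightarrow> bool" where
  "C_into_Ck A k S F \<longleftrightarrow> (\<forall>a\<in>A. Ck_on k S (F a) \<and> tendsto_Ck k S S F (F a) (at a within A))"

definition C1_manifold_with_boundary :: "(real^3) set \<Rightarrow> bool" where
  "C1_manifold_with_boundary M \<longleftrightarrow>
     (\<forall>p\<in>M. \<exists>U V \<phi> \<phi>'. open U \<and> p \<in> U \<and> open V \<and> homeomorphism U V \<phi> \<phi>' \<and>
        Ck_on 1 U \<phi> \<and> Ck_on 1 V \<phi>' \<and> \<phi> ` (U \<inter> M) = V \<inter> {y::real^3. y $ 3 \<ge> 0})"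

section \<open>Calculus on the unit sphere\<close>

text \<open>
  A function on the sphere is differentiated through its extension that is constant along rays,
  \<open>y \<mapsto> f (y/|y|)\<close> (recall \<open>sgn y = y/|y|\<close>). As \<open>sgn\<close> is a smooth retraction of the punctured space
  onto the sphere, \<open>f\<close> is \<open>C^k\<close> on the sphere iff this extension is \<open>C^k\<close> off the origin. Its
  Euclidean gradient at a point of the sphere is tangent to the sphere and is the gradient of \<open>f\<close>
  on the sphere; likewise the Euclidean divergence of the extension of a tangent field is its
  divergence on the sphere.
\<close>

definition radial :: "(real^3 \<Rightarrow> 'b) \<Rightarrow> real^3 \<Rightarrow> 'b" where
  "radial f = (\<lambda>y. f (sgn y))"

definition grad :: "('a::real_inner \<Rightarrow> real) \<Rightarrow> 'a \<Rightarrow> 'a" where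
  "grad f x = (THE D. GDERIV f x :> D)"

definition grad_S :: "(real^3 \<Rightarrow> real) \<Rightarrow> real^3 \<Rightarrow> real^3" where
  "grad_S f \<omega> = grad (radial f) \<omega>"

definition div_S :: "(real^3 \<Rightarrow> real^3) \<Rightarrow> real^3 \<Rightarrow> real" where
  "div_S X \<omega> = trace (jacobian (radial X) (at \<omega>))"

definition laplace_S :: "(real^3 \<Rightarrow> real) \<Rightarrow> real^3 \<Rightarrow> real" where
  "laplace_S f = div_S (grad_S f)"

definition pderiv :: "3 \<Rightarrow> (real^3 \<Rightarrow> real) \<Rightarrow> real^3 \<Rightarrow> real" where
  "pderiv i f y = frechet_derivative f (at y) (axis i 1)"

definition multi_deriv_S :: "nat^3 \<Rightarrow> (real^3 \<Rightarrow> real) \<Rightarrow> real^3 \<Rightarrow> real" where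
  "multi_deriv_S \<alpha> f =
     (pderiv 1 ^^ (\<alpha> $ 1)) ((pderiv 2 ^^ (\<alpha> $ 2)) ((pderiv 3 ^^ (\<alpha> $ 3)) (radial f)))"

definition Ck_sphere :: "nat \<Rightarrow> (real^3 \<Rightarrow> real) \<Rightarrow> bool" where
  "Ck_sphere k f \<longleftrightarrow> Ck_on k (- {0}) (radial f)"

text \<open>
  Convergence in the norm of \<open>C^k\<close> of the sphere. The first set is a parameter set on which the
  convergence is uniform as well.
\<close>

definition tendsto_Ck_sphere ::
  "'e set \<Rightarrow> nat \<Rightarrow> ('p \<Rightarrow> 'e \<Rightarrow> real^3 \<Rightarrow> real) \<Rightarrow> ('e \<Rightarrow> real^3 \<Rightarrow> real) \<Rightarrow> 'p filter \<Rightarrow> bool" where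
  "tendsto_Ck_sphere J k F f net \<longleftrightarrow>
     (\<forall>bs. set bs \<subseteq> Basis \<and> length bs \<le> k \<longrightarrow>
        uniform_limit (J \<times> sphere 0 1)
          (\<lambda>p (e, \<omega>). iter_deriv (- {0}) bs (radial (F p e)) \<omega>)
          (\<lambda>(e, \<omega>). iter_deriv (- {0}) bs (radial (f e)) \<omega>) net)"

definition energy_deriv :: "real set \<Rightarrow> (real \<Rightarrow> real^3 \<Rightarrow> real) \<Rightarrow> real \<Rightarrow> real^3 \<Rightarrow> real" where
  "energy_deriv I u E \<omega> = vector_derivative (\<lambda>t. u t \<omega>) (at E within I)"

text \<open>
  \<open>C^m(I, C^k(sphere))\<close>: the difference quotients converge in the norm of \<open>C^k(sphere)\<close>. Their limit
  can only be the pointwise derivative.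
\<close>

fun Cm_into_Ck_sphere :: "nat \<Rightarrow> real set \<Rightarrow> nat \<Rightarrow> (real \<Rightarrow> real^3 \<Rightarrow> real) \<Rightarrow> bool" where
  "Cm_into_Ck_sphere 0 I k u \<longleftrightarrow>
     (\<forall>E\<in>I. Ck_sphere k (u E) \<and>
        tendsto_Ck_sphere UNIV k (\<lambda>t (_::unit). u t) (\<lambda>_. u E) (at E within I))"
| "Cm_into_Ck_sphere (Suc m) I k u \<longleftrightarrow>
     (\<forall>E\<in>I. Ck_sphere k (u E) \<and>
        tendsto_Ck_sphere UNIV k (\<lambda>t (_::unit) \<omega>. (u t \<omega> - u E \<omega>) / (t - E))
          (\<lambda>_. energy_deriv I u E) (at E within I)) \<and>
     Cm_into_Ck_sphere m I k (energy_deriv I u)"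

text \<open>
  \<open>C(A, C^m(I, C^k(sphere)))\<close> for functions with arguments \<open>x\<close>, \<open>\<omega>\<close>, \<open>E\<close> in this order. Convergence
  in \<open>C^m(I, X)\<close> is uniform convergence on \<open>I\<close>, in the norm of \<open>X\<close>, of the derivatives of order
  at most \<open>m\<close>.
\<close>

definition C_into_Cm_Ck_sphere ::
  "(real^3) set \<Rightarrow> nat \<Rightarrow> real set \<Rightarrow> nat \<Rightarrow> (real^3 \<Rightarrow> real^3 \<Rightarrow> real \<Rightarrow> real) \<Rightarrow> bool" where
  "C_into_Cm_Ck_sphere A m I k \<psi> \<longleftrightarrow>
     (let u = (\<lambda>x E \<omega>. \<psi> x \<omega> E) in
      \<forall>x\<in>A. Cm_into_Ck_sphere m I k (u x) \<and>
        (\<forall>j\<le>m. tendsto_Ck_sphere I k (\<lambda>z. (energy_deriv I ^^ j) (u z))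
                  ((energy_deriv I ^^ j) (u x)) (at x within A)))"

section \<open>Hadamard finite parts\<close>

text \<open>
  \<open>f(x+)\<close> and \<open>f'(x+)\<close> are the right limits at \<open>x\<close> of \<open>f\<close> and of its derivative; the value of \<open>f\<close>
  at \<open>x\<close> itself is irrelevant.
\<close>

definition has_pf1 :: "(real \<Rightarrow> real) \<Rightarrow> real \<Rightarrow> real \<Rightarrow> real \<Rightarrow> bool" where
  "has_pf1 f x b L \<longleftrightarrow>
     (\<forall>\<epsilon>>0. set_integrable lebesgue {x+\<epsilon>..b} (\<lambda>t. f t / (t - x))) \<and>
     (\<exists>f0. (f \<longlongrightarrow> f0) (at_right x) \<and>
        ((\<lambda>\<epsilon>. (LINT t:{x+\<epsilon>..b}|lebesgue. f t / (t - x)) + f0 * ln \<epsilon>) \<longlongrightarrow> L) (at_right 0))"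

definition has_pf2 :: "(real \<Rightarrow> real) \<Rightarrow> real \<Rightarrow> real \<Rightarrow> real \<Rightarrow> bool" where
  "has_pf2 f x b L \<longleftrightarrow>
     (\<forall>\<epsilon>>0. set_integrable lebesgue {x+\<epsilon>..b} (\<lambda>t. f t / (t - x)^2)) \<and>
     (\<forall>\<^sub>F t in at_right x. f differentiable (at t)) \<and>
     (\<exists>f0 f1. (f \<longlongrightarrow> f0) (at_right x) \<and> (deriv f \<longlongrightarrow> f1) (at_right x) \<and>
        ((\<lambda>\<epsilon>. (LINT t:{x+\<epsilon>..b}|lebesgue. f t / (t - x)^2) + f1 * ln \<epsilon> - f0 / \<epsilon>) \<longlongrightarrow> L)
          (at_right 0))"

definition pf1 :: "(real \<Rightarrow> real) \<Rightarrow> real \<Rightarrow> real \<Rightarrow> real" where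
  "pf1 f x b = (THE L. has_pf1 f x b L)"

definition pf2 :: "(real \<Rightarrow> real) \<Rightarrow> real \<Rightarrow> real \<Rightarrow> real" where
  "pf2 f x b = (THE L. has_pf2 f x b L)"

section \<open>Collision kinematics and the transport operator\<close>

text \<open>Arguments are in the order \<open>E'\<close>, \<open>E\<close>.\<close>

definition mu :: "real \<Rightarrow> real \<Rightarrow> real" where
  "mu E' E = sqrt (E * (E' + 2) / (E' * (E + 2)))"

definition gam :: "(real^3 \<Rightarrow> real^3^3) \<Rightarrow> real \<Rightarrow> real \<Rightarrow> real^3 \<Rightarrow> real \<Rightarrow> real^3" where
  "gam R E' E \<omega> s =
     R \<omega> *v vector [sqrt (1 - (mu E' E)^2) * cos s, sqrt (1 - (mu E' E)^2) * sin s, mu E' E]"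

definition dgam_dE :: "(real^3 \<Rightarrow> real^3^3) \<Rightarrow> real \<Rightarrow> real \<Rightarrow> real^3 \<Rightarrow> real \<Rightarrow> real^3" where
  "dgam_dE R E' E \<omega> s = vector_derivative (\<lambda>t. gam R E' t \<omega> s) (at E)"

definition Kbar ::
  "(real^3 \<Rightarrow> real^3^3) \<Rightarrow> (real^3 \<Rightarrow> real \<Rightarrow> real \<Rightarrow> real) \<Rightarrow> (real^3 \<Rightarrow> real^3 \<Rightarrow> real \<Rightarrow> real)
     \<Rightarrow> real^3 \<Rightarrow> real^3 \<Rightarrow> real \<Rightarrow> real \<Rightarrow> real" where
  "Kbar R \<sigma> \<psi> x \<omega> E' E =
     \<sigma> x E' E * (LINT s:{0..2*pi}|lebesgue. \<psi> x (gam R E' E \<omega> s) E')"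

definition Kr_integrand ::
  "(real^3 \<Rightarrow> real^3^3) \<Rightarrow> (real^3 \<Rightarrow> real \<Rightarrow> real \<Rightarrow> real) \<Rightarrow> (real^3 \<Rightarrow> real^3 \<Rightarrow> real \<Rightarrow> real)
     \<Rightarrow> real^3 \<Rightarrow> real^3 \<Rightarrow> real \<Rightarrow> real \<Rightarrow> real" where
  "Kr_integrand R \<sigma>0 \<psi> x \<omega> E E' = (if E' > E then 1 else 0) * Kbar R \<sigma>0 \<psi> x \<omega> E' E"

definition Kr ::
  "(real^3 \<Rightarrow> real^3^3) \<Rightarrow> real set \<Rightarrow> (real^3 \<Rightarrow> real \<Rightarrow> real \<Rightarrow> real)
     \<Rightarrow> (real^3 \<Rightarrow> real^3 \<Rightarrow> real \<Rightarrow> real) \<Rightarrow> real^3 \<Rightarrow> real^3 \<Rightarrow> real \<Rightarrow> real" where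
  "Kr R I \<sigma>0 \<psi> x \<omega> E = (LINT E':I|lebesgue. Kr_integrand R \<sigma>0 \<psi> x \<omega> E E')"

text \<open>
  The surface measure of the unit sphere: the area of \<open>A\<close> is three times the volume of the cone
  over \<open>A\<close> in the unit ball.
\<close>

definition sphere_measure :: "(real^3) measure" where
  "sphere_measure =
     restrict_space (distr (density lborel (\<lambda>y. 3 * indicator (ball 0 1) y)) borel sgn) (sphere 0 1)"

definition phase_measure :: "(real^3) set \<Rightarrow> real set \<Rightarrow> ((real^3) \<times> (real^3) \<times> real) measure" where
  "phase_measure G I = restrict_space lborel G \<Otimes>\<^sub>M (sphere_measure \<Otimes>\<^sub>M restrict_space lborel I)"

text \<open>
  Boundedness of the restricted collision operator on \<open>L^2(G \<times> S \<times> I)\<close>. Each class of \<open>L^2\<close> has a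
  Borel representative \<open>f\<close>; its image need only be Lebesgue measurable.
\<close>

definition Kr_bounded_L2 ::
  "(real^3) set \<Rightarrow> real set \<Rightarrow> (real^3 \<Rightarrow> real^3^3) \<Rightarrow> (real^3 \<Rightarrow> real \<Rightarrow> real \<Rightarrow> real) \<Rightarrow> bool" where
  "Kr_bounded_L2 G I R \<sigma>0 \<longleftrightarrow>
     (let M = phase_measure G I; K = (\<lambda>f (x, \<omega>, E). Kr R I \<sigma>0 (\<lambda>x \<omega> E. f (x, \<omega>, E)) x \<omega> E) in
      \<exists>C::real. C \<ge> 0 \<and> (\<forall>f\<in>borel_measurable M. (\<integral>\<^sup>+ p. ennreal ((f p)^2) \<partial>M) < \<infinity> \<longrightarrow>
        (AE (x, \<omega>, E) in M.
           set_integrable lebesgue I (Kr_integrand R \<sigma>0 (\<lambda>x \<omega> E. f (x, \<omega>, E)) x \<omega> E)) \<and>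
        K f \<in> borel_measurable (completion M) \<and>
        (\<integral>\<^sup>+ p. ennreal ((K f p)^2) \<partial>completion M) \<le> ennreal C * (\<integral>\<^sup>+ p. ennreal ((f p)^2) \<partial>M)))"

definition transport_op ::
  "real \<Rightarrow> real \<Rightarrow> (real^3 \<Rightarrow> real^3^3) \<Rightarrow> (real^3 \<Rightarrow> real \<Rightarrow> real \<Rightarrow> real)
     \<Rightarrow> (real^3 \<Rightarrow> real \<Rightarrow> real \<Rightarrow> real) \<Rightarrow> (real^3 \<Rightarrow> real \<Rightarrow> real \<Rightarrow> real)
     \<Rightarrow> (real^3 \<Rightarrow> real^3 \<Rightarrow> real \<Rightarrow> real) \<Rightarrow> (real^3 \<Rightarrow> real^3 \<Rightarrow> real \<Rightarrow> real)
     \<Rightarrow> real^3 \<Rightarrow> real^3 \<Rightarrow> real \<Rightarrow> real" where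
  "transport_op E0 Em R \<sigma>0 \<sigma>1 \<sigma>2 Sig \<psi> x \<omega> E =
     - pf2 (\<lambda>E'. Kbar R \<sigma>2 \<psi> x \<omega> E' E) E Em
     + pf1 (\<lambda>E'. Kbar R \<sigma>1 \<psi> x \<omega> E' E) E Em
     + \<omega> \<bullet> grad (\<lambda>y. \<psi> y \<omega> E) x
     + Sig x \<omega> E * \<psi> x \<omega> E
     - Kr R {E0..Em} \<sigma>0 \<psi> x \<omega> E"

text \<open>
  The operator \<open>\<Sum>\<^bsub>|\<alpha>| \<le> 2\<^esub> a\<^sub>\<alpha>(E,\<omega>) \<partial>\<^sub>\<omega>\<^sup>\<alpha>\<close>.
\<close>

definition diff_op2_S ::
  "(nat^3 \<Rightarrow> real \<Rightarrow> real^3 \<Rightarrow> real) \<Rightarrow> (real^3 \<Rightarrow> real^3 \<Rightarrow> real \<Rightarrow> real)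
     \<Rightarrow> real^3 \<Rightarrow> real^3 \<Rightarrow> real \<Rightarrow> real" where
  "diff_op2_S a \<psi> x \<omega> E =
     (\<Sum>\<alpha> | (\<Sum>i\<in>UNIV. \<alpha> $ i) \<le> 2. a \<alpha> E \<omega> * multi_deriv_S \<alpha> (\<lambda>\<omega>. \<psi> x \<omega> E) \<omega>)"

end

theory Submission
  imports Defs
begin

text \<open>
  Fix \<open>x\<close> and \<open>\<omega>\<close>. A radial extension \<open>F\<close> is constant along rays, so the circle \<open>gam\<close> may be replaced by
  its central projection \<open>\<omega> + \<tau> d\<^sub>s\<close> onto the tangent plane at \<open>\<omega>\<close>, where \<open>d\<^sub>s\<close> runs through the unit
  circle and \<open>\<tau>\<^sup>2 = 2(E' - E) / (E(E' + 2))\<close> is rational. The circle average \<open>g(\<tau>)\<close> of \<open>F\<close> has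
  \<open>g'(0) = 0\<close> and \<open>g''(0) = \<pi> \<Delta>\<^sub>S\<close>, and three derivatives in \<open>\<omega>\<close> make \<open>g'(\<tau>)/\<tau>\<close> Lipschitz in \<open>\<tau>\<close>.
  Hence the integrand \<open>\<Phi>(E', E)\<close> of the finite part has first derivatives that are Hoelder continuous of
  exponent 1/2 at the diagonal, and \<open>g''(0)/2\<close> is what the chain rule contributes there.

  For such \<open>\<Phi>\<close> one substitutes \<open>E' = E + (b - E) v\<close>, which moves the singularity to the fixed point
  \<open>v = 0\<close>, and differentiates under the integral sign with the dominating function \<open>K v\<^bsup>-1/2\<^esup>\<close>. An
  integration by parts gives
  \<open>d/dE pf1 \<Phi> = pf2 \<Phi> + pf1 (\<partial>\<Phi>/\<partial>E) - (\<partial>\<Phi>/\<partial>E')(E, E)\<close>.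
\<close>

section \<open>Hadamard finite parts of functions with a square-root bound\<close>

text \<open>The obstacle is that \<tau> behaves like \<open>sqrt (E' - E)\<close>: its energy
  derivatives blow up like \<open>1/\<tau>\<close>, and a plain chain rule breaks down at the
  diagonal. The blow-up occurs only in the product \<open>g'(\<tau>) * (1/\<tau>)\<close>, which
  \<open>g'(0) = 0\<close> makes finite. What is left of it is a modulus of continuity of order
  \<open>sqrt (E' - E)\<close> for the partial derivatives; divided by \<open>E' - E\<close> it is
  still integrable, which fixes the exponent 1/2. The tangent plane is preferred to the circle
  itself because its points move on straight lines: repeated \<tau>-derivatives are iterated
  directional derivatives, without curvature terms. Joint differentiability of \<open>\<Phi>\<close>
  is used only for \<open>E < E'\<close>, so the derivative of its diagonal values enters
  separately. As \<open>\<tau>\<^sup>2\<close> is constantly 0 on the diagonal, its two partial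
  derivatives are opposite there and the Laplacian drops out of the derivative of
  \<open>\<Phi>(E, E)\<close>. It survives in the single term
  \<open>(\<partial>\<Phi>/\<partial>E')(E, E)\<close>, which is how the second order operator
  enters the formula.\<close>

lemma has_pf1_unique:
  assumes "has_pf1 f x b L" "has_pf1 f x b L'"
  shows "L = L'"
proof -
  obtain f0 f0' where *: "(f \<longlongrightarrow> f0) (at_right x)" "(f \<longlongrightarrow> f0') (at_right x)"
    "((\<lambda>\<epsilon>. (LINT t:{x+\<epsilon>..b}|lebesgue. f t / (t - x)) + f0 * ln \<epsilon>) \<longlongrightarrow> L) (at_right 0)"
    "((\<lambda>\<epsilon>. (LINT t:{x+\<epsilon>..b}|lebesgue. f t / (t - x)) + f0' * ln \<epsilon>) \<longlongrightarrow> L') (at_right 0)"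
    using assms unfolding has_pf1_def by blast
  have "f0 = f0'"
    using *(1,2) tendsto_unique trivial_limit_at_right_real by blast
  then show ?thesis
    using *(3,4) tendsto_unique trivial_limit_at_right_real by blast
qed

lemma pf1_eq: "has_pf1 f x b L \<Longrightarrow> pf1 f x b = L"
  unfolding pf1_def using has_pf1_unique by blast

lemma has_pf2_unique:
  assumes "has_pf2 f x b L" "has_pf2 f x b L'"
  shows "L = L'"
proof -
  obtain f0 f0' f1 f1' where *: "(f \<longlongrightarrow> f0) (at_right x)" "(f \<longlongrightarrow> f0') (at_right x)"
    "(deriv f \<longlongrightarrow> f1) (at_right x)" "(deriv f \<longlongrightarrow> f1') (at_right x)"
    "((\<lambda>\<epsilon>. (LINT t:{x+\<epsilon>..b}|lebesgue. f t / (t - x)^2) + f1 * ln \<epsilon> - f0 / \<epsilon>) \<longlongrightarrow> L) (at_right 0)"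
    "((\<lambda>\<epsilon>. (LINT t:{x+\<epsilon>..b}|lebesgue. f t / (t - x)^2) + f1' * ln \<epsilon> - f0' / \<epsilon>) \<longlongrightarrow> L') (at_right 0)"
    using assms unfolding has_pf2_def by blast
  have "f0 = f0'" "f1 = f1'"
    using *(1-4) tendsto_unique trivial_limit_at_right_real by blast+
  then show ?thesis
    using *(5,6) tendsto_unique trivial_limit_at_right_real by blast
qed

lemma pf2_eq: "has_pf2 f x b L \<Longrightarrow> pf2 f x b = L"
  unfolding pf2_def using has_pf2_unique by blast

lemma set_integral_eq_on:
  assumes "\<And>t. t \<in> A \<Longrightarrow> f t = g t"
  shows "set_integrable M A f \<longleftrightarrow> set_integrable M A g"
    and "(LINT t:A|M. f t) = (LINT t:A|M. (g t :: real))"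
proof -
  have "(\<lambda>t. indicator A t *\<^sub>R f t) = (\<lambda>t. indicator A t *\<^sub>R g t)"
    using assms by (auto simp: indicator_def)
  then show "set_integrable M A f \<longleftrightarrow> set_integrable M A g"
    "(LINT t:A|M. f t) = (LINT t:A|M. (g t :: real))"
    by (auto simp: set_integrable_def set_lebesgue_integral_def)
qed

lemma eventually_at_right_mem:
  fixes x b :: real
  assumes "x < b"
  shows "\<forall>\<^sub>F t in at_right x. x < t \<and> t < b"
  using assms eventually_at_right by blast

text \<open>The point \<open>t = x\<close> is excluded from the comparison. This lets formulas that
  are established only for \<open>E < E'\<close>, such as the one for the integrated gradient,
  replace the original integrand.\<close>

lemma has_pf1_cong:
  assumes "x < b" and eq: "\<And>t. x < t \<Longrightarrow> t \<le> b \<Longrightarrow> f t = g t" and f: "has_pf1 f x b L"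
  shows "has_pf1 g x b L"
proof -
  have ev: "\<forall>\<^sub>F t in at_right x. f t = g t"
    using eventually_at_right_mem[OF \<open>x < b\<close>] by eventually_elim (auto intro: eq)
  have int: "set_integrable lebesgue {x+\<epsilon>..b} (\<lambda>t. g t / (t - x)) \<longleftrightarrow>
      set_integrable lebesgue {x+\<epsilon>..b} (\<lambda>t. f t / (t - x))"
    "(LINT t:{x+\<epsilon>..b}|lebesgue. g t / (t - x)) = (LINT t:{x+\<epsilon>..b}|lebesgue. f t / (t - x))"
    if "\<epsilon> > 0" for \<epsilon>
    using that by (auto intro!: set_integral_eq_on simp: eq)
  obtain f0 where f0: "(f \<longlongrightarrow> f0) (at_right x)"
    "((\<lambda>\<epsilon>. (LINT t:{x+\<epsilon>..b}|lebesgue. f t / (t - x)) + f0 * ln \<epsilon>) \<longlongrightarrow> L) (at_right 0)"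
    using f unfolding has_pf1_def by blast
  have "(g \<longlongrightarrow> f0) (at_right x)"
    using tendsto_cong[OF ev] f0(1) by blast
  moreover have "\<forall>\<^sub>F \<epsilon> in at_right (0::real).
      (LINT t:{x+\<epsilon>..b}|lebesgue. f t / (t - x)) + f0 * ln \<epsilon> =
      (LINT t:{x+\<epsilon>..b}|lebesgue. g t / (t - x)) + f0 * ln \<epsilon>"
    using eventually_at_right_less[of 0] by (rule eventually_mono) (simp only: int)
  then have "((\<lambda>\<epsilon>. (LINT t:{x+\<epsilon>..b}|lebesgue. g t / (t - x)) + f0 * ln \<epsilon>) \<longlongrightarrow> L) (at_right 0)"
    by (rule Lim_transform_eventually[OF f0(2)])
  ultimately show ?thesis
    using f int unfolding has_pf1_def by blast
qed

lemma has_pf1_add: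
  assumes "has_pf1 f x b L" "has_pf1 g x b M"
  shows "has_pf1 (\<lambda>t. f t + g t) x b (L + M)"
proof -
  obtain f0 g0 where *: "(f \<longlongrightarrow> f0) (at_right x)" "(g \<longlongrightarrow> g0) (at_right x)"
    "((\<lambda>\<epsilon>. (LINT t:{x+\<epsilon>..b}|lebesgue. f t / (t - x)) + f0 * ln \<epsilon>) \<longlongrightarrow> L) (at_right 0)"
    "((\<lambda>\<epsilon>. (LINT t:{x+\<epsilon>..b}|lebesgue. g t / (t - x)) + g0 * ln \<epsilon>) \<longlongrightarrow> M) (at_right 0)"
    using assms unfolding has_pf1_def by blast
  have i: "set_integrable lebesgue {x+\<epsilon>..b} (\<lambda>t. f t / (t - x))"
      "set_integrable lebesgue {x+\<epsilon>..b} (\<lambda>t. g t / (t - x))" if "\<epsilon> > 0" for \<epsilon>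
    using assms that unfolding has_pf1_def by auto
  have "\<forall>\<^sub>F \<epsilon> in at_right (0::real).
      ((LINT t:{x+\<epsilon>..b}|lebesgue. f t / (t - x)) + f0 * ln \<epsilon>) +
      ((LINT t:{x+\<epsilon>..b}|lebesgue. g t / (t - x)) + g0 * ln \<epsilon>) =
      (LINT t:{x+\<epsilon>..b}|lebesgue. (f t + g t) / (t - x)) + (f0 + g0) * ln \<epsilon>"
    using eventually_at_right_less[of 0]
    by eventually_elim (simp add: add_divide_distrib set_integral_add(2)[OF i] distrib_right)
  then have "((\<lambda>\<epsilon>. (LINT t:{x+\<epsilon>..b}|lebesgue. (f t + g t) / (t - x)) + (f0 + g0) * ln \<epsilon>)
      \<longlongrightarrow> L + M) (at_right 0)"
    using tendsto_add[OF *(3,4)] by (rule Lim_transform_eventually[rotated])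
  then show ?thesis
    unfolding has_pf1_def using tendsto_add[OF *(1,2)] i
    by (auto simp: add_divide_distrib)
qed

section \<open>Finite parts of first order as convergent integrals\<close>

lemma integrable_on_inverse_sqrt_bound:
  fixes \<phi> :: "real \<Rightarrow> real"
  assumes "continuous_on {0<..1} \<phi>" "\<And>v. 0 < v \<Longrightarrow> v \<le> 1 \<Longrightarrow> \<bar>\<phi> v\<bar> \<le> K / sqrt v"
  shows "\<phi> integrable_on {0..1}"
proof -
  have 1: "((\<lambda>v. K * v powr (-1/2)) integrable_on {0..1})"
    using has_integral_mult_right[OF has_integral_powr_from_0[of "-1/2" 1], of K]
    by (auto simp: integrable_on_def)
  \<comment> \<open>Nothing is known about \<phi> at 0, so the comparison with
    \<open>K / sqrt v\<close> is made on the half-open interval; the missing point is a null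
    set.\<close>
  have "(\<lambda>v::real. K * v powr (-1/2)) integrable_on {0<..1}"
    by (rule integrable_spike_set[OF 1]) (auto intro: negligible_subset[OF negligible_sing[of 0]])
  moreover have "{0<..1::real} \<in> sets lebesgue" by simp
  moreover have "\<bar>\<phi> v\<bar> \<le> K * v powr (-1/2)" if "v \<in> {0<..1}" for v
    using assms(2)[of v] that by (simp add: powr_minus_divide powr_half_sqrt)
  ultimately have "\<phi> integrable_on {0<..1}"
    using continuous_imp_measurable_on_sets_lebesgue[OF assms(1)]
      measurable_bounded_by_integrable_imp_integrable_real by blast
  then show ?thesis
    by (rule integrable_spike_set) (auto intro: negligible_subset[OF negligible_sing[of 0]])
qed

lemma sqrt_divide_self: "0 < v \<Longrightarrow> C * sqrt (m * v) / v = C * sqrt m / sqrt v" for v :: real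
proof -
  assume "0 < v"
  then have "v = sqrt v * sqrt v" by simp
  then have "C * sqrt (m * v) / v = C * sqrt m * sqrt v / (sqrt v * sqrt v)"
    by (simp add: real_sqrt_mult)
  also have "\<dots> = C * sqrt m / sqrt v" using \<open>0 < v\<close> by (simp del: real_sqrt_mult_self)
  finally show ?thesis .
qed

lemma tendsto_sqrt_bound:
  fixes f :: "real \<Rightarrow> real"
  assumes "x < b" "\<And>t. x < t \<Longrightarrow> t \<le> b \<Longrightarrow> \<bar>f t - c\<bar> \<le> C * sqrt (t - x)"
  shows "(f \<longlongrightarrow> c) (at_right x)"
proof -
  have "((\<lambda>t. C * sqrt (t - x)) \<longlongrightarrow> C * sqrt (x - x)) (at_right x)"
    by (intro tendsto_intros)
  then have "((\<lambda>t. C * sqrt (t - x)) \<longlongrightarrow> 0) (at_right x)" by simp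
  moreover have "\<forall>\<^sub>F t in at_right x. norm (f t - c) \<le> C * sqrt (t - x)"
    using eventually_at_right_mem[OF assms(1)] by (rule eventually_mono) (simp add: assms(2))
  ultimately have "((\<lambda>t. f t - c) \<longlongrightarrow> 0) (at_right x)"
    by (rule Lim_null_comparison[rotated])
  then show ?thesis using Lim_null by blast
qed

text \<open>After \<open>t = x + (b - x) v\<close> the factor \<open>b - x\<close> of
  \<open>dt\<close> cancels against the one in \<open>t - x\<close>, so no Jacobian is left. The
  constant \<open>c\<close> stands for the right limit of \<open>f\<close> at \<open>x\<close>;
  subtracting it is what makes integrability at 0 possible. At \<open>v = 0\<close> the quotient is
  0 by the convention for division.\<close>

definition pf_quot :: "(real \<Rightarrow> real) \<Rightarrow> real \<Rightarrow> real \<Rightarrow> real \<Rightarrow> real \<Rightarrow> real" where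
  "pf_quot f c x b v = (f (x + (b - x) * v) - c) / v"

lemma affine_mem_segment:
  fixes x b v :: real
  assumes "x < b"
  shows "0 < v \<Longrightarrow> x < x + (b - x) * v" "v \<le> 1 \<Longrightarrow> x + (b - x) * v \<le> b"
proof -
  show "0 < v \<Longrightarrow> x < x + (b - x) * v" using assms by simp
  assume "v \<le> 1"
  then have "(b - x) * v \<le> (b - x) * 1" using assms by (intro mult_left_mono) auto
  then show "x + (b - x) * v \<le> b" by simp
qed

lemma pf_quot_bound:
  assumes "x < b" "\<And>t. x < t \<Longrightarrow> t \<le> b \<Longrightarrow> \<bar>f t - c\<bar> \<le> C * sqrt (t - x)" "0 < v" "v \<le> 1"
  shows "\<bar>pf_quot f c x b v\<bar> \<le> C * sqrt (b - x) / sqrt v"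
proof -
  have "\<bar>pf_quot f c x b v\<bar> \<le> C * sqrt ((b - x) * v) / v"
    using assms(2)[of "x + (b - x) * v"] affine_mem_segment[OF assms(1), of v] assms(3,4)
    by (simp add: pf_quot_def divide_right_mono)
  then show ?thesis using sqrt_divide_self[OF \<open>0 < v\<close>] by simp
qed

lemma pf_quot_continuous:
  assumes "x < b" "continuous_on {x<..b} f"
  shows "continuous_on {0<..1} (pf_quot f c x b)"
  unfolding pf_quot_def
  by (intro continuous_intros continuous_on_compose2[OF assms(2)])
    (use affine_mem_segment[OF assms(1)] in auto)

text \<open>The subtracted constant contributes \<open>c * ln ((b - x) / \<epsilon>)\<close> to the
  truncated integral. The counterterm \<open>c * ln \<epsilon>\<close> removes its divergent part
  and leaves \<open>c * ln (b - x)\<close>, so the finite part becomes a convergent integral over a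
  fixed interval plus an explicit term.\<close>

lemma has_pf1_sqrt_bound:
  assumes xb: "x < b" and f: "continuous_on {x<..b} f"
    and bd: "\<And>t. x < t \<Longrightarrow> t \<le> b \<Longrightarrow> \<bar>f t - c\<bar> \<le> C * sqrt (t - x)"
  shows "pf_quot f c x b integrable_on {0..1}"
    and "has_pf1 f x b (integral {0..1} (pf_quot f c x b) + c * ln (b - x))"
proof -
  let ?\<phi> = "pf_quot f c x b" and ?m = "b - x"
  show int: "?\<phi> integrable_on {0..1}"
    using pf_quot_bound[OF xb bd] pf_quot_continuous[OF xb f]
    by (intro integrable_on_inverse_sqrt_bound) auto
  have cont: "continuous_on {x+\<epsilon>..b} (\<lambda>t. f t / (t - x))" if "\<epsilon> > 0" for \<epsilon>
    using that by (intro continuous_intros continuous_on_subset[OF f]) auto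
  have abs: "set_integrable lebesgue {x+\<epsilon>..b} (\<lambda>t. f t / (t - x))" if "\<epsilon> > 0" for \<epsilon>
    by (rule absolutely_integrable_continuous_real[OF cont[OF that]])
  have val: "(LINT t:{x+\<epsilon>..b}|lebesgue. f t / (t - x)) + c * ln \<epsilon> =
      integral {\<epsilon> / ?m..1} ?\<phi> + c * ln ?m" if "0 < \<epsilon>" "\<epsilon> < ?m" for \<epsilon>
  proof -
    let ?d = "\<epsilon> / ?m"
    have d: "0 < ?d" "?d < 1" using that by auto
    have "((\<lambda>t. f t / (t - x)) has_integral (LINT t:{x+\<epsilon>..b}|lebesgue. f t / (t - x))) (cbox (x+\<epsilon>) b)"
      using has_integral_set_lebesgue[OF abs] that by simp
    from has_integral_affinity'[OF this, of ?m x]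
    have "((\<lambda>v. f (?m * v + x) / (?m * v)) has_integral
        (LINT t:{x+\<epsilon>..b}|lebesgue. f t / (t - x)) / ?m) {?d..1}"
      using xb by (simp add: field_simps)
    from has_integral_mult_right[OF this, of ?m]
    have 1: "((\<lambda>v. f (x + ?m * v) / v) has_integral
        (LINT t:{x+\<epsilon>..b}|lebesgue. f t / (t - x))) {?d..1}"
      using xb by (simp add: add.commute)
    have "((\<lambda>v. c / v) has_integral c * ln 1 - c * ln ?d) {?d..1}"
      using d by (intro fundamental_theorem_of_calculus)
        (auto intro!: derivative_eq_intros simp: has_real_derivative_iff_has_vector_derivative[symmetric])
    from has_integral_diff[OF 1 this]
    have "(?\<phi> has_integral (LINT t:{x+\<epsilon>..b}|lebesgue. f t / (t - x)) + c * ln ?d) {?d..1}"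
      by (simp add: pf_quot_def[abs_def] diff_divide_distrib)
    then have "integral {?d..1} ?\<phi> = (LINT t:{x+\<epsilon>..b}|lebesgue. f t / (t - x)) + c * ln ?d"
      by (rule integral_unique)
    then show ?thesis using that xb by (simp add: ln_div algebra_simps)
  qed
  have "((\<lambda>v. integral {v..1} ?\<phi>) \<longlongrightarrow> integral {0..1} ?\<phi>) (at_right 0)"
  proof -
    have "((\<lambda>v. integral {v..1} ?\<phi>) \<longlongrightarrow> integral {0..1} ?\<phi>) (at 0 within {0..1})"
      using indefinite_integral_continuous_1'[OF int] unfolding continuous_on by auto
    then show ?thesis by (simp add: at_within_Icc_at_right)
  qed
  moreover have "filterlim (\<lambda>\<epsilon>. \<epsilon> / ?m) (at_right 0) (at_right 0)"
    unfolding filterlim_at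
  proof
    have "((\<lambda>\<epsilon>. \<epsilon> / ?m) \<longlongrightarrow> 0 / ?m) (at_right 0)" using xb by (intro tendsto_intros) auto
    then show "((\<lambda>\<epsilon>. \<epsilon> / ?m) \<longlongrightarrow> 0) (at_right 0)" by simp
    show "\<forall>\<^sub>F \<epsilon> in at_right 0. \<epsilon> / ?m \<in> {0<..} \<and> \<epsilon> / ?m \<noteq> 0"
      using eventually_at_right_less[of 0] by eventually_elim (use xb in auto)
  qed
  ultimately have "((\<lambda>\<epsilon>. integral {\<epsilon> / ?m..1} ?\<phi>) \<longlongrightarrow> integral {0..1} ?\<phi>) (at_right 0)"
    by (rule filterlim_compose)
  then have "((\<lambda>\<epsilon>. integral {\<epsilon> / ?m..1} ?\<phi> + c * ln ?m) \<longlongrightarrow>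
      integral {0..1} ?\<phi> + c * ln ?m) (at_right 0)"
    by (intro tendsto_intros)
  moreover have "\<forall>\<^sub>F \<epsilon> in at_right 0. integral {\<epsilon> / ?m..1} ?\<phi> + c * ln ?m =
      (LINT t:{x+\<epsilon>..b}|lebesgue. f t / (t - x)) + c * ln \<epsilon>"
    using eventually_at_right_mem[of 0 ?m] xb by (auto elim!: eventually_mono simp: val)
  ultimately have "((\<lambda>\<epsilon>. (LINT t:{x+\<epsilon>..b}|lebesgue. f t / (t - x)) + c * ln \<epsilon>) \<longlongrightarrow>
      integral {0..1} ?\<phi> + c * ln ?m) (at_right 0)"
    by (rule Lim_transform_eventually)
  then show "has_pf1 f x b (integral {0..1} ?\<phi> + c * ln ?m)"
    unfolding has_pf1_def using abs tendsto_sqrt_bound[OF xb bd] by blast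
qed

section \<open>Finite parts of second order\<close>

lemma has_pf2_cong:
  assumes xb: "x < b" and eq: "\<And>t. x < t \<Longrightarrow> t \<le> b \<Longrightarrow> f t = g t" and f: "has_pf2 f x b L"
  shows "has_pf2 g x b L"
proof -
  have ev: "\<forall>\<^sub>F t in at_right x. f t = g t"
    using eventually_at_right_mem[OF xb] by eventually_elim (auto intro: eq)
  have near: "\<forall>\<^sub>F s in nhds t. f s = g s" if "x < t" "t < b" for t
    using eventually_nhds_in_open[of "{x<..<b}" t] that by (auto elim!: eventually_mono intro: eq)
  have int: "set_integrable lebesgue {x+\<epsilon>..b} (\<lambda>t. g t / (t - x)^2) \<longleftrightarrow>
      set_integrable lebesgue {x+\<epsilon>..b} (\<lambda>t. f t / (t - x)^2)"
    "(LINT t:{x+\<epsilon>..b}|lebesgue. g t / (t - x)^2) = (LINT t:{x+\<epsilon>..b}|lebesgue. f t / (t - x)^2)"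
    if "\<epsilon> > 0" for \<epsilon>
    using that by (auto intro!: set_integral_eq_on simp: eq)
  obtain f0 f1 where f0: "(f \<longlongrightarrow> f0) (at_right x)" "(deriv f \<longlongrightarrow> f1) (at_right x)"
    "((\<lambda>\<epsilon>. (LINT t:{x+\<epsilon>..b}|lebesgue. f t / (t - x)^2) + f1 * ln \<epsilon> - f0 / \<epsilon>) \<longlongrightarrow> L) (at_right 0)"
    and diff: "\<forall>\<^sub>F t in at_right x. f differentiable (at t)"
    using f unfolding has_pf2_def by blast
  have "(g \<longlongrightarrow> f0) (at_right x)"
    by (rule Lim_transform_eventually[OF f0(1) ev])
  moreover have "\<forall>\<^sub>F t in at_right x. deriv f t = deriv g t"
    using eventually_at_right_mem[OF xb]
    by (rule eventually_mono) (auto intro!: deriv_cong_ev near)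
  then have "(deriv g \<longlongrightarrow> f1) (at_right x)"
    by (rule Lim_transform_eventually[OF f0(2)])
  moreover have "\<forall>\<^sub>F \<epsilon> in at_right (0::real).
      (LINT t:{x+\<epsilon>..b}|lebesgue. f t / (t - x)^2) + f1 * ln \<epsilon> - f0 / \<epsilon> =
      (LINT t:{x+\<epsilon>..b}|lebesgue. g t / (t - x)^2) + f1 * ln \<epsilon> - f0 / \<epsilon>"
    using eventually_at_right_less[of 0] by (rule eventually_mono) (simp only: int)
  then have "((\<lambda>\<epsilon>. (LINT t:{x+\<epsilon>..b}|lebesgue. g t / (t - x)^2) + f1 * ln \<epsilon> - f0 / \<epsilon>) \<longlongrightarrow> L)
      (at_right 0)"
    by (rule Lim_transform_eventually[OF f0(3)])
  moreover have "\<forall>\<^sub>F t in at_right x. g differentiable (at t)"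
    using diff eventually_at_right_mem[OF xb]
  proof eventually_elim
    case (elim t)
    then obtain D where "(f has_real_derivative D) (at t)" by (auto simp: real_differentiable_def)
    with DERIV_cong_ev[OF refl near refl] elim(2) show ?case
      by (auto simp: real_differentiable_def)
  qed
  ultimately show ?thesis
    using f int unfolding has_pf2_def by blast
qed

text \<open>\<open>- f t / (t - x)\<close> is an antiderivative of
  \<open>f t / (t - x)^2 - f' t / (t - x)\<close>. Its value at the lower end yields
  \<open>f (x + \<epsilon>) / \<epsilon>\<close>, which splits into \<open>c / \<epsilon>\<close>,
  removed by the counterterm, and the quotient \<open>(f (x + \<epsilon>) - c) / \<epsilon>\<close>,
  whose limit \<open>d\<close> is the extra term of the result.\<close>

lemma has_pf2_by_parts:
  assumes xb: "x < b"
    and f: "\<And>t. x < t \<Longrightarrow> t \<le> b \<Longrightarrow> (f has_real_derivative f' t) (at t within {x..b})"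
    and f'_cont: "continuous_on {x<..b} f'"
    and f_lim: "(f \<longlongrightarrow> c) (at_right x)" and f'_lim: "(f' \<longlongrightarrow> d) (at_right x)"
    and f'_pf1: "has_pf1 f' x b L"
  shows "has_pf2 f x b (L + d - f b / (b - x))"
proof -
  have f_at: "(f has_real_derivative f' t) (at t)" if "x < t" "t < b" for t
    using f[of t] that at_within_interior[of t "{x..b}"] by auto
  have f_cont: "continuous_on {x<..b} f"
    by (auto simp: continuous_on_eq_continuous_within
        intro!: DERIV_continuous DERIV_subset[OF f])
  have cont2: "continuous_on {x+\<epsilon>..b} (\<lambda>t. f t / (t - x)^2)" if "\<epsilon> > 0" for \<epsilon>
    using that by (intro continuous_intros continuous_on_subset[OF f_cont]) auto
  have cont1: "continuous_on {x+\<epsilon>..b} (\<lambda>t. f' t / (t - x))" if "\<epsilon> > 0" for \<epsilon>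
    using that by (intro continuous_intros continuous_on_subset[OF f'_cont]) auto
  note int2 = absolutely_integrable_continuous_real[OF cont2]
    and int1 = absolutely_integrable_continuous_real[OF cont1]
  have ev_mem: "\<forall>\<^sub>F t in at_right x. x < t \<and> t < b"
    using xb by (rule eventually_at_right_mem)
  have ev_der: "\<forall>\<^sub>F t in at_right x. (f has_real_derivative f' t) (at t)"
    using ev_mem by (rule eventually_mono) (simp add: f_at)
  have "\<forall>\<^sub>F t in at_right x. f' t = deriv f t"
    using ev_der by (rule eventually_mono) (simp add: DERIV_imp_deriv)
  from Lim_transform_eventually[OF f'_lim this]
  have deriv_lim: "(deriv f \<longlongrightarrow> d) (at_right x)" .
  have diff: "\<forall>\<^sub>F t in at_right x. f differentiable (at t)"
    using ev_der by (rule eventually_mono) (auto simp: real_differentiable_def)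
  obtain f0 where f0: "(f' \<longlongrightarrow> f0) (at_right x)"
    "((\<lambda>\<epsilon>. (LINT t:{x+\<epsilon>..b}|lebesgue. f' t / (t - x)) + f0 * ln \<epsilon>) \<longlongrightarrow> L) (at_right 0)"
    using f'_pf1 unfolding has_pf1_def by blast
  have "f0 = d" using f0(1) f'_lim tendsto_unique trivial_limit_at_right_real by blast
  \<comment> \<open>The value of \<open>f\<close> at \<open>x\<close> is unknown, so the limit is
    obtained from l'Hospital's rule, with the right limit \<open>c\<close> in the place of
    \<open>f x\<close>.\<close>
  have quot: "((\<lambda>\<epsilon>. (f (x + \<epsilon>) - c) / \<epsilon>) \<longlongrightarrow> d) (at_right 0)"
  proof -
    have "((\<lambda>t. (f t - c) / (t - x)) \<longlongrightarrow> d) (at_right x)"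
    proof (rule lhopital_right)
      show "((\<lambda>t. f t - c) \<longlongrightarrow> 0) (at_right x)" using f_lim Lim_null by blast
      have "((\<lambda>t. t - x) \<longlongrightarrow> x - x) (at_right x)" by (intro tendsto_intros)
      then show "((\<lambda>t. t - x) \<longlongrightarrow> 0) (at_right x)" by simp
      show "\<forall>\<^sub>F t in at_right x. t - x \<noteq> 0"
        using ev_mem by (rule eventually_mono) simp
      show "\<forall>\<^sub>F t in at_right x. (1::real) \<noteq> 0" by simp
      show "\<forall>\<^sub>F t in at_right x. ((\<lambda>t. f t - c) has_real_derivative f' t) (at t)"
        using ev_der by (rule eventually_mono) (auto intro!: derivative_eq_intros)
      show "\<forall>\<^sub>F t in at_right x. ((\<lambda>t. t - x) has_real_derivative 1) (at t)"
        by (intro always_eventually allI) (auto intro!: derivative_eq_intros)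
      show "((\<lambda>t. f' t / 1) \<longlongrightarrow> d) (at_right x)" using f'_lim by simp
    qed
    then show ?thesis
      using filterlim_at_right_to_0[of "\<lambda>t. (f t - c) / (t - x)" _ x] by (simp add: add.commute)
  qed
  have val: "(LINT t:{x+\<epsilon>..b}|lebesgue. f' t / (t - x)) + f0 * ln \<epsilon> + (f (x + \<epsilon>) - c) / \<epsilon> - f b / (b - x)
      = (LINT t:{x+\<epsilon>..b}|lebesgue. f t / (t - x)^2) + d * ln \<epsilon> - c / \<epsilon>"
    if "0 < \<epsilon>" "\<epsilon> < b - x" for \<epsilon>
  proof -
    have "((\<lambda>t. f t / (t - x)^2 - f' t / (t - x)) has_integral
        (- f b / (b - x)) - (- f (x + \<epsilon>) / (x + \<epsilon> - x))) {x+\<epsilon>..b}"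
    proof (rule fundamental_theorem_of_calculus)
      show "x + \<epsilon> \<le> b" using that by simp
      fix t assume t: "t \<in> {x+\<epsilon>..b}"
      then have "(f has_real_derivative f' t) (at t within {x+\<epsilon>..b})"
        using f[of t] that by (auto intro: DERIV_subset)
      moreover have "t - x \<noteq> 0" using t that by simp
      ultimately have "((\<lambda>t. - f t / (t - x)) has_real_derivative f t / (t - x)^2 - f' t / (t - x))
          (at t within {x+\<epsilon>..b})"
      proof -
        have "- f' t * (t - x) + f t = f t - f' t * (t - x)" by simp
        then have "(- f' t * (t - x) - - f t * 1) / ((t - x) * (t - x)) = f t / (t - x)^2 - f' t / (t - x)"
          using \<open>t - x \<noteq> 0\<close> by (simp add: diff_divide_distrib power2_eq_square)
        moreover have "((\<lambda>t. - f t / (t - x)) has_real_derivative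
            (- f' t * (t - x) - - f t * 1) / ((t - x) * (t - x))) (at t within {x+\<epsilon>..b})"
          using \<open>(f has_real_derivative f' t) (at t within {x+\<epsilon>..b})\<close> \<open>t - x \<noteq> 0\<close>
          by (intro DERIV_divide) (auto intro!: derivative_eq_intros)
        ultimately show ?thesis by simp
      qed
      then show "((\<lambda>t. - f t / (t - x)) has_vector_derivative f t / (t - x)^2 - f' t / (t - x))
          (at t within {x+\<epsilon>..b})"
        by (simp add: has_real_derivative_iff_has_vector_derivative)
    qed
    then have "integral {x+\<epsilon>..b} (\<lambda>t. f t / (t - x)^2 - f' t / (t - x)) = f (x + \<epsilon>) / \<epsilon> - f b / (b - x)"
      by (simp add: integral_unique)
    moreover have "integral {x+\<epsilon>..b} (\<lambda>t. f t / (t - x)^2 - f' t / (t - x)) =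
        (LINT t:{x+\<epsilon>..b}|lebesgue. f t / (t - x)^2) - (LINT t:{x+\<epsilon>..b}|lebesgue. f' t / (t - x))"
      using set_lebesgue_integral_eq_integral[OF int2] set_lebesgue_integral_eq_integral[OF int1] that
      by (simp add: integral_diff)
    ultimately show ?thesis using \<open>f0 = d\<close> by (simp add: diff_divide_distrib)
  qed
  have "((\<lambda>\<epsilon>. (LINT t:{x+\<epsilon>..b}|lebesgue. f' t / (t - x)) + f0 * ln \<epsilon> + (f (x + \<epsilon>) - c) / \<epsilon>
      - f b / (b - x)) \<longlongrightarrow> L + d - f b / (b - x)) (at_right 0)"
    by (intro tendsto_diff tendsto_add f0(2) quot tendsto_const)
  moreover have "\<forall>\<^sub>F \<epsilon> in at_right 0.
      (LINT t:{x+\<epsilon>..b}|lebesgue. f' t / (t - x)) + f0 * ln \<epsilon> + (f (x + \<epsilon>) - c) / \<epsilon> - f b / (b - x)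
      = (LINT t:{x+\<epsilon>..b}|lebesgue. f t / (t - x)^2) + d * ln \<epsilon> - c / \<epsilon>"
    by (rule eventually_mono[OF eventually_at_right_mem[of 0 "b - x"]]) (use xb val in auto)
  ultimately have "((\<lambda>\<epsilon>. (LINT t:{x+\<epsilon>..b}|lebesgue. f t / (t - x)^2) + d * ln \<epsilon> - c / \<epsilon>)
      \<longlongrightarrow> L + d - f b / (b - x)) (at_right 0)"
    by (rule Lim_transform_eventually)
  then show ?thesis
    unfolding has_pf2_def using int2 diff f_lim deriv_lim by blast
qed

section \<open>Differentiation with respect to the lower limit\<close>

lemma has_real_derivative_integral_dominated:
  fixes \<phi> \<psi> :: "real \<Rightarrow> real \<Rightarrow> real"
  assumes "convex S" "E \<in> S"
    and der: "\<And>e v. e \<in> S \<Longrightarrow> v \<in> T \<Longrightarrow> ((\<lambda>e. \<phi> e v) has_real_derivative \<psi> e v) (at e within S)"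
    and bd: "\<And>e v. e \<in> S \<Longrightarrow> v \<in> T \<Longrightarrow> \<bar>\<psi> e v\<bar> \<le> h v" and h: "h integrable_on T"
    and \<phi>: "\<And>e. e \<in> S \<Longrightarrow> \<phi> e integrable_on T"
  shows "((\<lambda>e. integral T (\<phi> e)) has_real_derivative integral T (\<psi> E)) (at E within S)"
  unfolding has_field_derivative_iff tendsto_at_iff_sequentially
proof (intro allI impI)
  fix X :: "nat \<Rightarrow> real" assume X: "\<forall>i. X i \<in> S - {E}" "X \<longlonglongrightarrow> E"
  let ?f = "\<lambda>k v. (\<phi> (X k) v - \<phi> E v) / (X k - E)"
  have f_int: "?f k integrable_on T" for k
    using X \<phi> \<open>E \<in> S\<close> by (intro integrable_on_divide integrable_diff) auto
  have "(\<lambda>k. integral T (?f k)) \<longlonglongrightarrow> integral T (\<psi> E)"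
  proof (rule dominated_convergence[OF f_int h])
    fix k v assume v: "v \<in> T"
    \<comment> \<open>The mean value inequality on the convex set \<open>S\<close> turns the bound
      on the derivative into the domination of all difference quotients by \<open>h\<close>.\<close>
    have "norm (\<phi> (X k) v - \<phi> E v) \<le> h v * norm (X k - E)"
      using X \<open>E \<in> S\<close> der bd v
      by (intro field_differentiable_bound[OF \<open>convex S\<close>, of _ "\<lambda>e. \<psi> e v"]) auto
    then show "norm (?f k v) \<le> h v"
      using X by (simp add: divide_le_eq)
  next
    fix v assume v: "v \<in> T"
    show "(\<lambda>k. ?f k v) \<longlonglongrightarrow> \<psi> E v"
      using der[OF \<open>E \<in> S\<close> v] X
      unfolding has_field_derivative_iff tendsto_at_iff_sequentially comp_def by blast
  qed
  moreover have "integral T (?f k) = (integral T (\<phi> (X k)) - integral T (\<phi> E)) / (X k - E)" for k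
    using X \<phi> \<open>E \<in> S\<close> by (simp add: integral_diff)
  ultimately show "((\<lambda>y. (integral T (\<phi> y) - integral T (\<phi> E)) / (y - E)) \<circ> X) \<longlonglongrightarrow>
      integral T (\<psi> E)"
    by (simp add: comp_def del: integral_divide)
qed

text \<open>The constant is uniform in \<open>E\<close>, which later gives a dominating function
  independent of the energy. Comparisons are made only with the diagonal value at the same
  \<open>E\<close>, so that smooth functions and Lipschitz functions of \<open>sqrt (t - E)\<close>
  are covered alike. Boundedness is included to obtain closure under products.\<close>

definition diag_holder :: "real \<Rightarrow> real \<Rightarrow> (real \<Rightarrow> real \<Rightarrow> real) \<Rightarrow> bool" where
  "diag_holder a b f \<longleftrightarrow> (\<exists>C\<ge>0. \<forall>E t. a \<le> E \<and> E \<le> t \<and> t \<le> b \<longrightarrow>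
     \<bar>f t E\<bar> \<le> C \<and> \<bar>f t E - f E E\<bar> \<le> C * sqrt (t - E))"

lemma diag_holderI:
  assumes "\<And>E t. a \<le> E \<Longrightarrow> E \<le> t \<Longrightarrow> t \<le> b \<Longrightarrow> \<bar>f t E\<bar> \<le> B"
    and "\<And>E t. a \<le> E \<Longrightarrow> E \<le> t \<Longrightarrow> t \<le> b \<Longrightarrow> \<bar>f t E - f E E\<bar> \<le> C * sqrt (t - E)"
  shows "diag_holder a b f"
proof -
  have "\<bar>f t E\<bar> \<le> max 0 (max B C) \<and> \<bar>f t E - f E E\<bar> \<le> max 0 (max B C) * sqrt (t - E)"
    if "a \<le> E \<and> E \<le> t \<and> t \<le> b" for t E
    using assms[of E t] that mult_right_mono[of C "max 0 (max B C)" "sqrt (t - E)"] by force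
  then show ?thesis unfolding diag_holder_def by (intro exI[of _ "max 0 (max B C)"]) auto
qed

lemma diag_holderE:
  assumes "diag_holder a b f"
  obtains C where "C \<ge> 0" "\<And>E t. a \<le> E \<Longrightarrow> E \<le> t \<Longrightarrow> t \<le> b \<Longrightarrow> \<bar>f t E\<bar> \<le> C"
    "\<And>E t. a \<le> E \<Longrightarrow> E \<le> t \<Longrightarrow> t \<le> b \<Longrightarrow> \<bar>f t E - f E E\<bar> \<le> C * sqrt (t - E)"
  using assms unfolding diag_holder_def by blast

lemma diag_holder_add:
  assumes "diag_holder a b f" "diag_holder a b g"
  shows "diag_holder a b (\<lambda>t E. f t E + g t E)"
proof -
  obtain C D where C: "C \<ge> 0" "\<And>E t. a \<le> E \<Longrightarrow> E \<le> t \<Longrightarrow> t \<le> b \<Longrightarrow> \<bar>f t E\<bar> \<le> C"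
    "\<And>E t. a \<le> E \<Longrightarrow> E \<le> t \<Longrightarrow> t \<le> b \<Longrightarrow> \<bar>f t E - f E E\<bar> \<le> C * sqrt (t - E)"
    and D: "D \<ge> 0" "\<And>E t. a \<le> E \<Longrightarrow> E \<le> t \<Longrightarrow> t \<le> b \<Longrightarrow> \<bar>g t E\<bar> \<le> D"
    "\<And>E t. a \<le> E \<Longrightarrow> E \<le> t \<Longrightarrow> t \<le> b \<Longrightarrow> \<bar>g t E - g E E\<bar> \<le> D * sqrt (t - E)"
    using assms by (auto elim!: diag_holderE)
  show ?thesis
  proof (rule diag_holderI)
    fix E t assume t: "a \<le> E" "E \<le> t" "t \<le> b"
    show "\<bar>f t E + g t E\<bar> \<le> C + D" using C(2)[OF t] D(2)[OF t] by linarith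
    show "\<bar>f t E + g t E - (f E E + g E E)\<bar> \<le> (C + D) * sqrt (t - E)"
      using C(3)[OF t] D(3)[OF t] unfolding distrib_right by linarith
  qed
qed

lemma diag_holder_mult:
  assumes "diag_holder a b f" "diag_holder a b g"
  shows "diag_holder a b (\<lambda>t E. f t E * g t E)"
proof -
  obtain C D where C: "C \<ge> 0" "\<And>E t. a \<le> E \<Longrightarrow> E \<le> t \<Longrightarrow> t \<le> b \<Longrightarrow> \<bar>f t E\<bar> \<le> C"
    "\<And>E t. a \<le> E \<Longrightarrow> E \<le> t \<Longrightarrow> t \<le> b \<Longrightarrow> \<bar>f t E - f E E\<bar> \<le> C * sqrt (t - E)"
    and D: "D \<ge> 0" "\<And>E t. a \<le> E \<Longrightarrow> E \<le> t \<Longrightarrow> t \<le> b \<Longrightarrow> \<bar>g t E\<bar> \<le> D"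
    "\<And>E t. a \<le> E \<Longrightarrow> E \<le> t \<Longrightarrow> t \<le> b \<Longrightarrow> \<bar>g t E - g E E\<bar> \<le> D * sqrt (t - E)"
    using assms by (auto elim!: diag_holderE)
  show ?thesis
  proof (rule diag_holderI)
    fix E t assume t: "a \<le> E" "E \<le> t" "t \<le> b"
    show "\<bar>f t E * g t E\<bar> \<le> C * D"
      using C(2)[OF t] D(2)[OF t] C(1) by (simp add: abs_mult mult_mono)
    have "\<bar>f t E * g t E - f E E * g E E\<bar> = \<bar>(f t E - f E E) * g t E + f E E * (g t E - g E E)\<bar>"
      by (simp add: algebra_simps)
    also have "\<dots> \<le> \<bar>f t E - f E E\<bar> * \<bar>g t E\<bar> + \<bar>f E E\<bar> * \<bar>g t E - g E E\<bar>"
      using abs_triangle_ineq abs_mult by metis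
    also have "\<dots> \<le> (C * sqrt (t - E)) * D + C * (D * sqrt (t - E))"
      using C(2)[of E E] C(3)[OF t] D(2,3)[OF t] C(1) D(1) t
      by (intro add_mono mult_mono) auto
    finally show "\<bar>f t E * g t E - f E E * g E E\<bar> \<le> (2 * C * D) * sqrt (t - E)"
      by (simp add: algebra_simps)
  qed
qed

text \<open>On a bounded interval \<open>t - E\<close> is at most
  \<open>sqrt (b - a) * sqrt (t - E)\<close>, so a Lipschitz bound at the diagonal is
  enough.\<close>

lemma diag_holder_lipschitz:
  assumes "\<And>E t. a \<le> E \<Longrightarrow> E \<le> t \<Longrightarrow> t \<le> b \<Longrightarrow> \<bar>f t E\<bar> \<le> B"
    and L: "\<And>E t. a \<le> E \<Longrightarrow> E \<le> t \<Longrightarrow> t \<le> b \<Longrightarrow> \<bar>f t E - f E E\<bar> \<le> L * (t - E)"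
  shows "diag_holder a b f"
proof (rule diag_holderI)
  fix E t assume t: "a \<le> E" "E \<le> t" "t \<le> b"
  show "\<bar>f t E\<bar> \<le> B" by (rule assms(1)[OF t])
  have "L * (t - E) \<le> \<bar>L\<bar> * (sqrt (t - E) * sqrt (t - E))"
    using t by (simp add: mult_right_mono)
  also have "\<dots> \<le> \<bar>L\<bar> * (sqrt (b - a) * sqrt (t - E))"
    using t by (intro mult_left_mono mult_right_mono) auto
  finally show "\<bar>f t E - f E E\<bar> \<le> (\<bar>L\<bar> * sqrt (b - a)) * sqrt (t - E)"
    using L[OF t] by (simp add: algebra_simps)
qed

lemma has_pf1_diag_holder:
  assumes "diag_holder a b f" "a \<le> E" "E < b" "continuous_on {E<..b} (\<lambda>t. f t E)"
  shows "pf_quot (\<lambda>t. f t E) (f E E) E b integrable_on {0..1}"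
    and "has_pf1 (\<lambda>t. f t E) E b (integral {0..1} (pf_quot (\<lambda>t. f t E) (f E E) E b) + f E E * ln (b - E))"
proof -
  obtain C where "\<And>E t. a \<le> E \<Longrightarrow> E \<le> t \<Longrightarrow> t \<le> b \<Longrightarrow> \<bar>f t E - f E E\<bar> \<le> C * sqrt (t - E)"
    using assms(1) by (blast elim!: diag_holderE)
  then have "\<bar>f t E - f E E\<bar> \<le> C * sqrt (t - E)" if "E < t" "t \<le> b" for t
    using that assms(2) by simp
  note * = has_pf1_sqrt_bound[OF assms(3,4) this]
  show "pf_quot (\<lambda>t. f t E) (f E E) E b integrable_on {0..1}" by (rule *(1))
  show "has_pf1 (\<lambda>t. f t E) E b (integral {0..1} (pf_quot (\<lambda>t. f t E) (f E E) E b) + f E E * ln (b - E))"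
    by (rule *(2))
qed

lemma diag_holder_tendsto:
  assumes "diag_holder a b f" "a \<le> E" "E < b"
  shows "((\<lambda>t. f t E) \<longlongrightarrow> f E E) (at_right E)"
proof -
  obtain C where "\<And>E t. a \<le> E \<Longrightarrow> E \<le> t \<Longrightarrow> t \<le> b \<Longrightarrow> \<bar>f t E - f E E\<bar> \<le> C * sqrt (t - E)"
    using assms(1) by (blast elim!: diag_holderE)
  then have "\<bar>f t E - f E E\<bar> \<le> C * sqrt (t - E)" if "E < t" "t \<le> b" for t
    using that assms(2) by simp
  from tendsto_sqrt_bound[OF assms(3) this] show ?thesis .
qed

text \<open>By the representation of finite parts, the function to differentiate is
  \<open>J E + F E E * ln (b - E)\<close>. The term \<open>F1 E E\<close> in the conclusion
  compensates the limit term that integration by parts puts into \<open>M\<close>. The hypothesis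
  \<open>diag\<close> supplies the derivative along the diagonal, as \<open>der\<close> speaks only
  of \<open>E < t\<close>.\<close>

lemma pf1_has_derivative:
  fixes F F1 F2 :: "real \<Rightarrow> real \<Rightarrow> real"
  assumes der: "\<And>t E. a \<le> E \<Longrightarrow> E < t \<Longrightarrow> t \<le> b \<Longrightarrow>
      ((\<lambda>(t, E). F t E) has_derivative (\<lambda>(h, k). F1 t E * h + F2 t E * k))
        (at (t, E) within {a..b} \<times> {a..b})"
    and diag: "\<And>E. a \<le> E \<Longrightarrow> E < b \<Longrightarrow>
      ((\<lambda>E. F E E) has_real_derivative F1 E E + F2 E E) (at E within {a..b})"
    and hold: "diag_holder a b F" "diag_holder a b F1" "diag_holder a b F2"
    and cont: "\<And>E. a \<le> E \<Longrightarrow> E < b \<Longrightarrow> continuous_on {E<..b} (\<lambda>t. F1 t E)"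
      "\<And>E. a \<le> E \<Longrightarrow> E < b \<Longrightarrow> continuous_on {E<..b} (\<lambda>t. F2 t E)"
    and E: "a \<le> E" "E < b"
  shows "\<exists>P M L. has_pf1 (\<lambda>t. F t E) E b P \<and> has_pf2 (\<lambda>t. F t E) E b M \<and>
    has_pf1 (\<lambda>t. F2 t E) E b L \<and>
    ((\<lambda>E. pf1 (\<lambda>t. F t E) E b) has_real_derivative M + L - F1 E E) (at E within {a..b})"
proof -
  have der1: "((\<lambda>t. F t E) has_real_derivative F1 t E) (at t within {E..b})"
    if "a \<le> E" "E < t" "t \<le> b" for t E
  proof -
    have "((\<lambda>t. (t, E)) has_derivative (\<lambda>h. (h, 0))) (at t within {E..b})"
      by (auto intro!: derivative_eq_intros)
    from has_derivative_in_compose[OF this has_derivative_subset[OF der[OF that]]]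
    have "((\<lambda>t. F t E) has_derivative (\<lambda>h. F1 t E * h)) (at t within {E..b})"
      using that by fastforce
    then show ?thesis by (simp add: has_field_derivative_def)
  qed
  have F_cont: "continuous_on {E<..b} (\<lambda>t. F t E)" if "a \<le> E" for E
    using that by (auto simp: continuous_on_eq_continuous_within
        intro!: DERIV_continuous DERIV_subset[OF der1])
  define J where "J = (\<lambda>E. integral {0..1} (pf_quot (\<lambda>t. F t E) (F E E) E b))"
  have pf_F: "has_pf1 (\<lambda>t. F t E) E b (J E + F E E * ln (b - E))" if "a \<le> E" "E < b" for E
    unfolding J_def using has_pf1_diag_holder(2)[OF hold(1) that F_cont] that by blast
  \<comment> \<open>The point \<open>E + (b - E) v\<close> moves with speed \<open>1 - v\<close> in
    \<open>E\<close>, whence the weight at \<open>F1\<close>; the derivative of the subtracted value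
    \<open>F E E\<close> is \<open>F1 E E + F2 E E\<close>.\<close>
  define \<psi> where "\<psi> = (\<lambda>E v. ((1 - v) * F1 (E + (b - E) * v) E + F2 (E + (b - E) * v) E
      - (F1 E E + F2 E E)) / v)"
  obtain C1 where C1: "C1 \<ge> 0" "\<And>E t. a \<le> E \<Longrightarrow> E \<le> t \<Longrightarrow> t \<le> b \<Longrightarrow> \<bar>F1 t E\<bar> \<le> C1"
    "\<And>E t. a \<le> E \<Longrightarrow> E \<le> t \<Longrightarrow> t \<le> b \<Longrightarrow> \<bar>F1 t E - F1 E E\<bar> \<le> C1 * sqrt (t - E)"
    using hold(2) by (blast elim!: diag_holderE)
  obtain C2 where C2: "C2 \<ge> 0"
    "\<And>E t. a \<le> E \<Longrightarrow> E \<le> t \<Longrightarrow> t \<le> b \<Longrightarrow> \<bar>F2 t E - F2 E E\<bar> \<le> C2 * sqrt (t - E)"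
    using hold(3) by (blast elim!: diag_holderE)
  have ders: "((\<lambda>E. pf_quot (\<lambda>t. F t E) (F E E) E b v) has_real_derivative \<psi> E v) (at E within {a..<b})"
    if v: "v \<in> {0..1}" and E: "E \<in> {a..<b}" for E v
  proof (cases "v = 0")
    case True
    then show ?thesis by (simp add: pf_quot_def \<psi>_def)
  next
    case False
    then have v: "0 < v" "v \<le> 1" using that by auto
    have mem: "e < e + (b - e) * v \<and> e + (b - e) * v \<le> b" if "e < b" for e
      using affine_mem_segment[OF that] v by auto
    have "((\<lambda>E. (E + (b - E) * v, E)) has_derivative (\<lambda>h. (h * (1 - v), h))) (at E within {a..<b})"
      by (auto intro!: derivative_eq_intros simp: algebra_simps)
    from has_derivative_in_compose[OF this has_derivative_subset[OF der]]
    have "((\<lambda>E. F (E + (b - E) * v) E) has_derivative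
        (\<lambda>h. F1 (E + (b - E) * v) E * (h * (1 - v)) + F2 (E + (b - E) * v) E * h)) (at E within {a..<b})"
      using E mem by (force simp: image_subset_iff)
    then have 1: "((\<lambda>E. F (E + (b - E) * v) E) has_real_derivative
        (1 - v) * F1 (E + (b - E) * v) E + F2 (E + (b - E) * v) E) (at E within {a..<b})"
      unfolding has_field_derivative_def by (rule has_derivative_eq_rhs) (auto simp: algebra_simps)
    have 2: "((\<lambda>E. F E E) has_real_derivative F1 E E + F2 E E) (at E within {a..<b})"
      using E by (auto intro!: DERIV_subset[OF diag])
    show ?thesis
      unfolding pf_quot_def \<psi>_def by (intro DERIV_cdivide DERIV_diff 1 2)
  qed
  \<comment> \<open>The first two summands come from the bounds of \<open>F1\<close> and
    \<open>F2\<close> at the diagonal, where the distance \<open>(b - E) v\<close> is at most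
    \<open>(b - a) v\<close>. The last one comes from the term \<open>v * F1\<close>, since
    \<open>v \<le> sqrt v\<close> on the unit interval.\<close>
  define K where "K = C1 * sqrt (b - a) + C2 * sqrt (b - a) + C1"
  have \<psi>_bd: "\<bar>\<psi> E v\<bar> \<le> K * v powr (-1/2)" if v: "v \<in> {0..1}" and E: "E \<in> {a..<b}" for E v
  proof (cases "v = 0")
    case True
    then show ?thesis by (simp add: \<psi>_def)
  next
    case False
    then have v: "0 < v" "v \<le> 1" using that by auto
    let ?t = "E + (b - E) * v"
    have t: "a \<le> E" "E \<le> ?t" "?t \<le> b" using affine_mem_segment[of E b v] v E by auto
    have "\<bar>(1 - v) * F1 ?t E + F2 ?t E - (F1 E E + F2 E E)\<bar> =
        \<bar>(F1 ?t E - F1 E E) + (F2 ?t E - F2 E E) - v * F1 ?t E\<bar>"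
      by (simp add: algebra_simps)
    also have "\<dots> \<le> \<bar>F1 ?t E - F1 E E\<bar> + \<bar>F2 ?t E - F2 E E\<bar> + \<bar>v * F1 ?t E\<bar>"
      by linarith
    also have "\<dots> \<le> C1 * sqrt (?t - E) + C2 * sqrt (?t - E) + v * C1"
      using C1(2,3)[OF t] C2(2)[OF t] v by (intro add_mono) (auto simp: abs_mult)
    also have "\<dots> \<le> C1 * sqrt ((b - a) * v) + C2 * sqrt ((b - a) * v) + sqrt v * C1"
    proof (intro add_mono mult_left_mono mult_right_mono C1(1) C2(1))
      have "?t - E \<le> (b - a) * v" using E v by (simp add: mult_right_mono)
      then show "sqrt (?t - E) \<le> sqrt ((b - a) * v)" "sqrt (?t - E) \<le> sqrt ((b - a) * v)"
        by (rule real_sqrt_le_mono)+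
      have "v * v \<le> v" using v by (simp add: mult_left_le)
      then show "v \<le> sqrt v" using real_le_rsqrt[of v v] by (simp add: power2_eq_square)
    qed
    also have "\<dots> = K * sqrt v" unfolding K_def real_sqrt_mult by (simp add: distrib_right distrib_left mult_ac)
    finally have "\<bar>\<psi> E v\<bar> \<le> K * sqrt v / v"
      unfolding \<psi>_def using v by (simp add: divide_right_mono)
    also have "\<dots> = K * v powr (-1/2)"
      using sqrt_divide_self[of v K 1] v by (simp add: powr_minus_divide powr_half_sqrt)
    finally show ?thesis .
  qed
  have h_int: "(\<lambda>v. K * v powr (-1/2)) integrable_on {0..1}"
    using has_integral_mult_right[OF has_integral_powr_from_0[of "-1/2" 1], of K]
    by (auto simp: integrable_on_def)
  have J_der: "(J has_real_derivative integral {0..1} (\<psi> E)) (at E within {a..<b})"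
    unfolding J_def
    using has_pf1_diag_holder(1)[OF hold(1) _ _ F_cont] E
    by (intro has_real_derivative_integral_dominated[OF _ _ ders \<psi>_bd h_int]) auto
  \<comment> \<open>In the weight \<open>1 - v\<close> the part \<open>- v\<close> cancels the
    division by \<open>v\<close> and leaves \<open>F1\<close> itself, whose integral is explicit.
    Its contribution at \<open>t = b\<close> is the boundary term of
    \<open>has_pf2_by_parts\<close>, and the one at \<open>t = E\<close> cancels against the
    derivative of \<open>ln (b - E)\<close>. At \<open>v = 0\<close> the two integrands may differ,
    because \<open>\<psi> E 0\<close> is 0.\<close>
  have sub: "(\<psi> E has_integral
      integral {0..1} (pf_quot (\<lambda>t. F1 t E) (F1 E E) E b) +
      integral {0..1} (pf_quot (\<lambda>t. F2 t E) (F2 E E) E b) - (F b E - F E E) / (b - E)) {0..1}"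
  proof (rule has_integral_spike_finite[of "{0}"])
    have cont01: "continuous_on {0..1} (\<lambda>v. F (E + (b - E) * v) E)"
    proof -
      have "continuous_on {E..b} (\<lambda>t. F t E)"
        unfolding continuous_on_eq_continuous_within
      proof
        fix t assume t: "t \<in> {E..b}"
        show "continuous (at t within {E..b}) (\<lambda>t. F t E)"
        proof (cases "t = E")
          case True
          then show ?thesis
            using diag_holder_tendsto[OF hold(1) E] E
            by (simp add: continuous_within at_within_Icc_at_right)
        next
          case False
          then show ?thesis using t E by (intro DERIV_continuous[OF der1]) auto
        qed
      qed
      then show ?thesis
        by (rule continuous_on_compose2)
          (use E affine_mem_segment(2)[OF E(2)] in \<open>auto intro!: continuous_intros\<close>)
    qed
    \<comment> \<open>A derivative in \<open>t\<close> is available only for \<open>t > E\<close>,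
      so the fundamental theorem is used with continuity on the closed interval and derivatives in
      its interior.\<close>
    have "((\<lambda>v. (b - E) * F1 (E + (b - E) * v) E) has_integral
        F (E + (b - E) * 1) E - F (E + (b - E) * 0) E) {0..1}"
    proof (rule fundamental_theorem_of_calculus_interior[OF _ cont01])
      fix v :: real assume v: "v \<in> {0<..<1}"
      have "(b - E) * v < (b - E) * 1" using v E by (intro mult_strict_left_mono) auto
      then have "E + (b - E) * v < b" unfolding mult_1_right by linarith
      with affine_mem_segment(1)[OF E(2)] v have t: "E < E + (b - E) * v" "E + (b - E) * v < b" by auto
      then have "((\<lambda>t. F t E) has_real_derivative F1 (E + (b - E) * v) E) (at (E + (b - E) * v))"
        using der1[of E "E + (b - E) * v"] E
          at_within_interior[of "E + (b - E) * v" "{E..b}"] by auto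
      moreover have "((\<lambda>v. E + (b - E) * v) has_real_derivative b - E) (at v)"
        by (auto intro!: derivative_eq_intros)
      ultimately have "((\<lambda>v. F (E + (b - E) * v) E) has_real_derivative
          F1 (E + (b - E) * v) E * (b - E)) (at v)"
        by (rule DERIV_chain2[of "\<lambda>t. F t E"])
      then show "((\<lambda>v. F (E + (b - E) * v) E) has_vector_derivative
          (b - E) * F1 (E + (b - E) * v) E) (at v)"
        by (simp add: has_real_derivative_iff_has_vector_derivative mult.commute)
    qed simp
    from has_integral_divide[OF this, of "b - E"]
    have "((\<lambda>v. F1 (E + (b - E) * v) E) has_integral (F b E - F E E) / (b - E)) {0..1}"
      using E by simp
    then show "((\<lambda>v. pf_quot (\<lambda>t. F1 t E) (F1 E E) E b v + pf_quot (\<lambda>t. F2 t E) (F2 E E) E b v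
        - F1 (E + (b - E) * v) E) has_integral
      integral {0..1} (pf_quot (\<lambda>t. F1 t E) (F1 E E) E b) +
      integral {0..1} (pf_quot (\<lambda>t. F2 t E) (F2 E E) E b) - (F b E - F E E) / (b - E)) {0..1}"
      using has_pf1_diag_holder(1)[OF hold(2) E cont(1)[OF E]]
        has_pf1_diag_holder(1)[OF hold(3) E cont(2)[OF E]]
      by (intro has_integral_diff has_integral_add integrable_integral)
    show "\<psi> E v = pf_quot (\<lambda>t. F1 t E) (F1 E E) E b v + pf_quot (\<lambda>t. F2 t E) (F2 E E) E b v
        - F1 (E + (b - E) * v) E" if "v \<in> {0..1} - {0}" for v
      using that by (simp add: \<psi>_def pf_quot_def field_simps)
  qed simp
  define L1 where "L1 = integral {0..1} (pf_quot (\<lambda>t. F1 t E) (F1 E E) E b) + F1 E E * ln (b - E)"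
  define L2 where "L2 = integral {0..1} (pf_quot (\<lambda>t. F2 t E) (F2 E E) E b) + F2 E E * ln (b - E)"
  have L1: "has_pf1 (\<lambda>t. F1 t E) E b L1" and L2: "has_pf1 (\<lambda>t. F2 t E) E b L2"
    unfolding L1_def L2_def
    using has_pf1_diag_holder(2)[OF hold(2) E cont(1)[OF E]]
      has_pf1_diag_holder(2)[OF hold(3) E cont(2)[OF E]] by auto
  define M where "M = L1 + F1 E E - F b E / (b - E)"
  have M: "has_pf2 (\<lambda>t. F t E) E b M"
    unfolding M_def using E
    by (intro has_pf2_by_parts[OF E(2) der1 cont(1)[OF E] diag_holder_tendsto[OF hold(1) E]
        diag_holder_tendsto[OF hold(2) E] L1]) auto
  have "((\<lambda>E. J E + F E E * ln (b - E)) has_real_derivative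
      integral {0..1} (\<psi> E) + ((F1 E E + F2 E E) * ln (b - E) + F E E * (- 1 / (b - E))))
      (at E within {a..<b})"
    using E by (auto intro!: derivative_eq_intros J_der DERIV_subset[OF diag[OF E]])
  moreover have "integral {0..1} (\<psi> E) + ((F1 E E + F2 E E) * ln (b - E) + F E E * (- 1 / (b - E)))
      = M + L2 - F1 E E"
    unfolding integral_unique[OF sub] M_def L1_def L2_def by (simp add: diff_divide_distrib algebra_simps)
  ultimately have "((\<lambda>E. J E + F E E * ln (b - E)) has_real_derivative M + L2 - F1 E E) (at E within {a..<b})"
    by simp
  then have "((\<lambda>E. pf1 (\<lambda>t. F t E) E b) has_real_derivative M + L2 - F1 E E) (at E within {a..<b})"
    by (rule has_field_derivative_transform_within[of _ _ _ _ 1]) (use E pf1_eq[OF pf_F] in auto)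
  \<comment> \<open>The term \<open>ln (b - E)\<close> confined the computation to energies below
    \<open>b\<close>; as \<open>E < b\<close>, this does not change the derivative at
    \<open>E\<close>.\<close>
  moreover have "at E within {a..<b} = at E within {a..b}"
    by (rule at_within_nhd[of _ "{..<b}"]) (use E in auto)
  ultimately show ?thesis using pf_F[OF E] L2 M by auto
qed

section \<open>Derivatives of radial extensions\<close>

lemmas has_derivative_divide_const = bounded_linear.has_derivative[OF bounded_linear_divide]

lemma Ck_on_imp_continuous_on: "Ck_on k S f \<Longrightarrow> continuous_on S f"
  by (cases k) (auto intro: differentiable_imp_continuous_on)

lemma Ck_on_iter_deriv:
  assumes "Ck_on k S f" "set bs \<subseteq> Basis" "length bs \<le> k"
  shows "Ck_on (k - length bs) S (iter_deriv S bs f)"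
  using assms
proof (induction bs arbitrary: k f)
  case (Cons b bs)
  then obtain k' where "k = Suc k'" by (cases k) auto
  with Cons show ?case by auto
qed simp

text \<open>The list is processed from its head, so its last entry is the outermost derivative. In
  this form induction from the right can differentiate once more.\<close>

lemma iter_deriv_snoc:
  "iter_deriv S (bs @ [b]) f = (\<lambda>y. frechet_derivative (iter_deriv S bs f) (at y within S) b)"
  by (induction bs arbitrary: f) auto

lemma iter_deriv_has_derivative:
  fixes f :: "'a::euclidean_space \<Rightarrow> real"
  assumes "Ck_on k S f" "set bs \<subseteq> Basis" "length bs < k" "y \<in> S"
  shows "(iter_deriv S bs f has_derivative (\<lambda>h. \<Sum>b\<in>Basis. (h \<bullet> b) * iter_deriv S (bs @ [b]) f y))
    (at y within S)"
proof -
  let ?g = "iter_deriv S bs f"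
  obtain k' where "k - length bs = Suc k'" using assms(3) by (cases "k - length bs") auto
  with Ck_on_iter_deriv[OF assms(1,2)] assms(3) have "Ck_on (Suc k') S ?g" by auto
  then have *: "(?g has_derivative frechet_derivative ?g (at y within S)) (at y within S)"
    using \<open>y \<in> S\<close> by (simp add: differentiable_on_def frechet_derivative_works)
  let ?D = "frechet_derivative ?g (at y within S)"
  have "linear ?D" using has_derivative_linear[OF *] .
  then have "?D (\<Sum>b\<in>Basis. (h \<bullet> b) *\<^sub>R b) = (\<Sum>b\<in>Basis. (h \<bullet> b) * ?D b)" for h
    by (simp add: linear_sum linear_cmul)
  then have "?D h = (\<Sum>b\<in>Basis. (h \<bullet> b) * ?D b)" for h
    unfolding euclidean_representation .
  then have "?D = (\<lambda>h. \<Sum>b\<in>Basis. (h \<bullet> b) * ?D b)" by (rule ext)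
  from has_derivative_eq_rhs[OF * this] show ?thesis unfolding iter_deriv_snoc .
qed

lemma iter_deriv_Basis:
  fixes f :: "'a::euclidean_space \<Rightarrow> real"
  assumes "open S" "y \<in> S" "(iter_deriv S bs f has_derivative D) (at y)"
  shows "iter_deriv S (bs @ [b]) f y = D b"
  using frechet_derivative_at[OF assms(3)] at_within_open[OF assms(2,1)]
  by (simp add: iter_deriv_snoc)

lemma sum_inner_Basis_mult:
  "b \<in> Basis \<Longrightarrow> (\<Sum>b'\<in>Basis. (b \<bullet> b') * g b') = (g b :: real)"
proof -
  assume b: "b \<in> Basis"
  then have "(\<Sum>b'\<in>Basis. (b \<bullet> b') * g b') = (\<Sum>b'\<in>Basis. if b = b' then g b' else 0)"
    by (intro sum.cong) (auto simp: inner_Basis)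
  also have "\<dots> = g b" using b by simp
  finally show ?thesis .
qed

lemma open_Compl_0: "open (- {0 :: 'a::real_normed_vector})"
  by (simp add: open_Compl)

text \<open>The function space controls iterated derivatives of difference quotients in the energy,
  whereas limits are needed for difference quotients of iterated derivatives; linearity exchanges
  the two.\<close>

lemma iter_deriv_diff_quotient:
  fixes f g :: "'a::euclidean_space \<Rightarrow> real"
  assumes "open S" "Ck_on k S f" "Ck_on k S g" "set bs \<subseteq> Basis" "length bs \<le> k" "y \<in> S"
  shows "iter_deriv S bs (\<lambda>y. (f y - g y) / c) y = (iter_deriv S bs f y - iter_deriv S bs g y) / c"
  using assms(4-6)
proof (induction bs arbitrary: y rule: rev_induct)
  case (snoc b bs)
  let ?h = "\<lambda>y. (iter_deriv S bs f y - iter_deriv S bs g y) / c"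
  let ?D = "\<lambda>f h. \<Sum>b\<in>Basis. (h \<bullet> b) * iter_deriv S (bs @ [b]) f y"
  have "(?h has_derivative (\<lambda>h. (?D f h - ?D g h) / c)) (at y within S)"
    using snoc.prems
    by (intro has_derivative_divide_const has_derivative_diff iter_deriv_has_derivative[OF assms(2)]
        iter_deriv_has_derivative[OF assms(3)]) auto
  then have "(iter_deriv S bs (\<lambda>y. (f y - g y) / c) has_derivative (\<lambda>h. (?D f h - ?D g h) / c))
      (at y within S)"
    by (rule has_derivative_transform[rotated 2]) (use snoc in auto)
  then have "(iter_deriv S bs (\<lambda>y. (f y - g y) / c) has_derivative (\<lambda>h. (?D f h - ?D g h) / c)) (at y)"
    using at_within_open[OF snoc.prems(3) assms(1)] by simp
  from iter_deriv_Basis[OF assms(1) snoc.prems(3) this, of b]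
  show ?case using snoc.prems by (simp add: sum_inner_Basis_mult)
qed simp

text \<open>A radial extension is homogeneous of degree 0, and each partial derivative lowers the
  degree by one. In the induction step \<open>?g (c *\<^sub>R z)\<close> is differentiated in two
  ways, by the chain rule and through the scaling already known.\<close>

lemma iter_deriv_radial_scale:
  assumes f: "Ck_sphere k f" and "set bs \<subseteq> Basis" "length bs \<le> k" "y \<noteq> 0" "c > 0"
  shows "iter_deriv (- {0}) bs (radial f) (c *\<^sub>R y) = iter_deriv (- {0}) bs (radial f) y / c ^ length bs"
  using assms(2-4)
proof (induction bs arbitrary: y rule: rev_induct)
  case Nil
  then show ?case using \<open>c > 0\<close> by (simp add: radial_def sgn_scaleR)
next
  case (snoc b bs)
  let ?g = "iter_deriv (- {0}) bs (radial f)"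
  let ?D = "\<lambda>y h. \<Sum>b\<in>Basis. (h \<bullet> b) * iter_deriv (- {0}) (bs @ [b]) (radial f) y"
  have D: "(?g has_derivative ?D z) (at z)" if "z \<noteq> 0" for z
  proof -
    have "(?g has_derivative ?D z) (at z within - {0})"
      using snoc.prems that by (intro iter_deriv_has_derivative[OF f[unfolded Ck_sphere_def]]) auto
    then show ?thesis using at_within_open[OF _ open_Compl_0, of z] that by simp
  qed
  have "((\<lambda>z. ?g (c *\<^sub>R z)) has_derivative (\<lambda>h. ?D (c *\<^sub>R y) (c *\<^sub>R h))) (at y)"
    using snoc.prems \<open>c > 0\<close>
    by (intro has_derivative_compose[of "\<lambda>z. c *\<^sub>R z", OF _ D]) (auto intro!: derivative_eq_intros)
  moreover have "((\<lambda>z. ?g z / c ^ length bs) has_derivative (\<lambda>h. ?D y h / c ^ length bs)) (at y)"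
    using snoc.prems by (intro has_derivative_divide_const D)
  then have "((\<lambda>z. ?g (c *\<^sub>R z)) has_derivative (\<lambda>h. ?D y h / c ^ length bs)) (at y)"
    by (rule has_derivative_transform_within_open[of _ _ _ _ "- {0}"]) (use snoc in auto)
  ultimately have "(\<lambda>h. ?D (c *\<^sub>R y) (c *\<^sub>R h)) = (\<lambda>h. ?D y h / c ^ length bs)"
    by (rule has_derivative_unique)
  from fun_cong[OF this, of b]
  have "c * iter_deriv (- {0}) (bs @ [b]) (radial f) (c *\<^sub>R y) =
      iter_deriv (- {0}) (bs @ [b]) (radial f) y / c ^ length bs"
    using snoc.prems
    by (simp add: sum_inner_Basis_mult mult.assoc sum_distrib_left[symmetric])
  then show ?case using \<open>c > 0\<close> by (simp add: field_simps)
qed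

declare iter_deriv.simps(2) [simp del]

section \<open>Regularity in the energy\<close>

lemma Cm_into_Ck_sphere_imp_Ck:
  "Cm_into_Ck_sphere m I k u \<Longrightarrow> e \<in> I \<Longrightarrow> Ck_sphere k (u e)"
  by (cases m) auto

lemma tendsto_Ck_sphereD:
  assumes "tendsto_Ck_sphere UNIV k (\<lambda>p (_::unit). F p) (\<lambda>_. f) net" "set bs \<subseteq> Basis" "length bs \<le> k"
  shows "uniform_limit (sphere 0 1) (\<lambda>p. iter_deriv (- {0}) bs (radial (F p)))
    (iter_deriv (- {0}) bs (radial f)) net"
  using assms unfolding tendsto_Ck_sphere_def uniform_limit_iff by fastforce

lemma iter_deriv_radial_continuous:
  assumes "Ck_sphere k f" "set bs \<subseteq> Basis" "length bs \<le> k"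
  shows "continuous_on (- {0}) (iter_deriv (- {0}) bs (radial f))"
  using Ck_on_imp_continuous_on[OF Ck_on_iter_deriv] assms unfolding Ck_sphere_def by blast

text \<open>Homogeneity with the factor \<open>norm y\<close> carries statements about derivatives
  on the sphere to the whole punctured space.\<close>

lemma iter_deriv_radial_sgn:
  assumes "Ck_sphere k f" "set bs \<subseteq> Basis" "length bs \<le> k" "y \<noteq> 0"
  shows "iter_deriv (- {0}) bs (radial f) y =
    iter_deriv (- {0}) bs (radial f) (sgn y) / norm y ^ length bs"
  using iter_deriv_radial_scale[OF assms(1-3), of "sgn y" "norm y"] assms(4)
  by (simp add: sgn_div_norm)

lemma uniform_limit_quotient:
  assumes "e \<in> I" "set bs \<subseteq> Basis" "length bs \<le> k" "\<And>t. t \<in> I \<Longrightarrow> Ck_sphere k (u t)"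
    and "tendsto_Ck_sphere UNIV k (\<lambda>t (_::unit) \<omega>. (u t \<omega> - u e \<omega>) / (t - e)) (\<lambda>_. u') (at e within I)"
  shows "uniform_limit (sphere 0 1)
      (\<lambda>t y. (iter_deriv (- {0}) bs (radial (u t)) y - iter_deriv (- {0}) bs (radial (u e)) y) / (t - e))
      (iter_deriv (- {0}) bs (radial u')) (at e within I)"
proof -
  have *: "iter_deriv (- {0}) bs (radial (\<lambda>\<omega>. (u t \<omega> - u e \<omega>) / (t - e))) y =
      (iter_deriv (- {0}) bs (radial (u t)) y - iter_deriv (- {0}) bs (radial (u e)) y) / (t - e)"
    if "t \<in> I" "y \<in> sphere 0 1" for t y
  proof -
    have "y \<noteq> 0" using that by auto
    then show ?thesis
      using iter_deriv_diff_quotient[OF open_Compl_0 assms(4)[OF \<open>t \<in> I\<close>, unfolded Ck_sphere_def]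
          assms(4)[OF \<open>e \<in> I\<close>, unfolded Ck_sphere_def] assms(2,3), of y "t - e"]
      by (simp add: radial_def)
  qed
  have "\<forall>\<^sub>F t in at e within I. \<forall>y\<in>sphere 0 1.
      iter_deriv (- {0}) bs (radial (\<lambda>\<omega>. (u t \<omega> - u e \<omega>) / (t - e))) y =
      (iter_deriv (- {0}) bs (radial (u t)) y - iter_deriv (- {0}) bs (radial (u e)) y) / (t - e)"
    unfolding eventually_at using * by (intro exI[of _ 1]) auto
  from uniform_limit_cong[OF this, of "iter_deriv (- {0}) bs (radial u')" "iter_deriv (- {0}) bs (radial u')"]
  show ?thesis using tendsto_Ck_sphereD[OF assms(5,2,3)] by simp
qed

text \<open>The exchange of energy and space derivatives is built into the function space:
  difference quotients in the energy converge in the norm of \<open>C^k\<close>, hence so do their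
  space derivatives. Homogeneity then extends the limit from the sphere to \<open>y\<close>.\<close>

lemma Cm_into_Ck_sphere_energy_deriv:
  assumes u: "Cm_into_Ck_sphere (Suc m) I k u" and bs: "set bs \<subseteq> Basis" "length bs \<le> k"
    and e: "e \<in> I" and "y \<noteq> 0"
  shows "((\<lambda>e. iter_deriv (- {0}) bs (radial (u e)) y) has_real_derivative
    iter_deriv (- {0}) bs (radial (energy_deriv I u e)) y) (at e within I)"
proof -
  let ?\<omega> = "sgn y" and ?d = "\<lambda>f. iter_deriv (- {0}) bs (radial f)"
  have Ck: "Ck_sphere k (u t)" if "t \<in> I" for t
    using u that by (rule Cm_into_Ck_sphere_imp_Ck)
  have Ck': "Ck_sphere k (energy_deriv I u e)"
    using u e Cm_into_Ck_sphere_imp_Ck[of m I k "energy_deriv I u"] by auto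
  have "uniform_limit (sphere 0 1) (\<lambda>t y. (?d (u t) y - ?d (u e) y) / (t - e))
      (?d (energy_deriv I u e)) (at e within I)"
    using u e by (intro uniform_limit_quotient[OF e bs Ck]) auto
  from tendsto_uniform_limitI[OF this, of ?\<omega>]
  have "((\<lambda>e. ?d (u e) ?\<omega>) has_real_derivative ?d (energy_deriv I u e) ?\<omega>) (at e within I)"
    using \<open>y \<noteq> 0\<close> by (simp add: has_field_derivative_iff norm_sgn)
  then have "((\<lambda>e. ?d (u e) ?\<omega> / norm y ^ length bs) has_real_derivative
      ?d (energy_deriv I u e) ?\<omega> / norm y ^ length bs) (at e within I)"
    by (rule DERIV_cdivide)
  then have "((\<lambda>e. ?d (u e) ?\<omega> / norm y ^ length bs) has_real_derivative
      ?d (energy_deriv I u e) y) (at e within I)"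
    using iter_deriv_radial_sgn[OF Ck' bs \<open>y \<noteq> 0\<close>] by simp
  then show ?thesis
    by (rule has_field_derivative_transform_within[of _ _ _ _ 1])
      (use e iter_deriv_radial_sgn[OF Ck bs \<open>y \<noteq> 0\<close>] in auto)
qed

text \<open>For \<open>m = 0\<close> this is the definition. Otherwise the difference quotient is
  eventually within distance 1 of its bounded limit, so the increment is at most
  \<open>(\<bar>B\<bar> + 1) * \<bar>t - e\<bar>\<close> uniformly on the sphere.\<close>

lemma Cm_into_Ck_sphere_uniform_limit:
  assumes u: "Cm_into_Ck_sphere m I k u" and bs: "set bs \<subseteq> Basis" "length bs \<le> k" and e: "e \<in> I"
  shows "uniform_limit (sphere 0 1) (\<lambda>t. iter_deriv (- {0}) bs (radial (u t)))
    (iter_deriv (- {0}) bs (radial (u e))) (at e within I)"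
proof (cases m)
  case 0
  then show ?thesis using u e by (intro tendsto_Ck_sphereD[OF _ bs]) auto
next
  case (Suc m')
  let ?d = "\<lambda>f. iter_deriv (- {0}) bs (radial f)" and ?u' = "energy_deriv I u e"
  have Ck': "Ck_sphere k ?u'"
    using u e Cm_into_Ck_sphere_imp_Ck[of m' I k "energy_deriv I u"] Suc by auto
  have "continuous_on (sphere 0 1) (?d ?u')"
    by (rule continuous_on_subset[OF iter_deriv_radial_continuous[OF Ck' bs]]) auto
  then have "bounded (?d ?u' ` sphere 0 1)"
    using compact_continuous_image compact_imp_bounded compact_sphere by blast
  then obtain B where "\<forall>x\<in>?d ?u' ` sphere 0 1. norm x \<le> B"
    unfolding bounded_iff by blast
  then have B: "\<bar>?d ?u' y\<bar> \<le> B" if "y \<in> sphere 0 1" for y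
    using that by (simp del: mem_sphere)
  have "uniform_limit (sphere 0 1) (\<lambda>t y. (?d (u t) y - ?d (u e) y) / (t - e)) (?d ?u') (at e within I)"
    using u e Suc Cm_into_Ck_sphere_imp_Ck[OF u] by (intro uniform_limit_quotient[OF e bs]) auto
  then have ev: "\<forall>\<^sub>F t in at e within I. \<forall>y\<in>sphere 0 1.
      dist ((?d (u t) y - ?d (u e) y) / (t - e)) (?d ?u' y) < 1"
    unfolding uniform_limit_iff by auto
  show ?thesis unfolding uniform_limit_iff
  proof (intro allI impI)
    fix \<epsilon> :: real assume "\<epsilon> > 0"
    have "((\<lambda>t. (\<bar>B\<bar> + 1) * \<bar>t - e\<bar>) \<longlongrightarrow> (\<bar>B\<bar> + 1) * \<bar>e - e\<bar>) (at e within I)"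
      by (intro tendsto_intros)
    then have "\<forall>\<^sub>F t in at e within I. (\<bar>B\<bar> + 1) * \<bar>t - e\<bar> < \<epsilon>"
      using \<open>\<epsilon> > 0\<close> by (auto dest!: order_tendstoD(2)[of _ 0])
    moreover have "\<forall>\<^sub>F t in at e within I. t \<noteq> e" by (auto simp: eventually_at_filter)
    ultimately show "\<forall>\<^sub>F t in at e within I. \<forall>y\<in>sphere 0 1. dist (?d (u t) y) (?d (u e) y) < \<epsilon>"
      using ev
    proof eventually_elim
      case (elim t)
      show ?case
      proof
        fix y :: "real^3" assume y: "y \<in> sphere 0 1"
        let ?q = "(?d (u t) y - ?d (u e) y) / (t - e)"
        have "\<bar>?q\<bar> \<le> \<bar>B\<bar> + 1" using bspec[OF elim(3) y] B[OF y] unfolding dist_real_def by linarith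
        then have "\<bar>?q\<bar> * \<bar>t - e\<bar> \<le> (\<bar>B\<bar> + 1) * \<bar>t - e\<bar>" by (intro mult_right_mono) auto
        moreover have "\<bar>?q\<bar> * \<bar>t - e\<bar> = \<bar>?d (u t) y - ?d (u e) y\<bar>" using elim(2) by simp
        ultimately show "dist (?d (u t) y) (?d (u e) y) < \<epsilon>"
          using elim(1) by (simp add: dist_real_def)
      qed
    qed
  qed
qed

text \<open>Continuity in the energy is uniform over the sphere, so half of \<epsilon> is spent on
  moving \<open>t\<close> to \<open>e\<close> and half on moving \<open>z\<close> to
  \<open>y\<close> at the fixed energy \<open>e\<close>. Homogeneity removes the restriction to the
  sphere.\<close>

lemma Cm_into_Ck_sphere_continuous:
  assumes u: "Cm_into_Ck_sphere m I k u" and bs: "set bs \<subseteq> Basis" "length bs \<le> k"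
  shows "continuous_on (I \<times> - {0}) (\<lambda>(e, y). iter_deriv (- {0}) bs (radial (u e)) y)"
proof -
  let ?d = "\<lambda>e. iter_deriv (- {0}) bs (radial (u e))"
  have Ck: "Ck_sphere k (u t)" if "t \<in> I" for t
    using u that by (rule Cm_into_Ck_sphere_imp_Ck)
  have sph: "continuous_on (I \<times> sphere 0 1) (\<lambda>(e, y). ?d e y)"
    unfolding continuous_on_iff
  proof (intro ballI allI impI, clarify)
    fix e :: real and y :: "real^3" and \<epsilon> :: real
    assume e: "e \<in> I" and y: "y \<in> sphere 0 1" and "\<epsilon> > 0"
    have "\<forall>\<^sub>F t in at e within I. \<forall>z\<in>sphere 0 1. dist (?d t z) (?d e z) < \<epsilon>/2"
      using Cm_into_Ck_sphere_uniform_limit[OF u bs e] half_gt_zero[OF \<open>\<epsilon> > 0\<close>]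
      unfolding uniform_limit_iff by blast
    then obtain \<delta>1 where \<delta>1: "\<delta>1 > 0"
      "\<And>t z. t \<in> I \<Longrightarrow> t \<noteq> e \<Longrightarrow> dist t e < \<delta>1 \<Longrightarrow> z \<in> sphere 0 1 \<Longrightarrow> dist (?d t z) (?d e z) < \<epsilon>/2"
      unfolding eventually_at by blast
    have "continuous_on (sphere 0 1) (?d e)"
      by (rule continuous_on_subset[OF iter_deriv_radial_continuous[OF Ck[OF e] bs]]) auto
    then obtain \<delta>2 where \<delta>2: "\<delta>2 > 0"
      "\<And>z. z \<in> sphere 0 1 \<Longrightarrow> dist z y < \<delta>2 \<Longrightarrow> dist (?d e z) (?d e y) < \<epsilon>/2"
      using y \<open>\<epsilon> > 0\<close> unfolding continuous_on_iff by (meson half_gt_zero)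
    have "dist (?d t z) (?d e y) < \<epsilon>"
      if "t \<in> I" "z \<in> sphere 0 1" "dist (t, z) (e, y) < min \<delta>1 \<delta>2" for t z
    proof -
      have "dist t e < \<delta>1" "dist z y < \<delta>2"
        using that dist_fst_le[of "(t, z)" "(e, y)"] dist_snd_le[of "(t, z)" "(e, y)"] by auto
      then have "dist (?d e z) (?d e y) < \<epsilon>/2" using \<delta>2(2) that(2) by blast
      moreover have "dist (?d t z) (?d e z) < \<epsilon>/2"
        using \<delta>1(2)[OF that(1) _ \<open>dist t e < \<delta>1\<close> that(2)] \<open>\<epsilon> > 0\<close> by (cases "t = e") simp_all
      ultimately show ?thesis using dist_triangle[of "?d t z" "?d e y" "?d e z"] by linarith
    qed
    then show "\<exists>\<delta>>0. \<forall>p\<in>I \<times> sphere 0 1. dist p (e, y) < \<delta> \<longrightarrow>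
        dist (case p of (e, y) \<Rightarrow> ?d e y) (?d e y) < \<epsilon>"
      using \<delta>1(1) \<delta>2(1) by (intro exI[of _ "min \<delta>1 \<delta>2"]) auto
  qed
  have "continuous_on (I \<times> - {0}) (\<lambda>p. ?d (fst p) (sgn (snd p)) / norm (snd p) ^ length bs)"
    by (intro continuous_intros continuous_on_compose2[OF sph, of _ "\<lambda>p. (fst p, sgn (snd p))", simplified])
      (auto simp: norm_sgn)
  then show ?thesis
  proof (rule continuous_on_eq)
    fix p assume p: "p \<in> I \<times> (- {0} :: (real^3) set)"
    then have "fst p \<in> I" "snd p \<noteq> 0" by auto
    from iter_deriv_radial_sgn[OF Ck[OF this(1)] bs this(2)]
    show "?d (fst p) (sgn (snd p)) / norm (snd p) ^ length bs = (case p of (e, y) \<Rightarrow> ?d e y)"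
      by (simp add: case_prod_beta)
  qed
qed

section \<open>Gradient and Laplacian on the sphere\<close>

lemma iter_deriv_radial_has_derivative:
  assumes "Ck_sphere k f" "set bs \<subseteq> Basis" "length bs < k" "y \<noteq> 0"
  shows "(iter_deriv (- {0}) bs (radial f) has_derivative
    (\<lambda>h. \<Sum>b\<in>Basis. (h \<bullet> b) * iter_deriv (- {0}) (bs @ [b]) (radial f) y)) (at y)"
  using iter_deriv_has_derivative[OF assms(1)[unfolded Ck_sphere_def] assms(2,3), of y]
    at_within_open[OF _ open_Compl_0, of y] assms(4) by simp

text \<open>Euler's identity for a function that is homogeneous of degree
  \<open>- length bs\<close>, obtained by differentiating \<open>?g (c *\<^sub>R y)\<close> in
  \<open>c\<close> at 1.\<close>

lemma iter_deriv_radial_euler: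
  assumes "Ck_sphere k f" "set bs \<subseteq> Basis" "length bs < k" "y \<noteq> 0"
  shows "(\<Sum>b\<in>Basis. (y \<bullet> b) * iter_deriv (- {0}) (bs @ [b]) (radial f) y) =
    - real (length bs) * iter_deriv (- {0}) bs (radial f) y"
proof -
  let ?g = "iter_deriv (- {0}) bs (radial f)"
  have "((\<lambda>c. ?g (c *\<^sub>R y)) has_derivative
      (\<lambda>h. \<Sum>b\<in>Basis. ((h *\<^sub>R y) \<bullet> b) * iter_deriv (- {0}) (bs @ [b]) (radial f) ((1::real) *\<^sub>R y))) (at 1)"
    using assms
    by (intro has_derivative_compose[of "\<lambda>c. c *\<^sub>R y", OF _ iter_deriv_radial_has_derivative])
      (auto intro!: derivative_eq_intros)
  moreover have "((\<lambda>c::real. ?g y / c ^ length bs) has_real_derivative - real (length bs) * ?g y) (at 1)"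
    by (auto intro!: derivative_eq_intros)
  then have "((\<lambda>c. ?g (c *\<^sub>R y)) has_real_derivative - real (length bs) * ?g y) (at 1)"
    by (rule has_field_derivative_transform_within_open[of _ _ _ "{0<..}"])
      (use assms iter_deriv_radial_scale[OF assms(1,2)] in auto)
  then have "((\<lambda>c. ?g (c *\<^sub>R y)) has_derivative (\<lambda>h. - real (length bs) * ?g y * h)) (at 1)"
    unfolding has_field_derivative_def .
  ultimately have "(\<lambda>h. \<Sum>b\<in>Basis. ((h *\<^sub>R y) \<bullet> b) * iter_deriv (- {0}) (bs @ [b]) (radial f) ((1::real) *\<^sub>R y)) =
      (\<lambda>h. - real (length bs) * ?g y * h)"
    by (rule has_derivative_unique)
  from fun_cong[OF this, of 1] show ?thesis by simp
qed

lemma grad_eq: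
  assumes "GDERIV f x :> D"
  shows "grad f x = D"
  unfolding grad_def
proof (rule the_equality[where P="\<lambda>D. GDERIV f x :> D", OF assms])
  fix D' assume "GDERIV f x :> D'"
  with assms have "(\<lambda>h. h \<bullet> D') = (\<lambda>h. h \<bullet> D)"
    unfolding gderiv_def by (rule has_derivative_unique[rotated])
  then show "D' = D" by (metis vector_eq_ldot)
qed

lemma GDERIV_radial:
  assumes "Ck_sphere k f" "0 < k" "y \<noteq> 0"
  shows "GDERIV (radial f) y :> (\<Sum>b\<in>Basis. iter_deriv (- {0}) [b] (radial f) y *\<^sub>R b)"
  using iter_deriv_radial_has_derivative[OF assms(1), of "[]" y] assms(2,3)
  by (simp add: gderiv_def inner_sum_right mult.commute)

lemma grad_S_eq:
  assumes "Ck_sphere k f" "0 < k" "y \<noteq> 0"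
  shows "grad_S f y = (\<Sum>b\<in>Basis. iter_deriv (- {0}) [b] (radial f) y *\<^sub>R b)"
  unfolding grad_S_def by (rule grad_eq[OF GDERIV_radial[OF assms]])

lemma sum_Basis_vec:
  "(\<Sum>b\<in>(Basis::(real^'n::finite) set). g b) = (\<Sum>i\<in>UNIV. g (axis i 1))"
proof -
  have "(Basis::(real^'n) set) = (\<lambda>i. axis i 1) ` UNIV"
    by (auto simp: Basis_vec_def)
  show ?thesis
    unfolding \<open>Basis = _\<close> by (subst sum.reindex) (auto simp: inj_on_def axis_eq_axis)
qed

lemma trace_jacobian:
  fixes X :: "real^'n::finite \<Rightarrow> real^'n"
  assumes "(X has_derivative D) (at x)"
  shows "trace (jacobian X (at x)) = (\<Sum>b\<in>Basis. D b \<bullet> b)"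
  using frechet_derivative_at[OF assms]
  by (simp add: trace_def jacobian_def matrix_def sum_Basis_vec inner_axis)

text \<open>The gradient of a radial extension has degree -1, so \<open>radial (grad_S f)\<close> is
  \<open>norm y\<close> times it. Differentiating the factor \<open>norm y\<close> gives the sum of
  \<open>(\<omega> \<bullet> c) * ?p [c] \<omega>\<close>, which vanishes by Euler's identity; what
  remains is the trace of the Euclidean Hessian of the radial extension.\<close>

lemma laplace_S_eq:
  assumes f: "Ck_sphere k f" and k: "2 \<le> k" and \<omega>: "\<omega> \<in> sphere 0 1"
  shows "laplace_S f \<omega> = (\<Sum>b\<in>Basis. iter_deriv (- {0}) [b, b] (radial f) \<omega>)"
proof -
  let ?p = "\<lambda>bs. iter_deriv (- {0}) bs (radial f)"
  have \<omega>0: "\<omega> \<noteq> 0" and \<omega>1: "norm \<omega> = 1" using \<omega> by auto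
  have eq: "(\<Sum>b\<in>Basis. (norm y * ?p [b] y) *\<^sub>R b) = radial (grad_S f) y" if "y \<in> - {0}" for y
  proof -
    have "?p [b] (sgn y) = norm y * ?p [b] y" if "b \<in> Basis" for b
      using iter_deriv_radial_sgn[OF f, of "[b]" y] \<open>y \<in> - {0}\<close> that k by simp
    then show ?thesis
      using grad_S_eq[OF f, of "sgn y"] that k by (simp add: radial_def sgn_zero_iff)
  qed
  have "((\<lambda>y. \<Sum>b\<in>Basis. (norm y * ?p [b] y) *\<^sub>R b) has_derivative
      (\<lambda>h. \<Sum>b\<in>Basis. (norm \<omega> * (\<Sum>b'\<in>Basis. (h \<bullet> b') * ?p ([b] @ [b']) \<omega>) + (h \<bullet> sgn \<omega>) * ?p [b] \<omega>) *\<^sub>R b)) (at \<omega>)"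
    using k \<omega>0
    by (intro has_derivative_sum has_derivative_scaleR_left has_derivative_mult
        has_derivative_norm iter_deriv_radial_has_derivative[OF f]) auto
  then have "((radial (grad_S f)) has_derivative
      (\<lambda>h. \<Sum>b\<in>Basis. (norm \<omega> * (\<Sum>b'\<in>Basis. (h \<bullet> b') * ?p ([b] @ [b']) \<omega>) + (h \<bullet> sgn \<omega>) * ?p [b] \<omega>) *\<^sub>R b)) (at \<omega>)"
    by (rule has_derivative_transform_within_open[OF _ open_Compl_0]) (use \<omega>0 eq in auto)
  from trace_jacobian[OF this]
  have "laplace_S f \<omega> = (\<Sum>c\<in>Basis. (norm \<omega> * (\<Sum>b'\<in>Basis. (c \<bullet> b') * ?p ([c] @ [b']) \<omega>) + (c \<bullet> sgn \<omega>) * ?p [c] \<omega>))"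
    unfolding laplace_S_def div_S_def by (simp add: inner_sum_left_Basis)
  also have "\<dots> = (\<Sum>c\<in>Basis. ?p [c, c] \<omega> + (\<omega> \<bullet> c) * ?p [c] \<omega>)"
    using \<omega>1 by (intro sum.cong refl) (simp add: sum_inner_Basis_mult sgn_div_norm inner_commute)
  also have "\<dots> = (\<Sum>c\<in>Basis. ?p [c, c] \<omega>)"
    using iter_deriv_radial_euler[OF f, of "[]" \<omega>] k \<omega>0 by (simp add: sum.distrib)
  finally show ?thesis .
qed

lemma pderiv_radial:
  assumes f: "Ck_sphere k f" and k: "0 < k" and y: "y \<noteq> 0"
  shows "pderiv i (radial f) y = iter_deriv (- {0}) [axis i 1] (radial f) y"
proof -
  have "(iter_deriv (- {0}) [] (radial f) has_derivative frechet_derivative (radial f) (at y)) (at y)"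
    using iter_deriv_radial_has_derivative[OF f, of "[]" y] k y
    by (auto simp: frechet_derivative_works[symmetric] differentiable_def)
  from iter_deriv_Basis[OF open_Compl_0 _ this] y show ?thesis by (simp add: pderiv_def)
qed

lemma pderiv_pderiv_radial:
  assumes f: "Ck_sphere k f" and k: "2 \<le> k" and y: "y \<noteq> 0"
  shows "pderiv i (pderiv i (radial f)) y = iter_deriv (- {0}) [axis i 1, axis i 1] (radial f) y"
proof -
  let ?p = "\<lambda>bs. iter_deriv (- {0}) bs (radial f)"
  let ?D = "\<lambda>h. \<Sum>b\<in>Basis. (h \<bullet> b) * ?p ([axis i 1] @ [b]) y"
  have D: "(?p [axis i 1] has_derivative ?D) (at y)"
    using k y by (intro iter_deriv_radial_has_derivative[OF f]) (auto simp: axis_in_Basis_iff)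
  then have "(pderiv i (radial f) has_derivative ?D) (at y)"
    by (rule has_derivative_transform_within_open[OF _ open_Compl_0])
      (use y k pderiv_radial[OF f] in auto)
  from fun_cong[OF frechet_derivative_at[OF this], of "axis i 1"]
    iter_deriv_Basis[OF open_Compl_0 _ D, of "axis i 1"] y
  show ?thesis by (simp add: pderiv_def)
qed

lemma multi_deriv_S_axis:
  assumes "Ck_sphere k f" "2 \<le> k" "y \<noteq> 0"
  shows "multi_deriv_S (axis i 2) f y = iter_deriv (- {0}) [axis i 1, axis i 1] (radial f) y"
proof -
  have "multi_deriv_S (axis i 2) f y = pderiv i (pderiv i (radial f)) y"
    using exhaust_3[of i] by (auto simp: multi_deriv_S_def axis_def numeral_2_eq_2)
  then show ?thesis using pderiv_pderiv_radial[OF assms] by simp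
qed

lemma finite_multi_index: "finite {\<alpha>::nat^3. (\<Sum>i\<in>UNIV. \<alpha> $ i) \<le> n}"
proof (rule inj_on_finite)
  show "inj_on (\<lambda>\<alpha>::nat^3. (\<alpha> $ 1, \<alpha> $ 2, \<alpha> $ 3)) {\<alpha>. (\<Sum>i\<in>UNIV. \<alpha> $ i) \<le> n}"
    by (auto simp: inj_on_def vec_eq_iff forall_3)
  show "(\<lambda>\<alpha>::nat^3. (\<alpha> $ 1, \<alpha> $ 2, \<alpha> $ 3)) ` {\<alpha>. (\<Sum>i\<in>UNIV. \<alpha> $ i) \<le> n} \<subseteq> {..n} \<times> {..n} \<times> {..n}"
    by (auto simp: sum_3)
qed simp

text \<open>The spherical Laplacian is the sum of the three pure second derivatives of the radial
  extension, so a coefficient is put on the multi-indices \<open>axis i 2\<close> only. Finiteness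
  of the index set matters because a sum over an infinite set is 0 by convention.\<close>

lemma diff_op2_S_laplace:
  assumes f: "Ck_sphere k (\<lambda>\<omega>. \<phi> x \<omega> E)" and k: "2 \<le> k" and \<omega>: "\<omega> \<in> sphere 0 1"
  shows "diff_op2_S (\<lambda>\<alpha> E \<omega>. if \<alpha> \<in> range (\<lambda>i. axis i 2) then c E else 0) \<phi> x \<omega> E =
    c E * laplace_S (\<lambda>\<omega>. \<phi> x \<omega> E) \<omega>"
proof -
  let ?f = "\<lambda>\<omega>. \<phi> x \<omega> E" and ?A = "range (\<lambda>i::3. axis i (2::nat))"
  have sub: "?A \<subseteq> {\<alpha>. (\<Sum>i\<in>UNIV. \<alpha> $ i) \<le> 2}"
    by (auto simp: axis_def)
  have "diff_op2_S (\<lambda>\<alpha> E \<omega>. if \<alpha> \<in> ?A then c E else 0) \<phi> x \<omega> E =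
      (\<Sum>\<alpha>\<in>?A. c E * multi_deriv_S \<alpha> ?f \<omega>)"
    unfolding diff_op2_S_def
    by (rule sum.mono_neutral_cong_right[OF finite_multi_index sub]) auto
  also have "\<dots> = (\<Sum>i\<in>UNIV. c E * multi_deriv_S (axis i 2) ?f \<omega>)"
    by (subst sum.reindex) (auto simp: inj_on_def axis_eq_axis)
  also have "\<dots> = c E * (\<Sum>b\<in>Basis. iter_deriv (- {0}) [b, b] (radial ?f) \<omega>)"
    using multi_deriv_S_axis[OF f k, of \<omega>] \<omega> by (force simp: sum_Basis_vec sum_distrib_left)
  finally show ?thesis using laplace_S_eq[OF f k \<omega>] by simp
qed

section \<open>Averages of directional derivatives along circles\<close>

text \<open>The \<open>n\<close>-fold derivative at \<open>y\<close> in the direction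
  \<open>h\<close>, written out in coordinates; \<open>bs\<close> collects the partial derivatives
  taken so far and is generalised in inductions. Since \<open>h\<close> and \<open>y\<close> are
  independent arguments, joint continuity can be stated before both are tied to a tangent
  line.\<close>

fun dir_deriv :: "nat \<Rightarrow> (real^3) list \<Rightarrow> (real^3 \<Rightarrow> real) \<Rightarrow> real^3 \<Rightarrow> real^3 \<Rightarrow> real" where
  "dir_deriv 0 bs f h y = iter_deriv (- {0}) bs (radial f) y"
| "dir_deriv (Suc n) bs f h y = (\<Sum>b\<in>Basis. (h \<bullet> b) * dir_deriv n (bs @ [b]) f h y)"

text \<open>On a straight line the direction \<open>h\<close> is constant, so a differentiation in
  \<tau> only raises the order by one.\<close>

lemma dir_deriv_line:
  assumes "Ck_sphere k f" "set bs \<subseteq> Basis" "length bs + n < k" "y + \<tau> *\<^sub>R h \<noteq> 0"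
  shows "((\<lambda>\<tau>. dir_deriv n bs f h (y + \<tau> *\<^sub>R h)) has_real_derivative
    dir_deriv (Suc n) bs f h (y + \<tau> *\<^sub>R h)) (at \<tau>)"
  using assms(2,3)
proof (induction n arbitrary: bs)
  case 0
  let ?D = "\<lambda>v. \<Sum>b\<in>Basis. (v \<bullet> b) * iter_deriv (- {0}) (bs @ [b]) (radial f) (y + \<tau> *\<^sub>R h)"
  have "((\<lambda>\<tau>. iter_deriv (- {0}) bs (radial f) (y + \<tau> *\<^sub>R h)) has_derivative (\<lambda>t. ?D (t *\<^sub>R h))) (at \<tau>)"
    using 0 assms(1,4)
    by (intro has_derivative_compose[of "\<lambda>\<tau>. y + \<tau> *\<^sub>R h", OF _ iter_deriv_radial_has_derivative])
      (auto intro!: derivative_eq_intros)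
  moreover have "(\<lambda>t. ?D (t *\<^sub>R h)) = (*) (?D h)"
    by (auto simp: sum_distrib_left sum_distrib_right mult_ac)
  ultimately show ?case by (simp add: has_field_derivative_def)
next
  case (Suc n)
  have "((\<lambda>\<tau>. \<Sum>b\<in>Basis. (h \<bullet> b) * dir_deriv n (bs @ [b]) f h (y + \<tau> *\<^sub>R h)) has_real_derivative
      (\<Sum>b\<in>Basis. (h \<bullet> b) * dir_deriv (Suc n) (bs @ [b]) f h (y + \<tau> *\<^sub>R h))) (at \<tau>)"
    using Suc.prems by (intro DERIV_sum DERIV_cmult Suc.IH) auto
  then show ?case by simp
qed

lemma dir_deriv_energy:
  assumes "Cm_into_Ck_sphere (Suc m) I k u" "set bs \<subseteq> Basis" "length bs + n \<le> k" "e \<in> I" "y \<noteq> 0"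
  shows "((\<lambda>e. dir_deriv n bs (u e) h y) has_real_derivative
    dir_deriv n bs (energy_deriv I u e) h y) (at e within I)"
  using assms(2,3)
proof (induction n arbitrary: bs)
  case 0
  then show ?case
    using Cm_into_Ck_sphere_energy_deriv[OF assms(1) _ _ assms(4,5)] by simp
next
  case (Suc n)
  have "((\<lambda>e. \<Sum>b\<in>Basis. (h \<bullet> b) * dir_deriv n (bs @ [b]) (u e) h y) has_real_derivative
      (\<Sum>b\<in>Basis. (h \<bullet> b) * dir_deriv n (bs @ [b]) (energy_deriv I u e) h y)) (at e within I)"
    using Suc.prems by (intro DERIV_sum DERIV_cmult Suc.IH) auto
  then show ?case by simp
qed

lemma dir_deriv_continuous:
  assumes "Cm_into_Ck_sphere m I k u" "set bs \<subseteq> Basis" "length bs + n \<le> k"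
  shows "continuous_on (I \<times> UNIV \<times> - {0}) (\<lambda>(e, h, y). dir_deriv n bs (u e) h y)"
  using assms(2,3)
proof (induction n arbitrary: bs)
  case 0
  have "continuous_on (I \<times> UNIV \<times> - {0}) (\<lambda>p. case (fst p, snd (snd p)) of (e, y) \<Rightarrow>
      iter_deriv (- {0}) bs (radial (u e)) y)"
    using 0 by (intro continuous_on_compose2[OF Cm_into_Ck_sphere_continuous[OF assms(1)]])
      (auto intro!: continuous_intros)
  then show ?case by (simp add: case_prod_unfold)
next
  case (Suc n)
  have "continuous_on (I \<times> UNIV \<times> - {0})
      (\<lambda>p. \<Sum>b\<in>Basis. (fst (snd p) \<bullet> b) * (case p of (e, h, y) \<Rightarrow> dir_deriv n (bs @ [b]) (u e) h y))"
    using Suc.prems by (intro continuous_intros Suc.IH) auto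
  then show ?case by (simp add: case_prod_unfold)
qed

definition circ :: "real^3 \<Rightarrow> real^3 \<Rightarrow> real \<Rightarrow> real^3" where
  "circ p q s = cos s *\<^sub>R p + sin s *\<^sub>R q"

text \<open>For \<open>n = 0\<close> this is the circle average, and for larger \<open>n\<close> its
  \<open>n\<close>-th derivative in \<tau>, with the differentiation already carried out under the
  integral.\<close>

definition ray_avg :: "real^3 \<Rightarrow> real^3 \<Rightarrow> real^3 \<Rightarrow> nat \<Rightarrow> (real^3 \<Rightarrow> real) \<Rightarrow> real \<Rightarrow> real" where
  "ray_avg p q w n f \<tau> =
     integral {0..2*pi} (\<lambda>s. dir_deriv n [] f (circ p q s) (w + \<tau> *\<^sub>R circ p q s))"

text \<open>\<open>parseval\<close> states that the orthonormal triple is complete. It enters where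
  a trace in the frame is compared with a trace in coordinates.\<close>

locale frame =
  fixes p q w :: "real^3"
  assumes norm: "p \<bullet> p = 1" "q \<bullet> q = 1" "w \<bullet> w = 1"
    and orth: "p \<bullet> q = 0" "w \<bullet> p = 0" "w \<bullet> q = 0"
    and parseval: "x \<bullet> y = (p \<bullet> x) * (p \<bullet> y) + (q \<bullet> x) * (q \<bullet> y) + (w \<bullet> x) * (w \<bullet> y)"
begin

lemma w_sphere: "w \<in> sphere 0 1"
  using norm by (simp add: norm_eq_sqrt_inner)

text \<open>The component along \<open>w\<close> is always 1, so tangent lines stay in the domain of
  radial extensions for every real \<tau>.\<close>

lemma line_nonzero: "w + \<tau> *\<^sub>R circ p q s \<noteq> 0"
proof
  assume "w + \<tau> *\<^sub>R circ p q s = 0"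
  then have "w \<bullet> (w + \<tau> *\<^sub>R circ p q s) = 0" by simp
  then show False using norm orth by (simp add: circ_def inner_add_right)
qed

lemma integrand_continuous:
  assumes "Cm_into_Ck_sphere m I k u" "n \<le> k"
  shows "continuous_on ((I \<times> UNIV) \<times> {0..2*pi}) (\<lambda>z. dir_deriv n [] (u (fst (fst z)))
    (circ p q (snd z)) (w + snd (fst z) *\<^sub>R circ p q (snd z)))"
proof -
  have "continuous_on ((I \<times> UNIV) \<times> {0..2*pi}) (\<lambda>z. case (fst (fst z), circ p q (snd z),
      w + snd (fst z) *\<^sub>R circ p q (snd z)) of (e, h, y) \<Rightarrow> dir_deriv n [] (u e) h y)"
    unfolding circ_def
    by (intro continuous_on_compose2[OF dir_deriv_continuous[OF assms(1)]])
      (use assms(2) line_nonzero in \<open>auto simp: circ_def intro!: continuous_intros\<close>)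
  then show ?thesis by (simp add: case_prod_unfold)
qed

lemma integrand_continuous_on:
  assumes "Cm_into_Ck_sphere m I k u" "n \<le> k" "e \<in> I"
  shows "continuous_on {0..2*pi} (\<lambda>s. dir_deriv n [] (u e) (circ p q s) (w + \<tau> *\<^sub>R circ p q s))"
  by (rule continuous_on_compose2[OF integrand_continuous[OF assms(1,2)],
        of "{0..2*pi}" "\<lambda>s. ((e, \<tau>), s)", unfolded fst_conv snd_conv])
    (use assms(3) in \<open>auto intro!: continuous_intros\<close>)

lemma ray_avg_continuous:
  assumes "Cm_into_Ck_sphere m I k u" "n \<le> k"
  shows "continuous_on (I \<times> UNIV) (\<lambda>(e, \<tau>). ray_avg p q w n (u e) \<tau>)"
proof -
  have "continuous_on (I \<times> UNIV) (\<lambda>z. integral (cbox 0 (2*pi)) (\<lambda>s.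
      dir_deriv n [] (u (fst z)) (circ p q s) (w + snd z *\<^sub>R circ p q s)))"
    using integrand_continuous[OF assms]
    by (intro integral_continuous_on_param) (simp add: case_prod_unfold)
  then show ?thesis by (simp add: ray_avg_def case_prod_unfold)
qed

lemma ray_avg_deriv:
  assumes u: "Cm_into_Ck_sphere m I k u" and n: "n < k" and e: "e \<in> I"
  shows "((\<lambda>\<tau>. ray_avg p q w n (u e) \<tau>) has_real_derivative ray_avg p q w (Suc n) (u e) \<tau>) (at \<tau>)"
proof -
  have "((\<lambda>\<tau>. integral (cbox 0 (2*pi)) (\<lambda>s. dir_deriv n [] (u e) (circ p q s) (w + \<tau> *\<^sub>R circ p q s)))
      has_real_derivative
      integral (cbox 0 (2*pi)) (\<lambda>s. dir_deriv (Suc n) [] (u e) (circ p q s) (w + \<tau> *\<^sub>R circ p q s)))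
      (at \<tau> within UNIV)"
  proof (rule leibniz_rule_field_derivative)
    show "((\<lambda>\<tau>. dir_deriv n [] (u e) (circ p q s) (w + \<tau> *\<^sub>R circ p q s)) has_real_derivative
        dir_deriv (Suc n) [] (u e) (circ p q s) (w + \<tau> *\<^sub>R circ p q s)) (at \<tau>)" for \<tau> s
      using n by (intro dir_deriv_line[OF Cm_into_Ck_sphere_imp_Ck[OF u e]] line_nonzero) auto
    show "(\<lambda>s. dir_deriv n [] (u e) (circ p q s) (w + \<tau> *\<^sub>R circ p q s)) integrable_on cbox 0 (2*pi)" for \<tau>
      using integrand_continuous_on[OF u _ e] n by (auto intro!: integrable_continuous_real)
    have "continuous_on (UNIV \<times> {0..2*pi})
        (\<lambda>z. dir_deriv (Suc n) [] (u e) (circ p q (snd z)) (w + fst z *\<^sub>R circ p q (snd z)))"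
      by (rule continuous_on_compose2[OF integrand_continuous[OF u, of "Suc n"],
            of "UNIV \<times> {0..2*pi}" "\<lambda>z. ((e, fst z), snd z)", unfolded fst_conv snd_conv])
        (use e n in \<open>auto intro!: continuous_intros\<close>)
    then show "continuous_on (UNIV \<times> cbox 0 (2*pi))
        (\<lambda>(\<tau>, s). dir_deriv (Suc n) [] (u e) (circ p q s) (w + \<tau> *\<^sub>R circ p q s))"
      by (simp add: case_prod_unfold del: dir_deriv.simps)
  qed auto
  then show ?thesis by (simp add: ray_avg_def)
qed

lemma ray_avg_energy_deriv:
  assumes u: "Cm_into_Ck_sphere (Suc m) I k u" and n: "n \<le> k" and e: "e \<in> I" and I: "convex I"
  shows "((\<lambda>e. ray_avg p q w n (u e) \<tau>) has_real_derivative ray_avg p q w n (energy_deriv I u e) \<tau>)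
    (at e within I)"
proof -
  have u': "Cm_into_Ck_sphere m I k (energy_deriv I u)" using u by simp
  have "((\<lambda>e. integral (cbox 0 (2*pi)) (\<lambda>s. dir_deriv n [] (u e) (circ p q s) (w + \<tau> *\<^sub>R circ p q s)))
      has_real_derivative
      integral (cbox 0 (2*pi)) (\<lambda>s. dir_deriv n [] (energy_deriv I u e) (circ p q s) (w + \<tau> *\<^sub>R circ p q s)))
      (at e within I)"
  proof (rule leibniz_rule_field_derivative[OF _ _ _ e I])
    show "((\<lambda>e. dir_deriv n [] (u e) (circ p q s) (w + \<tau> *\<^sub>R circ p q s)) has_real_derivative
        dir_deriv n [] (energy_deriv I u e) (circ p q s) (w + \<tau> *\<^sub>R circ p q s)) (at e within I)"
      if "e \<in> I" for e s
      using n that by (intro dir_deriv_energy[OF u] line_nonzero) auto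
    show "(\<lambda>s. dir_deriv n [] (u e) (circ p q s) (w + \<tau> *\<^sub>R circ p q s)) integrable_on cbox 0 (2*pi)"
      if "e \<in> I" for e
      using integrand_continuous_on[OF u n that] by (auto intro!: integrable_continuous_real)
    have "continuous_on (I \<times> {0..2*pi}) (\<lambda>z. dir_deriv n [] (energy_deriv I u (fst z))
        (circ p q (snd z)) (w + \<tau> *\<^sub>R circ p q (snd z)))"
      by (rule continuous_on_compose2[OF integrand_continuous[OF u' n],
            of "I \<times> {0..2*pi}" "\<lambda>z. ((fst z, \<tau>), snd z)", unfolded fst_conv snd_conv])
        (auto intro!: continuous_intros)
    then show "continuous_on (I \<times> cbox 0 (2*pi))
        (\<lambda>(e, s). dir_deriv n [] (energy_deriv I u e) (circ p q s) (w + \<tau> *\<^sub>R circ p q s))"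
      by (simp add: case_prod_unfold)
  qed
  then show ?thesis by (simp add: ray_avg_def)
qed

text \<open>Joint differentiability follows from the two partial derivatives because the one in
  \<tau> is jointly continuous. The energy is confined to \<open>I\<close>, while \<tau> runs
  through the whole line.\<close>

lemma ray_avg_has_derivative:
  assumes u: "Cm_into_Ck_sphere (Suc m) I k u" and n: "n < k" and e: "e \<in> I" and I: "convex I"
  shows "((\<lambda>(e, \<tau>). ray_avg p q w n (u e) \<tau>) has_derivative
    (\<lambda>(h, j). ray_avg p q w n (energy_deriv I u e) \<tau> * h + ray_avg p q w (Suc n) (u e) \<tau> * j))
    (at (e, \<tau>) within I \<times> UNIV)"
proof -
  have "((\<lambda>(e, \<tau>). ray_avg p q w n (u e) \<tau>) has_derivative
      (\<lambda>(h, j). ray_avg p q w n (energy_deriv I u e) \<tau> * h +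
        blinfun_apply (blinfun_mult_right (ray_avg p q w (Suc n) (u e) \<tau>)) j))
      (at (e, \<tau>) within I \<times> UNIV)"
  proof (rule has_derivative_partialsI)
    show "((\<lambda>e. ray_avg p q w n (u e) \<tau>) has_derivative (*) (ray_avg p q w n (energy_deriv I u e) \<tau>))
        (at e within I)"
      using ray_avg_energy_deriv[OF u _ e I] n by (simp add: has_field_derivative_def)
    show "((\<lambda>\<tau>. ray_avg p q w n (u e) \<tau>) has_derivative
        blinfun_apply (blinfun_mult_right (ray_avg p q w (Suc n) (u e) \<tau>))) (at \<tau> within UNIV)"
      if "e \<in> I" for e \<tau>
      using ray_avg_deriv[OF u n that] by (simp add: has_field_derivative_def)
    have "continuous (at (e, \<tau>) within I \<times> UNIV) (\<lambda>(e, \<tau>). ray_avg p q w (Suc n) (u e) \<tau>)"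
      using ray_avg_continuous[OF u, of "Suc n"] n e
      by (auto simp: continuous_on_eq_continuous_within)
    then have "continuous (at (e, \<tau>) within I \<times> UNIV)
        (\<lambda>z. blinfun_mult_right (case z of (e, \<tau>) \<Rightarrow> ray_avg p q w (Suc n) (u e) \<tau>))"
      by (rule bounded_linear.continuous[OF bounded_linear_blinfun_mult_right])
    then show "continuous (at (e, \<tau>) within I \<times> UNIV)
        (\<lambda>(e, \<tau>). blinfun_mult_right (ray_avg p q w (Suc n) (u e) \<tau>))"
      by (simp add: case_prod_unfold)
  qed auto
  then show ?thesis by simp
qed

lemma ray_avg_0: "ray_avg p q w 0 f 0 = 2 * pi * f w"
  using w_sphere by (simp add: ray_avg_def radial_def sgn_div_norm)

text \<open>At \<tau> = 0 the integrand is linear in \<open>circ p q s\<close>, whose mean over a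
  period is zero.\<close>

lemma ray_avg_1: "ray_avg p q w 1 f 0 = 0"
proof -
  let ?v = "\<Sum>b\<in>Basis. iter_deriv (- {0}) [b] (radial f) w *\<^sub>R b"
  have "((\<lambda>s. circ p q s \<bullet> ?v) has_integral
      (sin (2*pi) * (p \<bullet> ?v) - cos (2*pi) * (q \<bullet> ?v)) - (sin 0 * (p \<bullet> ?v) - cos 0 * (q \<bullet> ?v))) {0..2*pi}"
    unfolding circ_def
    by (intro fundamental_theorem_of_calculus)
      (auto intro!: derivative_eq_intros simp: inner_add_left
        simp flip: has_real_derivative_iff_has_vector_derivative)
  then show ?thesis
    by (simp add: ray_avg_def inner_sum_right mult.commute integral_unique)
qed

text \<open>The trace of a bilinear form is the same in every orthonormal basis: Parseval's identity
  for coordinate vectors collapses the double sum to its diagonal.\<close>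

lemma frame_trace:
  fixes P :: "real^3 \<Rightarrow> real^3 \<Rightarrow> real"
  defines "Q \<equiv> \<lambda>x y. \<Sum>b\<in>Basis. (x \<bullet> b) * (\<Sum>c\<in>Basis. (y \<bullet> c) * P b c)"
  shows "Q p p + Q q q + Q w w = (\<Sum>b\<in>Basis. P b b)"
proof -
  have "Q p p + Q q q + Q w w = (\<Sum>b\<in>Basis. \<Sum>c\<in>Basis.
      ((p \<bullet> b) * (p \<bullet> c) + (q \<bullet> b) * (q \<bullet> c) + (w \<bullet> b) * (w \<bullet> c)) * P b c)"
    unfolding Q_def by (simp add: sum_distrib_left sum.distrib distrib_right mult.assoc)
  also have "\<dots> = (\<Sum>b\<in>Basis. \<Sum>c\<in>Basis. (b \<bullet> c) * P b c)"
    by (simp only: parseval[symmetric])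
  finally show ?thesis by (simp add: sum_inner_Basis_mult)
qed

text \<open>At \<tau> = 0 the integrand is the Hessian of the radial extension in the direction of
  the circle. Over a period \<open>cos^2\<close> and \<open>sin^2\<close> each integrate to
  \<open>pi\<close> and the mixed term to 0, which leaves \<open>pi\<close> times the trace over the
  tangent plane.\<close>

lemma ray_avg_2:
  assumes f: "Ck_sphere k f" and k: "2 \<le> k"
  shows "ray_avg p q w 2 f 0 = pi * laplace_S f w"
proof -
  let ?P = "\<lambda>b c. iter_deriv (- {0}) [b, c] (radial f) w"
  define Q where "Q = (\<lambda>x y. \<Sum>b\<in>Basis. (x \<bullet> b) * (\<Sum>c\<in>Basis. (y \<bullet> c) * ?P b c))"
  have w0: "w \<noteq> 0" using w_sphere by auto
  have lin: "Q (a *\<^sub>R x + b *\<^sub>R y) z = a * Q x z + b * Q y z"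
    "Q z (a *\<^sub>R x + b *\<^sub>R y) = a * Q z x + b * Q z y" for a b x y z
    unfolding Q_def
    by (simp_all add: inner_add_left distrib_right distrib_left sum.distrib sum_distrib_left mult_ac)
  have dd: "dir_deriv 2 [] f h w = Q h h" for h
    by (simp add: numeral_2_eq_2 Q_def)
  have expand: "Q (circ p q s) (circ p q s) =
      (cos s)^2 * Q p p + sin s * cos s * (Q p q + Q q p) + (sin s)^2 * Q q q" for s
    by (simp add: circ_def lin power2_eq_square algebra_simps)
  let ?F = "\<lambda>s. (s + sin s * cos s) / 2 * Q p p + (sin s)^2 / 2 * (Q p q + Q q p)
      + (s - sin s * cos s) / 2 * Q q q"
  have "((\<lambda>s. Q (circ p q s) (circ p q s)) has_integral ?F (2*pi) - ?F 0) {0..2*pi}"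
  proof (rule fundamental_theorem_of_calculus)
    fix s :: real
    have c: "1 - sin s * sin s = cos s * cos s" using sin_cos_squared_add[of s] by (simp add: power2_eq_square)
    have "((\<lambda>s. (s + sin s * cos s) / 2) has_real_derivative (cos s)^2) (at s within {0..2*pi})"
      "((\<lambda>s. (s - sin s * cos s) / 2) has_real_derivative (sin s)^2) (at s within {0..2*pi})"
      "((\<lambda>s. (sin s)^2 / 2) has_real_derivative sin s * cos s) (at s within {0..2*pi})"
      using c by (auto intro!: derivative_eq_intros simp: power2_eq_square)
    from DERIV_add[OF DERIV_add[OF DERIV_cmult_right[OF this(1)] DERIV_cmult_right[OF this(3)]]
        DERIV_cmult_right[OF this(2)]]
    have "(?F has_real_derivative Q (circ p q s) (circ p q s)) (at s within {0..2*pi})"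
      unfolding expand by simp
    then show "(?F has_vector_derivative Q (circ p q s) (circ p q s)) (at s within {0..2*pi})"
      by (simp add: has_real_derivative_iff_has_vector_derivative)
  qed simp
  then have "ray_avg p q w 2 f 0 = pi * (Q p p + Q q q)"
    by (simp add: ray_avg_def dd integral_unique algebra_simps)
  \<comment> \<open>The radial second derivative vanishes: Euler's identity in degree -1 reduces it
    to the first radial derivative, which is zero by the identity in degree 0. Hence the tangential
    trace is the full trace.\<close>
  moreover have "Q w w = 0"
  proof -
    have "(\<Sum>c\<in>Basis. (w \<bullet> c) * ?P b c) = - iter_deriv (- {0}) [b] (radial f) w" if "b \<in> Basis" for b
      using iter_deriv_radial_euler[OF f, of "[b]" w] that w0 k by simp
    then have "Q w w = - (\<Sum>b\<in>Basis. (w \<bullet> b) * iter_deriv (- {0}) [b] (radial f) w)"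
      by (simp add: Q_def sum_negf)
    also have "\<dots> = 0" using iter_deriv_radial_euler[OF f, of "[]" w] w0 k by simp
    finally show ?thesis .
  qed
  moreover have "Q p p + Q q q + Q w w = laplace_S f w"
    using frame_trace[of ?P] laplace_S_eq[OF f k w_sphere] by (simp add: Q_def)
  ultimately show ?thesis by simp
qed

end

section \<open>Collision kinematics\<close>

text \<open>Orthogonality of the transposed matrix provides \<open>parseval\<close>, since the
  entries of \<open>x v* R\<close> are the inner products of \<open>x\<close> with the columns of
  \<open>R\<close>.\<close>

lemma rotation_frame:
  assumes R: "rotation_matrix R" and w: "R *v axis 3 1 = w"
  shows "frame (R *v axis 1 1) (R *v axis 2 1) w"
proof -
  have orth: "orthogonal_matrix R" using R by (simp add: rotation_matrix_def)
  have inner: "(R *v x) \<bullet> (R *v y) = x \<bullet> y" for x y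
    using orthogonal_transformation_matrix[of "(*v) R"] orth
    by (simp add: orthogonal_transformation_def)
  have "orthogonal_matrix (transpose R)" using orth by simp
  then have inner': "(x v* R) \<bullet> (y v* R) = x \<bullet> y" for x y
    using orthogonal_transformation_matrix[of "(*v) (transpose R)"]
    by (simp add: orthogonal_transformation_def)
  have comp: "(x v* R) $ i = (R *v axis i 1) \<bullet> x" for x i
    by (metis cart_eq_inner_axis dot_lmul_matrix inner_commute)
  show ?thesis
  proof
    fix x y
    show "x \<bullet> y = (R *v axis 1 1) \<bullet> x * ((R *v axis 1 1) \<bullet> y) + (R *v axis 2 1) \<bullet> x * ((R *v axis 2 1) \<bullet> y)
        + (w \<bullet> x) * (w \<bullet> y)"
      unfolding inner'[of x y, symmetric] unfolding inner_vec_def[of "x v* R"] sum_3 comp w by simp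
  qed (auto simp: w[symmetric] inner inner_axis_axis)
qed

lemma mult_vector_3:
  fixes R :: "real^3^3"
  shows "R *v vector [x, y, z] = x *\<^sub>R (R *v axis 1 1) + y *\<^sub>R (R *v axis 2 1) + z *\<^sub>R (R *v axis 3 1)"
proof -
  have "(vector [x, y, z] :: real^3) = x *\<^sub>R axis 1 1 + y *\<^sub>R axis 2 1 + z *\<^sub>R axis 3 1"
    by (simp add: vec_eq_iff forall_3 axis_def)
  then show ?thesis
    by (simp add: matrix_vector_right_distrib matrix_vector_mult_scaleR)
qed

text \<open>\<open>tan2\<close> is the squared tangent of the scattering angle, whose cosine is \<open>mu\<close>; \<open>tan2_t\<close> and \<open>tan2_E\<close> are its partial derivatives.\<close>

definition tan2 :: "real \<Rightarrow> real \<Rightarrow> real" where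
  "tan2 t E = 2 * (t - E) / (E * (t + 2))"

definition tan2_t :: "real \<Rightarrow> real \<Rightarrow> real" where
  "tan2_t t E = 2 * (E + 2) / (E * (t + 2)^2)"

definition tan2_E :: "real \<Rightarrow> real \<Rightarrow> real" where
  "tan2_E t E = - (2 * t / (E^2 * (t + 2)))"

lemma tan2_nonneg: "0 < E \<Longrightarrow> E \<le> t \<Longrightarrow> 0 \<le> tan2 t E"
  by (simp add: tan2_def)

lemma tan2_pos: "0 < E \<Longrightarrow> E < t \<Longrightarrow> 0 < tan2 t E"
  by (simp add: tan2_def)

lemma tan2_self [simp]: "tan2 E E = 0"
  by (simp add: tan2_def)

lemma tan2_le:
  assumes "0 < a" "a \<le> E" "E \<le> t"
  shows "tan2 t E \<le> (t - E) / a"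
proof -
  have "2 * (t - E) / (E * (t + 2)) \<le> 2 * (t - E) / (a * 2)"
    using assms by (intro divide_left_mono mult_mono mult_pos_pos) auto
  also have "\<dots> = (t - E) / a" using assms by (simp add: field_simps)
  finally show ?thesis by (simp only: tan2_def)
qed

text \<open>\<open>1 + tan2 t E\<close> equals \<open>t * (E + 2) / (E * (t + 2))\<close>, the
  reciprocal of the radicand of \<open>mu\<close>. This is where the rational formula for
  \<open>tan2\<close> comes from.\<close>

lemma mu_eq:
  assumes "0 < E" "E \<le> t"
  shows "mu t E = 1 / sqrt (1 + tan2 t E)"
proof -
  have "1 + tan2 t E = (E * (t + 2) + 2 * (t - E)) / (E * (t + 2))"
    using assms by (simp add: tan2_def add_divide_distrib)
  also have "E * (t + 2) + 2 * (t - E) = t * (E + 2)"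
    by (simp add: algebra_simps)
  finally have "1 + tan2 t E = t * (E + 2) / (E * (t + 2))" .
  then show ?thesis
    using assms by (simp add: mu_def real_sqrt_divide)
qed

lemma sqrt_1_mu:
  assumes "0 < E" "E \<le> t"
  shows "sqrt (1 - (mu t E)^2) = mu t E * sqrt (tan2 t E)"
proof -
  have nn: "0 \<le> tan2 t E" using assms by (rule tan2_nonneg)
  have "1 - (mu t E)^2 = tan2 t E / (1 + tan2 t E)"
    using nn by (simp add: mu_eq[OF assms] power_divide field_simps)
  then show ?thesis using nn by (simp add: mu_eq[OF assms] real_sqrt_divide)
qed

text \<open>The value identifies the coefficient of the Laplacian: \<open>tan2_t E E\<close> is -2
  times it.\<close>

lemma deriv_mu:
  assumes "0 < E"
  shows "deriv (\<lambda>t. mu t E) E = - 1 / (E * (E + 2))"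
proof (rule DERIV_imp_deriv)
  have 1: "((\<lambda>t. E * (t + 2) / (t * (E + 2))) has_real_derivative - 2 / (E * (E + 2))) (at E)"
  proof -
    have "((\<lambda>t. E * (t + 2) / (t * (E + 2))) has_real_derivative
        (E * (E * (E + 2)) - E * (E + 2) * (E + 2)) / (E * (E + 2) * (E * (E + 2)))) (at E)"
      using assms by (auto intro!: derivative_eq_intros)
    moreover have "(E * (E * (E + 2)) - E * (E + 2) * (E + 2)) = (E * (E + 2)) * (- 2)"
      by (simp add: algebra_simps)
    ultimately show ?thesis using assms by simp
  qed
  have "((\<lambda>t. sqrt (E * (t + 2) / (t * (E + 2)))) has_real_derivative
      (inverse (sqrt (E * (E + 2) / (E * (E + 2)))) / 2) * (- 2 / (E * (E + 2)))) (at E)"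
    using assms by (intro DERIV_chain2[OF DERIV_real_sqrt 1]) simp
  then show "((\<lambda>t. mu t E) has_real_derivative - 1 / (E * (E + 2))) (at E)"
    using assms unfolding mu_def by simp
qed

lemma tan2_has_derivative:
  assumes "0 < E" "0 < t"
  shows "((\<lambda>(t, E). tan2 t E) has_derivative (\<lambda>(h, j). tan2_t t E * h + tan2_E t E * j)) (at (t, E) within S)"
proof -
  have *: "(2 * (h - j) * (E * (t + 2)) - 2 * (t - E) * (E * h + j * (t + 2))) / (E * (t + 2) * (E * (t + 2)))
      = tan2_t t E * h + tan2_E t E * j" for h j
  proof -
    have "2 * (h - j) * (E * (t + 2)) - 2 * (t - E) * (E * h + j * (t + 2)) =
        2 * (E + 2) * E * h - 2 * t * (t + 2) * j"
      by (simp add: algebra_simps)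
    also have "\<dots> / (E * (t + 2) * (E * (t + 2))) = tan2_t t E * h + tan2_E t E * j"
    proof -
      have "2 * (E + 2) * E * h / (E * B * (E * B)) = 2 * (E + 2) / (E * B^2) * h"
        "2 * t * B * j / (E * B * (E * B)) = 2 * t / (E^2 * B) * j" if "B \<noteq> 0" for B
        using that assms by (simp_all add: power2_eq_square)
      from this[of "t + 2"] show ?thesis
        using assms by (simp add: tan2_t_def tan2_E_def diff_divide_distrib)
    qed
    finally show ?thesis .
  qed
  have "((\<lambda>z. 2 * (fst z - snd z) / (snd z * (fst z + 2))) has_derivative
      (\<lambda>h. (2 * (fst h - snd h) * (E * (t + 2)) - 2 * (t - E) * (E * fst h + snd h * (t + 2))) /
        (E * (t + 2) * (E * (t + 2))))) (at (t, E) within S)"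
    using assms by (auto intro!: derivative_eq_intros)
  then show ?thesis
    unfolding * by (simp add: tan2_def case_prod_unfold)
qed

text \<open>The strict inequality keeps away from the diagonal, where the square root has infinite
  slope. The factor \<open>1 / (2 * sqrt (tan2 t E))\<close> is later paired with the first
  derivative of the circle average.\<close>

lemma sqrt_tan2_has_derivative:
  assumes "0 < E" "E < t"
  shows "((\<lambda>(t, E). sqrt (tan2 t E)) has_derivative
    (\<lambda>(h, j). (tan2_t t E * h + tan2_E t E * j) / (2 * sqrt (tan2 t E)))) (at (t, E) within S)"
proof -
  have "(sqrt has_derivative (\<lambda>h. h * (inverse (sqrt (tan2 t E)) / 2))) (at (tan2 t E))"
    using DERIV_real_sqrt[OF tan2_pos[OF assms]] unfolding has_field_derivative_def
    by (rule has_derivative_eq_rhs) auto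
  from has_derivative_compose[OF tan2_has_derivative[of E t S], of sqrt] assms this
  have "((\<lambda>z. sqrt (case z of (t, E) \<Rightarrow> tan2 t E)) has_derivative
      (\<lambda>z. (case z of (h, j) \<Rightarrow> tan2_t t E * h + tan2_E t E * j) * (inverse (sqrt (tan2 t E)) / 2)))
      (at (t, E) within S)"
    by auto
  then show ?thesis by (simp add: case_prod_unfold field_simps)
qed

lemma sqrt_tan2_DERIV:
  assumes "0 < E" "E < t"
  shows "((\<lambda>E. sqrt (tan2 t E)) has_real_derivative tan2_E t E / (2 * sqrt (tan2 t E))) (at E)"
proof -
  have "((\<lambda>E. (t, E)) has_derivative (\<lambda>j. (0, j))) (at E)"
    by (auto intro!: derivative_eq_intros)
  from has_derivative_compose[OF this sqrt_tan2_has_derivative[OF assms]]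
  have "((\<lambda>E. sqrt (tan2 t E)) has_derivative (\<lambda>j. tan2_E t E * j / (2 * sqrt (tan2 t E)))) (at E)"
    by simp
  then show ?thesis
    unfolding has_field_derivative_def by (rule has_derivative_eq_rhs) auto
qed

section \<open>The scattering circle in the tangent plane\<close>

lemma gam_eq:
  assumes "R w *v axis 3 1 = w" "0 < E" "E \<le> t"
  shows "gam R t E w s =
    mu t E *\<^sub>R (w + sqrt (tan2 t E) *\<^sub>R circ (R w *v axis 1 1) (R w *v axis 2 1) s)"
  unfolding gam_def mult_vector_3 sqrt_1_mu[OF assms(2,3)] assms(1)
  by (simp add: circ_def scaleR_add_right mult_ac)

lemma set_integral_continuous_eq:
  "continuous_on {a..b} f \<Longrightarrow> (LINT s:{a..b}|lebesgue. f s) = integral {a..b} (f :: real \<Rightarrow> real)"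
  using set_lebesgue_integral_eq_integral(2)[OF absolutely_integrable_continuous_real] .

lemma sgn_sgn_vec: "sgn (sgn v) = sgn (v :: 'a::real_normed_vector)"
  by (cases "v = 0") (simp_all add: sgn_div_norm)

context frame
begin

lemma circ_inner: "circ p q s \<bullet> circ p q s = 1" "w \<bullet> circ p q s = 0"
  using norm orth sin_cos_squared_add[of s]
  by (simp_all add: circ_def inner_add_left inner_add_right inner_commute[of q p] power2_eq_square)

lemma sgn_line: "sgn (w + \<tau> *\<^sub>R circ p q s) = (1 / sqrt (1 + \<tau>^2)) *\<^sub>R (w + \<tau> *\<^sub>R circ p q s)"
proof -
  have "(w + \<tau> *\<^sub>R circ p q s) \<bullet> (w + \<tau> *\<^sub>R circ p q s) = 1 + \<tau>^2"
    using norm circ_inner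
    by (simp add: inner_add_left inner_add_right inner_commute[of "circ p q s" w] power2_eq_square)
  then show ?thesis by (simp add: sgn_div_norm norm_eq_sqrt_inner inverse_eq_divide)
qed

text \<open>The factor \<open>mu\<close> is the reciprocal of the length of the tangent plane point.
  The point of the circle is therefore its normalisation, and a radial extension takes the same
  value at both.\<close>

lemma gam_eq_sgn:
  assumes R: "R w *v axis 3 1 = w" "p = R w *v axis 1 1" "q = R w *v axis 2 1" and "0 < E" "E \<le> t"
  shows "gam R t E w s = sgn (w + sqrt (tan2 t E) *\<^sub>R circ p q s)"
  using gam_eq[of R w, OF R(1) assms(4,5)] tan2_nonneg[OF assms(4,5)]
  unfolding sgn_line R(2,3)[symmetric] by (simp add: mu_eq[OF assms(4,5)])

lemma integral_gam:
  assumes R: "R w *v axis 3 1 = w" "p = R w *v axis 1 1" "q = R w *v axis 2 1"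
    and u: "Cm_into_Ck_sphere m I k u" and t: "t \<in> I" and E: "0 < E" "E \<le> t"
  shows "(LINT s:{0..2*pi}|lebesgue. u t (gam R t E w s)) = ray_avg p q w 0 (u t) (sqrt (tan2 t E))"
proof -
  have "u t (gam R t E w s) =
      dir_deriv 0 [] (u t) (circ p q s) (w + sqrt (tan2 t E) *\<^sub>R circ p q s)" for s
    unfolding gam_eq_sgn[of R, OF R E] by (simp add: radial_def)
  then show ?thesis
    unfolding ray_avg_def
    using integrand_continuous_on[OF u _ t, of 0] set_integral_continuous_eq by simp
qed

text \<open>Both sides compute the derivative of \<open>radial f (gam R t e w s)\<close> at
  \<open>e = E\<close>: one follows the curve on the sphere by means of the gradient, the other the
  straight line in the tangent plane, on which \<open>radial f\<close> has the same values.\<close>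

lemma grad_S_inner_dgam:
  assumes R: "R w *v axis 3 1 = w" "p = R w *v axis 1 1" "q = R w *v axis 2 1"
    and f: "Ck_sphere k f" "1 < k" and E: "0 < E" "E < t"
  shows "grad_S f (gam R t E w s) \<bullet> dgam_dE R t E w s =
    dir_deriv 1 [] f (circ p q s) (w + sqrt (tan2 t E) *\<^sub>R circ p q s) *
      (tan2_E t E / (2 * sqrt (tan2 t E)))"
proof -
  let ?c = "circ p q s" and ?\<tau> = "\<lambda>E. sqrt (tan2 t E)"
  have open_E: "open {0<..<t}" "E \<in> {0<..<t}" using E by auto
  have gam: "gam R t e w s = sgn (w + ?\<tau> e *\<^sub>R ?c)" if "e \<in> {0<..<t}" for e
    using gam_eq_sgn[of R, OF R, of e t] that by simp
  have \<tau>: "(?\<tau> has_real_derivative tan2_E t E / (2 * ?\<tau> E)) (at E)"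
    using E by (rule sqrt_tan2_DERIV)
  \<comment> \<open>The derivative of the normalised line is only required to exist: it ensures that
    \<open>dgam_dE\<close>, defined by \<open>vector_derivative\<close>, is a true
    derivative.\<close>
  have "\<exists>D. ((\<lambda>\<tau>. sgn (w + \<tau> *\<^sub>R ?c)) has_vector_derivative D) (at \<tau>)" for \<tau>
  proof -
    have pos: "1 + \<tau>^2 > 0" by (simp add: add_pos_nonneg)
    have "\<exists>d. ((\<lambda>\<tau>. 1 / sqrt (1 + \<tau>^2)) has_real_derivative d) (at \<tau>)"
      by (rule exI, (rule derivative_eq_intros refl | use pos in simp)+)
    then obtain d where "((\<lambda>\<tau>. 1 / sqrt (1 + \<tau>^2)) has_real_derivative d) (at \<tau>)" ..
    moreover have "((\<lambda>\<tau>. w + \<tau> *\<^sub>R ?c) has_vector_derivative ?c) (at \<tau>)"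
      by (auto intro!: derivative_eq_intros simp: has_vector_derivative_def)
    ultimately show ?thesis unfolding sgn_line by (intro exI, rule has_vector_derivative_scaleR)
  qed
  then obtain D where "((\<lambda>\<tau>. sgn (w + \<tau> *\<^sub>R ?c)) has_vector_derivative D) (at (?\<tau> E))" by blast
  from vector_diff_chain_at[OF \<tau>[unfolded has_real_derivative_iff_has_vector_derivative] this]
  have "((\<lambda>e. sgn (w + ?\<tau> e *\<^sub>R ?c)) has_vector_derivative (tan2_E t E / (2 * ?\<tau> E)) *\<^sub>R D) (at E)"
    by (simp add: comp_def)
  then have "((\<lambda>e. gam R t e w s) has_vector_derivative (tan2_E t E / (2 * ?\<tau> E)) *\<^sub>R D) (at E)"
    by (rule has_vector_derivative_transform_within_open[OF _ open_E]) (simp add: gam)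
  then have dgam: "((\<lambda>e. gam R t e w s) has_vector_derivative dgam_dE R t E w s) (at E)"
    unfolding dgam_dE_def by (simp add: vector_derivative_works[symmetric] differentiableI_vector)
  have gam0: "gam R t E w s \<noteq> 0"
    using gam[OF open_E(2)] line_nonzero[of "?\<tau> E" s] by (simp add: sgn_zero_iff)
  have "(radial f has_derivative (\<lambda>h. h \<bullet> grad_S f (gam R t E w s))) (at (gam R t E w s))"
    using GDERIV_radial[OF f(1) _ gam0] f(2) grad_S_eq[OF f(1) _ gam0] by (simp add: gderiv_def)
  from has_derivative_compose[OF dgam[unfolded has_vector_derivative_def] this]
  have "((\<lambda>e. radial f (gam R t e w s)) has_derivative
      (\<lambda>j. (j *\<^sub>R dgam_dE R t E w s) \<bullet> grad_S f (gam R t E w s))) (at E)" .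
  then have 1: "((\<lambda>e. radial f (gam R t e w s)) has_real_derivative
      grad_S f (gam R t E w s) \<bullet> dgam_dE R t E w s) (at E)"
    unfolding has_field_derivative_def
    by (rule has_derivative_eq_rhs) (auto simp: inner_commute mult.commute)
  have "((\<lambda>e. dir_deriv 0 [] f ?c (w + ?\<tau> e *\<^sub>R ?c)) has_real_derivative
      dir_deriv (Suc 0) [] f ?c (w + ?\<tau> E *\<^sub>R ?c) * (tan2_E t E / (2 * ?\<tau> E))) (at E)"
    using f(2) by (intro DERIV_chain2[OF dir_deriv_line[OF f(1)] \<tau>] line_nonzero) auto
  then have 2: "((\<lambda>e. radial f (gam R t e w s)) has_real_derivative
      dir_deriv 1 [] f ?c (w + ?\<tau> E *\<^sub>R ?c) * (tan2_E t E / (2 * ?\<tau> E))) (at E)"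
    unfolding One_nat_def
    by (rule has_field_derivative_transform_within_open[OF _ open_E]) (simp add: gam radial_def sgn_sgn_vec)
  show ?thesis using DERIV_unique[OF 1 2] .
qed

lemma integral_grad_S_dgam:
  assumes R: "R w *v axis 3 1 = w" "p = R w *v axis 1 1" "q = R w *v axis 2 1"
    and u: "Cm_into_Ck_sphere m I k u" "1 < k" and t: "t \<in> I" and E: "0 < E" "E < t"
  shows "(LINT s:{0..2*pi}|lebesgue. grad_S (u t) (gam R t E w s) \<bullet> dgam_dE R t E w s) =
    ray_avg p q w 1 (u t) (sqrt (tan2 t E)) / sqrt (tan2 t E) / 2 * tan2_E t E"
proof -
  have cont: "continuous_on {0..2*pi} (\<lambda>s. dir_deriv 1 [] (u t) (circ p q s) (w + sqrt (tan2 t E) *\<^sub>R circ p q s))"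
    using u(2) by (intro integrand_continuous_on[OF u(1) _ t]) auto
  have "(LINT s:{0..2*pi}|lebesgue. grad_S (u t) (gam R t E w s) \<bullet> dgam_dE R t E w s) =
    (LINT s:{0..2*pi}|lebesgue. dir_deriv 1 [] (u t) (circ p q s) (w + sqrt (tan2 t E) *\<^sub>R circ p q s)) *
      (tan2_E t E / (2 * sqrt (tan2 t E)))"
    by (simp only: grad_S_inner_dgam[of R, OF R Cm_into_Ck_sphere_imp_Ck[OF u(1) t] u(2) E] set_integral_mult_left)
  then show ?thesis
    unfolding ray_avg_def set_integral_continuous_eq[OF cont] by simp
qed

section \<open>Bounds for circle averages near the diagonal\<close>

lemma ray_avg_bound:
  assumes "Cm_into_Ck_sphere m {a..b} k u" "n \<le> k"
  obtains B where "B \<ge> 0" "\<And>t \<tau>. t \<in> {a..b} \<Longrightarrow> \<tau> \<in> {0..T} \<Longrightarrow> \<bar>ray_avg p q w n (u t) \<tau>\<bar> \<le> B"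
proof -
  let ?f = "\<lambda>(t, \<tau>). ray_avg p q w n (u t) \<tau>"
  have "continuous_on ({a..b} \<times> {0..T}) ?f"
    by (rule continuous_on_subset[OF ray_avg_continuous[OF assms]]) auto
  then have "bounded (?f ` ({a..b} \<times> {0..T}))"
    by (intro compact_imp_bounded compact_continuous_image compact_Times) auto
  then obtain B where "B > 0" "\<forall>x\<in>?f ` ({a..b} \<times> {0..T}). norm x \<le> B"
    unfolding bounded_pos by blast
  then show ?thesis by (intro that[of B]) force+
qed

text \<open>The passage from \<open>(t, \<tau>)\<close> to \<open>(E, 0)\<close> goes through
  \<open>(t, 0)\<close>: the first leg is controlled by the derivative of order \<open>n + 1\<close>
  in \<tau>, the second by the energy derivative. For \<open>n = 2\<close> this uses three
  derivatives on the sphere.\<close>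

lemma ray_avg_lipschitz:
  assumes u: "Cm_into_Ck_sphere (Suc m) {a..b} k u" and n: "n < k"
  obtains C where "C \<ge> 0" "\<And>t \<tau>. t \<in> {a..b} \<Longrightarrow> \<tau> \<in> {0..T} \<Longrightarrow> \<bar>ray_avg p q w n (u t) \<tau>\<bar> \<le> C"
    "\<And>t E \<tau>. t \<in> {a..b} \<Longrightarrow> E \<in> {a..b} \<Longrightarrow> \<tau> \<in> {0..T} \<Longrightarrow>
      \<bar>ray_avg p q w n (u t) \<tau> - ray_avg p q w n (u E) 0\<bar> \<le> C * (\<tau> + \<bar>t - E\<bar>)"
proof -
  let ?G = "\<lambda>n u t \<tau>. ray_avg p q w n (u t) \<tau>" and ?u' = "energy_deriv {a..b} u"
  have u': "Cm_into_Ck_sphere m {a..b} k ?u'" using u by simp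
  obtain B0 where B0: "B0 \<ge> 0" "\<And>t \<tau>. t \<in> {a..b} \<Longrightarrow> \<tau> \<in> {0..T} \<Longrightarrow> \<bar>?G n u t \<tau>\<bar> \<le> B0"
    using ray_avg_bound[OF u, of n T] n by auto
  obtain B1 where B1: "B1 \<ge> 0" "\<And>t \<tau>. t \<in> {a..b} \<Longrightarrow> \<tau> \<in> {0..T} \<Longrightarrow> \<bar>?G (Suc n) u t \<tau>\<bar> \<le> B1"
    using ray_avg_bound[OF u, of "Suc n" T] n by auto
  obtain B2 where B2: "B2 \<ge> 0" "\<And>t \<tau>. t \<in> {a..b} \<Longrightarrow> \<tau> \<in> {0..T} \<Longrightarrow> \<bar>?G n ?u' t \<tau>\<bar> \<le> B2"
    using ray_avg_bound[OF u', of n T] n by auto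
  show ?thesis
  proof (rule that[of "B0 + B1 + B2"])
    show "\<bar>?G n u t \<tau>\<bar> \<le> B0 + B1 + B2" if "t \<in> {a..b}" "\<tau> \<in> {0..T}" for t \<tau>
      using B0(2)[OF that] B1(1) B2(1) by linarith
    fix t E \<tau> assume t: "t \<in> {a..b}" and E: "E \<in> {a..b}" and \<tau>: "\<tau> \<in> {0..T}"
    then have 0: "0 \<in> {0..T}" by auto
    have "norm (?G n u t \<tau> - ?G n u t 0) \<le> B1 * norm (\<tau> - 0)"
      using t \<tau> 0 B1(2) n
      by (intro field_differentiable_bound[of "{0..T}" _ "?G (Suc n) u t"]
          has_field_derivative_at_within[OF ray_avg_deriv[OF u]]) auto
    moreover have "norm (?G n u t 0 - ?G n u E 0) \<le> B2 * norm (t - E)"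
      using t E 0 B2(2) n
      by (intro field_differentiable_bound[of "{a..b}" _ "\<lambda>t. ?G n ?u' t 0"] ray_avg_energy_deriv[OF u]) auto
    ultimately have "\<bar>?G n u t \<tau> - ?G n u E 0\<bar> \<le> B1 * \<tau> + B2 * \<bar>t - E\<bar>"
      using \<tau> by (auto simp: abs_le_iff)
    also have "\<dots> \<le> (B0 + B1 + B2) * \<tau> + (B0 + B1 + B2) * \<bar>t - E\<bar>"
      using B0(1) B1(1) B2(1) \<tau> by (intro add_mono mult_right_mono) auto
    finally show "\<bar>?G n u t \<tau> - ?G n u E 0\<bar> \<le> (B0 + B1 + B2) * (\<tau> + \<bar>t - E\<bar>)"
      by (simp add: distrib_left)
  qed (use B0 B1 B2 in auto)
qed

text \<open>The function \<open>g'(\<tau>)/\<tau>\<close>, extended continuously to \<open>\<tau> = 0\<close>; its half is \<open>dg/d(\<tau>\<^sup>2)\<close>.\<close>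

definition ray_slope :: "(real^3 \<Rightarrow> real) \<Rightarrow> real \<Rightarrow> real" where
  "ray_slope f \<tau> = (if \<tau> = 0 then ray_avg p q w 2 f 0 else ray_avg p q w 1 f \<tau> / \<tau>)"

text \<open>The mean value theorem applies to the first derivative because that vanishes at \<tau> =
  0; the slope thus inherits the bounds of the second derivative.\<close>

lemma ray_slope_mvt:
  assumes u: "Cm_into_Ck_sphere m I k u" and k: "2 \<le> k" and t: "t \<in> I" and "0 \<le> \<tau>"
  shows "\<exists>\<xi>\<in>{0..\<tau>}. ray_slope (u t) \<tau> = ray_avg p q w 2 (u t) \<xi>"
proof (cases "\<tau> = 0")
  case False
  with \<open>0 \<le> \<tau>\<close> have "0 < \<tau>" by simp
  from MVT2[OF this, of "ray_avg p q w 1 (u t)" "ray_avg p q w 2 (u t)"]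
    ray_avg_deriv[OF u _ t, of 1] k
  obtain \<xi> where "0 < \<xi>" "\<xi> < \<tau>" "ray_avg p q w 1 (u t) \<tau> - ray_avg p q w 1 (u t) 0 = \<tau> * ray_avg p q w 2 (u t) \<xi>"
    by (auto simp: numeral_2_eq_2)
  then show ?thesis
    using False by (intro bexI[of _ \<xi>]) (auto simp: ray_slope_def ray_avg_1[unfolded One_nat_def])
qed (auto simp: ray_slope_def)

lemma sqrt_tan2_bound:
  assumes "0 < a" "a \<le> E" "E \<le> t" "t \<le> b"
  shows "sqrt (tan2 t E) \<le> sqrt (t - E) / sqrt a" "sqrt (tan2 t E) \<in> {0..sqrt ((b - a) / a)}"
proof -
  show *: "sqrt (tan2 t E) \<le> sqrt (t - E) / sqrt a"
    using real_sqrt_le_mono[OF tan2_le[OF assms(1-3)]] by (simp add: real_sqrt_divide)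
  have "(t - E) / a \<le> (b - a) / a" using assms by (intro divide_right_mono) auto
  then have "sqrt ((t - E) / a) \<le> sqrt ((b - a) / a)" by (rule real_sqrt_le_mono)
  with * tan2_nonneg[of E t] assms show "sqrt (tan2 t E) \<in> {0..sqrt ((b - a) / a)}"
    by (simp add: real_sqrt_divide)
qed

text \<open>\<open>sqrt (tan2 t E)\<close> is at most \<open>sqrt (t - E) / sqrt a\<close>, hence
  Lipschitz dependence on \<tau> turns into the exponent 1/2, and the dependence on the energy is
  absorbed with the factor \<open>sqrt (b - a)\<close>. The number \<open>sqrt ((b - a) / a)\<close>
  bounds every \<tau> that can occur.\<close>

lemma diag_holder_tan2:
  assumes a: "0 < a" and self: "\<And>E. a \<le> E \<Longrightarrow> E \<le> b \<Longrightarrow> g E 0 = f E E"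
    and f: "\<And>t E. a \<le> E \<Longrightarrow> E \<le> t \<Longrightarrow> t \<le> b \<Longrightarrow> f t E = g t (sqrt (tan2 t E))"
    and C: "C \<ge> 0" "\<And>t \<tau>. t \<in> {a..b} \<Longrightarrow> \<tau> \<in> {0..sqrt ((b - a) / a)} \<Longrightarrow> \<bar>g t \<tau>\<bar> \<le> C"
    "\<And>t E \<tau>. t \<in> {a..b} \<Longrightarrow> E \<in> {a..b} \<Longrightarrow> \<tau> \<in> {0..sqrt ((b - a) / a)} \<Longrightarrow>
      \<bar>g t \<tau> - g E 0\<bar> \<le> C * (\<tau> + \<bar>t - E\<bar>)"
  shows "diag_holder a b f"
proof (rule diag_holderI)
  fix E t assume t: "a \<le> E" "E \<le> t" "t \<le> b"
  note \<tau> = sqrt_tan2_bound[OF a t]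
  have alg: "C * (x / y + z * x) = (C * (1 / y + z)) * x" for x y z :: real
    by (simp add: algebra_simps)
  show "\<bar>f t E\<bar> \<le> C" unfolding f[OF t] using C(2)[OF _ \<tau>(2)] t by simp
  have "sqrt (t - E) * sqrt (t - E) \<le> sqrt (b - a) * sqrt (t - E)"
    using t by (intro mult_right_mono real_sqrt_le_mono) auto
  then have tE: "\<bar>t - E\<bar> \<le> sqrt (b - a) * sqrt (t - E)" using t by simp
  have "\<bar>f t E - f E E\<bar> \<le> C * (sqrt (tan2 t E) + \<bar>t - E\<bar>)"
    using C(3)[OF _ _ \<tau>(2), of t E] self[of E] t unfolding f[OF t] by simp
  also have "\<dots> \<le> C * (sqrt (t - E) / sqrt a + sqrt (b - a) * sqrt (t - E))"
    using \<tau>(1) tE C(1) by (intro mult_left_mono add_mono) auto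
  finally show "\<bar>f t E - f E E\<bar> \<le> (C * (1 / sqrt a + sqrt (b - a))) * sqrt (t - E)"
    unfolding alg .
qed

lemma diag_holder_ray_avg:
  assumes u: "Cm_into_Ck_sphere (Suc m) {a..b} k u" and n: "n < k" and a: "0 < a"
  shows "diag_holder a b (\<lambda>t E. ray_avg p q w n (u t) (sqrt (tan2 t E)))"
proof -
  obtain C where C: "C \<ge> 0"
    "\<And>t \<tau>. t \<in> {a..b} \<Longrightarrow> \<tau> \<in> {0..sqrt ((b - a) / a)} \<Longrightarrow> \<bar>ray_avg p q w n (u t) \<tau>\<bar> \<le> C"
    "\<And>t E \<tau>. t \<in> {a..b} \<Longrightarrow> E \<in> {a..b} \<Longrightarrow> \<tau> \<in> {0..sqrt ((b - a) / a)} \<Longrightarrow>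
      \<bar>ray_avg p q w n (u t) \<tau> - ray_avg p q w n (u E) 0\<bar> \<le> C * (\<tau> + \<bar>t - E\<bar>)"
    using ray_avg_lipschitz[OF u n, of "sqrt ((b - a) / a)"] by blast
  show ?thesis
    by (rule diag_holder_tan2[OF a, of b "\<lambda>t \<tau>. ray_avg p q w n (u t) \<tau>" _ C]) (use C in auto)
qed

text \<open>The slope equals a second derivative at some \<xi> between 0 and \<tau>, and its
  diagonal value is the second derivative at 0. As \<xi> \<le> \<tau>, the Lipschitz bound of order
  2 passes over to the slope.\<close>

lemma diag_holder_ray_slope:
  assumes u: "Cm_into_Ck_sphere (Suc m) {a..b} k u" and k: "2 < k" and a: "0 < a"
  shows "diag_holder a b (\<lambda>t E. ray_slope (u t) (sqrt (tan2 t E)))"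
proof -
  let ?T = "sqrt ((b - a) / a)"
  obtain C where C: "C \<ge> 0"
    "\<And>t \<tau>. t \<in> {a..b} \<Longrightarrow> \<tau> \<in> {0..?T} \<Longrightarrow> \<bar>ray_avg p q w 2 (u t) \<tau>\<bar> \<le> C"
    "\<And>t E \<tau>. t \<in> {a..b} \<Longrightarrow> E \<in> {a..b} \<Longrightarrow> \<tau> \<in> {0..?T} \<Longrightarrow>
      \<bar>ray_avg p q w 2 (u t) \<tau> - ray_avg p q w 2 (u E) 0\<bar> \<le> C * (\<tau> + \<bar>t - E\<bar>)"
    using ray_avg_lipschitz[OF u k, of ?T] by blast
  show ?thesis
  proof (rule diag_holder_tan2[OF a, of b "\<lambda>t \<tau>. ray_slope (u t) \<tau>" _ C])
    fix t \<tau> assume t: "t \<in> {a..b}" and \<tau>: "\<tau> \<in> {0..?T}"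
    then obtain \<xi> where \<xi>: "\<xi> \<in> {0..\<tau>}" "ray_slope (u t) \<tau> = ray_avg p q w 2 (u t) \<xi>"
      using ray_slope_mvt[OF u _ t, of \<tau>] k by auto
    then have \<xi>T: "\<xi> \<in> {0..?T}" using \<tau> by auto
    show "\<bar>ray_slope (u t) \<tau>\<bar> \<le> C" unfolding \<xi>(2) by (rule C(2)[OF t \<xi>T])
    fix E assume E: "E \<in> {a..b}"
    have "\<bar>ray_slope (u t) \<tau> - ray_slope (u E) 0\<bar> \<le> C * (\<xi> + \<bar>t - E\<bar>)"
      using C(3)[OF t E \<xi>T] unfolding \<xi>(2) by (simp add: ray_slope_def)
    also have "\<dots> \<le> C * (\<tau> + \<bar>t - E\<bar>)" using \<xi>(1) C(1) by (intro mult_left_mono) auto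
    finally show "\<bar>ray_slope (u t) \<tau> - ray_slope (u E) 0\<bar> \<le> C * (\<tau> + \<bar>t - E\<bar>)" .
  qed (use C in auto)
qed

end

section \<open>Differentiation of the finite part\<close>

lemma Ck_on_box_partials:
  fixes f :: "real \<times> real \<Rightarrow> real"
  assumes f: "Ck_on (Suc k) S f"
  obtains D1 D2 where "\<And>z. z \<in> S \<Longrightarrow> (f has_derivative (\<lambda>(h, j). D1 z * h + D2 z * j)) (at z within S)"
    "Ck_on k S D1" "Ck_on k S D2"
proof
  let ?D = "\<lambda>z. frechet_derivative f (at z within S)"
  show "Ck_on k S (\<lambda>z. ?D z (1, 0))" "Ck_on k S (\<lambda>z. ?D z (0, 1))"
    using f by (auto simp: Basis_prod_def)
  fix z assume "z \<in> S"
  then have D: "(f has_derivative ?D z) (at z within S)"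
    using f by (simp add: differentiable_on_def frechet_derivative_works)
  note lin = has_derivative_linear[OF D]
  have "?D z = (\<lambda>(h, j). ?D z (1, 0) * h + ?D z (0, 1) * j)"
  proof (rule ext, clarify)
    fix h j
    have "?D z (h, j) = ?D z (h *\<^sub>R (1, 0) + j *\<^sub>R (0, 1))" by simp
    also have "\<dots> = h * ?D z (1, 0) + j * ?D z (0, 1)"
      using lin by (simp only: linear_add linear_scale real_scaleR_def)
    finally show "?D z (h, j) = ?D z (1, 0) * h + ?D z (0, 1) * j" by (simp add: mult.commute)
  qed
  from has_derivative_eq_rhs[OF D this]
  show "(f has_derivative (\<lambda>(h, j). ?D z (1, 0) * h + ?D z (0, 1) * j)) (at z within S)" .
qed

lemma has_derivative_partials:
  fixes f :: "real \<times> real \<Rightarrow> real"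
  assumes f: "(f has_derivative (\<lambda>(h, j). d1 * h + d2 * j)) (at (t, E) within S \<times> T)"
    and "t \<in> S" "E \<in> T"
  shows "((\<lambda>t. f (t, E)) has_real_derivative d1) (at t within S)"
    and "((\<lambda>E. f (t, E)) has_real_derivative d2) (at E within T)"
proof -
  have "((\<lambda>t. (t, E)) has_derivative (\<lambda>h. (h, 0))) (at t within S)"
    by (auto intro!: derivative_eq_intros)
  from has_derivative_in_compose[OF this has_derivative_subset[OF f]] assms(2,3)
  show "((\<lambda>t. f (t, E)) has_real_derivative d1) (at t within S)"
    by (auto simp: has_field_derivative_def)
  have "((\<lambda>E. (t, E)) has_derivative (\<lambda>h. (0, h))) (at E within T)"
    by (auto intro!: derivative_eq_intros)
  from has_derivative_in_compose[OF this has_derivative_subset[OF f]] assms(2,3)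
  show "((\<lambda>E. f (t, E)) has_real_derivative d2) (at E within T)"
    by (auto simp: has_field_derivative_def)
qed

lemma has_derivative_diagonal:
  fixes f :: "real \<times> real \<Rightarrow> real"
  assumes f: "(f has_derivative (\<lambda>(h, j). d1 * h + d2 * j)) (at (E, E) within S \<times> S)"
    and "E \<in> S"
  shows "((\<lambda>E. f (E, E)) has_real_derivative d1 + d2) (at E within S)"
proof -
  have "((\<lambda>E. (E, E)) has_derivative (\<lambda>h. (h, h))) (at E within S)"
    by (auto intro!: derivative_eq_intros)
  from has_derivative_in_compose[OF this has_derivative_subset[OF f]] assms(2)
  have "((\<lambda>E. f (E, E)) has_derivative (\<lambda>h. d1 * h + d2 * h)) (at E within S)"
    by auto
  then show ?thesis
    unfolding has_field_derivative_def by (rule has_derivative_eq_rhs) (auto simp: distrib_right)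
qed

lemma continuous_on_compact_bound:
  fixes f :: "'a::metric_space \<Rightarrow> real"
  assumes "compact S" "continuous_on S f"
  obtains B where "\<And>z. z \<in> S \<Longrightarrow> \<bar>f z\<bar> \<le> B"
proof -
  have "bounded (f ` S)" using assms by (intro compact_imp_bounded compact_continuous_image)
  then obtain B where "\<forall>x\<in>f ` S. norm x \<le> B" unfolding bounded_iff by blast
  then show ?thesis by (intro that[of B]) simp
qed

lemma diag_holder_of_deriv:
  fixes f f' :: "real \<times> real \<Rightarrow> real"
  assumes "continuous_on ({a..b} \<times> {a..b}) f" "continuous_on ({a..b} \<times> {a..b}) f'"
    and D: "\<And>t E. t \<in> {a..b} \<Longrightarrow> E \<in> {a..b} \<Longrightarrow>
      ((\<lambda>t. f (t, E)) has_real_derivative f' (t, E)) (at t within {a..b})"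
  shows "diag_holder a b (\<lambda>t E. f (t, E))"
proof -
  have S: "compact ({a..b} \<times> {a..b})" by (intro compact_Times) auto
  obtain B where B: "\<And>z. z \<in> {a..b} \<times> {a..b} \<Longrightarrow> \<bar>f z\<bar> \<le> B"
    using continuous_on_compact_bound[OF S assms(1)] by metis
  obtain L where L: "\<And>z. z \<in> {a..b} \<times> {a..b} \<Longrightarrow> \<bar>f' z\<bar> \<le> L"
    using continuous_on_compact_bound[OF S assms(2)] by metis
  show ?thesis
  proof (rule diag_holder_lipschitz[of a b _ B L])
    fix E t assume t: "a \<le> E" "E \<le> t" "t \<le> b"
    show "\<bar>f (t, E)\<bar> \<le> B" using B t by auto
    have "norm (f (t, E) - f (E, E)) \<le> L * norm (t - E)"
      using t L D by (intro field_differentiable_bound[of "{a..b}" "\<lambda>t. f (t, E)" "\<lambda>t. f' (t, E)"]) auto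
    then show "\<bar>f (t, E) - f (E, E)\<bar> \<le> L * (t - E)" using t by simp
  qed
qed

lemma diag_holder_Ck_on:
  fixes f :: "real \<times> real \<Rightarrow> real"
  assumes f: "Ck_on (Suc k) ({a..b} \<times> {a..b}) f"
  shows "diag_holder a b (\<lambda>t E. f (t, E))"
proof -
  let ?S = "{a..b} \<times> {a..b}"
  obtain D1 D2 where D: "\<And>z. z \<in> ?S \<Longrightarrow> (f has_derivative (\<lambda>(h, j). D1 z * h + D2 z * j)) (at z within ?S)"
    "Ck_on k ?S D1"
    using Ck_on_box_partials[OF f] by metis
  show ?thesis
    using has_derivative_partials(1)[OF D(1)]
    by (intro diag_holder_of_deriv[OF Ck_on_imp_continuous_on[OF f] Ck_on_imp_continuous_on[OF D(2)]]) auto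
qed

lemma diag_holder_Ck_on_1:
  assumes f: "Ck_on (Suc k) {a..b} (f :: real \<Rightarrow> real)"
  shows "diag_holder a b (\<lambda>t E. f t)"
proof -
  let ?D = "\<lambda>z. frechet_derivative f (at z within {a..b})"
  have D: "(f has_real_derivative ?D z 1) (at z within {a..b})" if "z \<in> {a..b}" for z
  proof -
    have D: "(f has_derivative ?D z) (at z within {a..b})"
      using f that by (simp add: differentiable_on_def frechet_derivative_works)
    have "?D z (h *\<^sub>R 1) = h *\<^sub>R ?D z 1" for h
      by (rule linear_scale[OF has_derivative_linear[OF D]])
    then have "?D z h = ?D z 1 * h" for h
      by (metis mult.commute mult.right_neutral real_scaleR_def)
    then have "?D z = (*) (?D z 1)" by (rule ext)
    from has_derivative_eq_rhs[OF D this] show ?thesis unfolding has_field_derivative_def .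
  qed
  have "Ck_on k {a..b} (\<lambda>z. ?D z 1)" using f by simp
  then have "continuous_on ({a..b} \<times> {a..b}) (\<lambda>z. ?D (fst z) 1)" "continuous_on ({a..b} \<times> {a..b}) (\<lambda>z. f (fst z))"
    using Ck_on_imp_continuous_on[OF f]
    by (auto dest!: Ck_on_imp_continuous_on intro!: continuous_on_compose2[of _ _ _ fst] continuous_intros)
  from diag_holder_of_deriv[OF this(2,1)] D show ?thesis by simp
qed

lemma tan2_partials_continuous:
  assumes "0 < a"
  shows "continuous_on ({a..b} \<times> {a..b}) (\<lambda>z. tan2_t (fst z) (snd z))"
    and "continuous_on ({a..b} \<times> {a..b}) (\<lambda>z. tan2_E (fst z) (snd z))"
  using assms unfolding tan2_t_def tan2_E_def by (auto intro!: continuous_intros)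

lemma diag_holder_tan2_partials:
  assumes "0 < a"
  shows "diag_holder a b tan2_t" "diag_holder a b tan2_E"
proof -
  have "((\<lambda>t. tan2_t t E) has_real_derivative
      - (2 * (E + 2) * (E * (2 * (t + 2)))) / (E * (t + 2)^2 * (E * (t + 2)^2))) (at t within {a..b})"
    if "t \<in> {a..b}" "E \<in> {a..b}" for t E
    unfolding tan2_t_def using that assms by (auto intro!: derivative_eq_intros)
  moreover have "continuous_on ({a..b} \<times> {a..b}) (\<lambda>z. - (2 * (snd z + 2) * (snd z * (2 * (fst z + 2)))) /
      (snd z * (fst z + 2)^2 * (snd z * (fst z + 2)^2)))"
    by (intro continuous_intros) (use assms in auto)
  ultimately show "diag_holder a b tan2_t"
    using diag_holder_of_deriv[OF tan2_partials_continuous(1)[OF assms]] by fastforce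
  have "((\<lambda>t. tan2_E t E) has_real_derivative
      - ((2 * (E^2 * (t + 2)) - 2 * t * E^2) / (E^2 * (t + 2) * (E^2 * (t + 2))))) (at t within {a..b})"
    if "t \<in> {a..b}" "E \<in> {a..b}" for t E
    unfolding tan2_E_def using that assms by (auto intro!: derivative_eq_intros)
  moreover have "continuous_on ({a..b} \<times> {a..b}) (\<lambda>z. - ((2 * ((snd z)^2 * (fst z + 2)) - 2 * fst z * (snd z)^2) /
      ((snd z)^2 * (fst z + 2) * ((snd z)^2 * (fst z + 2)))))"
    using assms by (auto intro!: continuous_intros)
  ultimately show "diag_holder a b tan2_E"
    using diag_holder_of_deriv[OF tan2_partials_continuous(2)[OF assms]] by fastforce
qed

lemma tan2_partials_self:
  assumes "0 < E"
  shows "tan2_t E E = 2 / (E * (E + 2))" "tan2_E E E = - (2 / (E * (E + 2)))"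
proof -
  have "2 * c / (E * c^2) = 2 / (E * c)" "- (2 * E / (E^2 * c)) = - (2 / (E * c))" if "c \<noteq> 0" for c
    using that assms by (simp_all add: power2_eq_square)
  from this[of "E + 2"] assms show "tan2_t E E = 2 / (E * (E + 2))" "tan2_E E E = - (2 / (E * (E + 2)))"
    unfolding tan2_t_def tan2_E_def by simp_all
qed

section \<open>Finite parts for a fixed position and direction\<close>

locale energy_frame = frame p q w for p q w +
  fixes a b :: real and u :: "real \<Rightarrow> real^3 \<Rightarrow> real"
  assumes a: "0 < a" and ab: "a < b" and u: "Cm_into_Ck_sphere (Suc (Suc 0)) {a..b} 3 u"
begin

abbreviation "u' \<equiv> energy_deriv {a..b} u"
abbreviation "\<tau> t E \<equiv> sqrt (tan2 t E)"
abbreviation "avg t E \<equiv> ray_avg p q w 0 (u t) (\<tau> t E)"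
abbreviation "avg' t E \<equiv> ray_avg p q w 0 (u' t) (\<tau> t E)"
abbreviation "slope t E \<equiv> ray_slope (u t) (\<tau> t E) / 2"

lemma u': "Cm_into_Ck_sphere (Suc 0) {a..b} 3 u'"
  using u by simp

text \<open>Two energy derivatives of \<open>u\<close> leave one for \<open>u'\<close>, which makes
  \<open>avg'\<close> Lipschitz in the energy; the third derivative on the sphere serves
  \<open>slope\<close>.\<close>

lemma diag_holder_avg: "diag_holder a b avg" "diag_holder a b avg'" "diag_holder a b slope"
proof -
  show "diag_holder a b avg" "diag_holder a b avg'"
    using diag_holder_ray_avg[OF u _ a, of 0] diag_holder_ray_avg[OF u' _ a, of 0] by auto
  have "diag_holder a b (\<lambda>t E. 1/2)" by (rule diag_holderI[of a b _ 1 0]) auto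
  from diag_holder_mult[OF diag_holder_ray_slope[OF u _ a] this]
  show "diag_holder a b slope" by simp
qed

lemma tau_continuous: "a \<le> E \<Longrightarrow> continuous_on {E<..b} (\<lambda>t. \<tau> t E)"
  using a unfolding tan2_def by (auto intro!: continuous_intros)

lemma ray_avg_tau_continuous:
  assumes v: "Cm_into_Ck_sphere m {a..b} 3 v" and n: "n \<le> 3" and E: "a \<le> E"
  shows "continuous_on {E<..b} (\<lambda>t. ray_avg p q w n (v t) (\<tau> t E))"
proof -
  have "continuous_on {E<..b} (\<lambda>t. (t, \<tau> t E))"
    by (intro continuous_intros tau_continuous[OF E])
  then have "continuous_on {E<..b} (\<lambda>t. case (t, \<tau> t E) of (e, r) \<Rightarrow> ray_avg p q w n (v e) r)"
    by (rule continuous_on_compose2[OF ray_avg_continuous[OF v n]]) (use E in auto)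
  then show ?thesis by simp
qed

lemma avg_continuous:
  assumes E: "a \<le> E"
  shows "continuous_on {E<..b} (\<lambda>t. avg t E)" "continuous_on {E<..b} (\<lambda>t. avg' t E)"
    "continuous_on {E<..b} (\<lambda>t. slope t E)"
proof -
  show "continuous_on {E<..b} (\<lambda>t. avg t E)" "continuous_on {E<..b} (\<lambda>t. avg' t E)"
    using ray_avg_tau_continuous[OF u _ E] ray_avg_tau_continuous[OF u' _ E] by auto
  have nz: "\<tau> t E \<noteq> 0" if "t \<in> {E<..b}" for t
    using tan2_pos[of E t] E a that by auto
  have "continuous_on {E<..b} (\<lambda>t. ray_avg p q w 1 (u t) (\<tau> t E) / \<tau> t E / 2)"
    using nz
    by (intro continuous_on_divide continuous_on_const ray_avg_tau_continuous[OF u _ E] tau_continuous[OF E]) auto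
  then show "continuous_on {E<..b} (\<lambda>t. slope t E)"
    by (rule continuous_on_eq) (use nz in \<open>auto simp: ray_slope_def\<close>)
qed

lemma avg_self: "avg E E = 2 * pi * u E w" "avg' E E = 2 * pi * u' E w"
  by (simp_all add: ray_avg_0)

lemma slope_self:
  assumes "E \<in> {a..b}"
  shows "slope E E = pi * laplace_S (u E) w / 2"
  using ray_avg_2[OF Cm_into_Ck_sphere_imp_Ck[OF u assms]] by (simp add: ray_slope_def)

text \<open>The second energy acts only through \<open>\<tau>\<close>, the first also through
  \<open>u\<close>. The derivative of the square root brings in \<open>1 / (2 * \<tau> t E)\<close>,
  which turns the first derivative of the average into \<open>slope\<close>.\<close>

lemma avg_has_derivative:
  assumes t: "a \<le> E" "E < t" "t \<le> b"
  shows "((\<lambda>(t, E). avg t E) has_derivative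
    (\<lambda>(h, j). (avg' t E + slope t E * tan2_t t E) * h + (slope t E * tan2_E t E) * j))
    (at (t, E) within {a..b} \<times> {a..b})"
proof -
  have E: "0 < E" and tI: "t \<in> {a..b}" using a t by auto
  have nz: "\<tau> t E \<noteq> 0" using tan2_pos[OF E t(2)] by simp
  have "((\<lambda>z. (fst z, case z of (t, E) \<Rightarrow> \<tau> t E)) has_derivative
      (\<lambda>z. (fst z, case z of (h, j) \<Rightarrow> (tan2_t t E * h + tan2_E t E * j) / (2 * \<tau> t E))))
      (at (t, E) within {a..b} \<times> {a..b})"
    by (intro has_derivative_Pair sqrt_tan2_has_derivative[OF E t(2)]) (auto intro!: derivative_eq_intros)
  moreover have "((\<lambda>(e, r). ray_avg p q w 0 (u e) r) has_derivative
      (\<lambda>(h, j). avg' t E * h + ray_avg p q w 1 (u t) (\<tau> t E) * j))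
      (at (fst (t, E), case (t, E) of (t, E) \<Rightarrow> \<tau> t E) within
        (\<lambda>z. (fst z, case z of (t, E) \<Rightarrow> \<tau> t E)) ` ({a..b} \<times> {a..b}))"
    using ray_avg_has_derivative[OF u _ tI, of 0 "\<tau> t E"]
    by (auto intro: has_derivative_subset)
  ultimately have "((\<lambda>z. case (fst z, case z of (t, E) \<Rightarrow> \<tau> t E) of (e, r) \<Rightarrow> ray_avg p q w 0 (u e) r)
      has_derivative (\<lambda>z. case (fst z, case z of (h, j) \<Rightarrow> (tan2_t t E * h + tan2_E t E * j) / (2 * \<tau> t E)) of
        (h, j) \<Rightarrow> avg' t E * h + ray_avg p q w 1 (u t) (\<tau> t E) * j)) (at (t, E) within {a..b} \<times> {a..b})"
    by (rule has_derivative_in_compose)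
  moreover have "(\<lambda>z. case (fst z, case z of (h, j) \<Rightarrow> (tan2_t t E * h + tan2_E t E * j) / (2 * \<tau> t E)) of
        (h, j) \<Rightarrow> avg' t E * h + ray_avg p q w 1 (u t) (\<tau> t E) * j) =
      (\<lambda>(h, j). (avg' t E + slope t E * tan2_t t E) * h + (slope t E * tan2_E t E) * j)"
    using nz by (auto simp: fun_eq_iff ray_slope_def field_simps)
  ultimately show ?thesis by (simp add: case_prod_unfold)
qed

text \<open>The subtracted bracket is the first partial derivative of
  \<open>\<sigma> t E * avg t E\<close> at the diagonal. The Laplacian in it stems from
  \<open>slope * tan2_t\<close>, which is there \<open>pi * laplace_S (u E) w / 2\<close> times
  \<open>2 / (E * (E + 2))\<close>.\<close>

lemma hadamard_pf1_derivative:
  fixes \<sigma> :: "real \<Rightarrow> real \<Rightarrow> real"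
  assumes \<sigma>: "Ck_on 2 ({a..b} \<times> {a..b}) (\<lambda>(t, E). \<sigma> t E)" and E: "a \<le> E" "E < b"
  defines "\<sigma>t \<equiv> \<lambda>t E. vector_derivative (\<lambda>t. \<sigma> t E) (at t within {a..b})"
    and "\<sigma>E \<equiv> \<lambda>t E. vector_derivative (\<lambda>E. \<sigma> t E) (at E within {a..b})"
  shows "\<exists>P M L1 L2.
    has_pf1 (\<lambda>t. \<sigma> t E * avg t E) E b P \<and>
    has_pf2 (\<lambda>t. \<sigma> t E * avg t E) E b M \<and>
    has_pf1 (\<lambda>t. \<sigma> t E * (slope t E * tan2_E t E)) E b L1 \<and>
    has_pf1 (\<lambda>t. \<sigma>E t E * avg t E) E b L2 \<and>
    ((\<lambda>E. pf1 (\<lambda>t. \<sigma> t E * avg t E) E b) has_real_derivative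
      M + L1 + L2 - (2 * pi * \<sigma>t E E * u E w + 2 * pi * \<sigma> E E * u' E w +
        \<sigma> E E * pi * laplace_S (u E) w / (E * (E + 2)))) (at E within {a..b})"
proof -
  let ?S = "{a..b} \<times> {a..b}"
  obtain D1 D2 where D: "\<And>z. z \<in> ?S \<Longrightarrow>
      ((\<lambda>(t, E). \<sigma> t E) has_derivative (\<lambda>(h, j). D1 z * h + D2 z * j)) (at z within ?S)"
    "Ck_on (Suc 0) ?S D1" "Ck_on (Suc 0) ?S D2"
    using Ck_on_box_partials[OF \<sigma>[unfolded numeral_2_eq_2]] by metis
  \<comment> \<open>A derivative within a nondegenerate closed interval is unique, so the components
    of the total derivative are the one-sided vector derivatives of the statement, for arguments in
    the box.\<close>
  have D1: "D1 (t, E) = \<sigma>t t E" and D2: "D2 (t, E) = \<sigma>E t E" if "t \<in> {a..b}" "E \<in> {a..b}" for t E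
    using has_derivative_partials[OF D(1), of t E] that ab
    unfolding \<sigma>t_def \<sigma>E_def
    by (auto intro!: vector_derivative_within_closed_interval[symmetric]
        simp flip: has_real_derivative_iff_has_vector_derivative)
  define F1 where "F1 = (\<lambda>t E. D1 (t, E) * avg t E + \<sigma> t E * (avg' t E + slope t E * tan2_t t E))"
  define F2 where "F2 = (\<lambda>t E. D2 (t, E) * avg t E + \<sigma> t E * (slope t E * tan2_E t E))"
  have hold\<sigma>: "diag_holder a b \<sigma>"
    using diag_holder_Ck_on[OF \<sigma>[unfolded numeral_2_eq_2]] by simp
  note hold = diag_holder_Ck_on[OF D(2)] diag_holder_Ck_on[OF D(3)] hold\<sigma> diag_holder_avg
    diag_holder_tan2_partials[OF a]
  have hF: "diag_holder a b (\<lambda>t E. \<sigma> t E * avg t E)" and hF1: "diag_holder a b F1" and hF2: "diag_holder a b F2"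
    and hL1: "diag_holder a b (\<lambda>t E. \<sigma> t E * (slope t E * tan2_E t E))"
    and hL2: "diag_holder a b (\<lambda>t E. D2 (t, E) * avg t E)"
    unfolding F1_def F2_def by (intro diag_holder_add diag_holder_mult hold)+
  have slice: "continuous_on {e<..b} (\<lambda>t. f (t, e))" if "continuous_on ?S f" "a \<le> e" "e < b"
    for f :: "real \<times> real \<Rightarrow> real" and e
    using that by (intro continuous_on_compose2[OF that(1)]) (auto intro!: continuous_intros)
  have cont: "continuous_on {e<..b} (\<lambda>t. D1 (t, e))" "continuous_on {e<..b} (\<lambda>t. D2 (t, e))"
    "continuous_on {e<..b} (\<lambda>t. \<sigma> t e)" "continuous_on {e<..b} (\<lambda>t. tan2_t t e)"
    "continuous_on {e<..b} (\<lambda>t. tan2_E t e)" if e: "a \<le> e" "e < b" for e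
    using slice[OF Ck_on_imp_continuous_on[OF D(2)] e] slice[OF Ck_on_imp_continuous_on[OF D(3)] e]
      slice[OF Ck_on_imp_continuous_on[OF \<sigma>] e] slice[OF tan2_partials_continuous(1)[OF a] e]
      slice[OF tan2_partials_continuous(2)[OF a] e] by simp_all
  have contF: "continuous_on {e<..b} (\<lambda>t. F1 t e)" "continuous_on {e<..b} (\<lambda>t. F2 t e)"
    "continuous_on {e<..b} (\<lambda>t. \<sigma> t e * (slope t e * tan2_E t e))"
    "continuous_on {e<..b} (\<lambda>t. D2 (t, e) * avg t e)" if e: "a \<le> e" "e < b" for e
    unfolding F1_def F2_def by (intro continuous_on_add continuous_on_mult cont[OF e] avg_continuous[OF e(1)])+
  \<comment> \<open>\<open>tan2\<close> vanishes on the diagonal, so its two partial derivatives are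
    opposite there and the \<open>slope\<close> terms of \<open>F1\<close> and \<open>F2\<close>
    cancel.\<close>
  have self: "F1 e e + F2 e e = (D1 (e, e) + D2 (e, e)) * (2 * pi * u e w) + \<sigma> e e * (2 * pi * u' e w)"
    if "a \<le> e" for e
  proof -
    have "tan2_E e e = - tan2_t e e" using that a by (simp add: tan2_partials_self)
    then show ?thesis unfolding F1_def F2_def avg_self by (simp add: algebra_simps)
  qed
  have "\<exists>P M L. has_pf1 (\<lambda>t. \<sigma> t E * avg t E) E b P \<and> has_pf2 (\<lambda>t. \<sigma> t E * avg t E) E b M \<and>
    has_pf1 (\<lambda>t. F2 t E) E b L \<and>
    ((\<lambda>E. pf1 (\<lambda>t. \<sigma> t E * avg t E) E b) has_real_derivative M + L - F1 E E) (at E within {a..b})"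
  proof (rule pf1_has_derivative[OF _ _ hF hF1 hF2 contF(1,2) E])
    fix t E assume t: "a \<le> E" "E < t" "t \<le> b"
    have "((\<lambda>z. (case z of (t, E) \<Rightarrow> \<sigma> t E) * (case z of (t, E) \<Rightarrow> avg t E)) has_derivative
      (\<lambda>h. (case (t, E) of (t, E) \<Rightarrow> \<sigma> t E) *
          (case h of (h, j) \<Rightarrow> (avg' t E + slope t E * tan2_t t E) * h + (slope t E * tan2_E t E) * j) +
        (case h of (h, j) \<Rightarrow> D1 (t, E) * h + D2 (t, E) * j) * (case (t, E) of (t, E) \<Rightarrow> avg t E)))
      (at (t, E) within ?S)"
      using t by (intro has_derivative_mult D(1) avg_has_derivative) auto
    then show "((\<lambda>(t, E). \<sigma> t E * avg t E) has_derivative (\<lambda>(h, j). F1 t E * h + F2 t E * j)) (at (t, E) within ?S)"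
      by (simp add: case_prod_unfold F1_def F2_def algebra_simps)
  next
    fix E assume E: "a \<le> E" "E < b"
    then have "((\<lambda>E. \<sigma> E E) has_real_derivative D1 (E, E) + D2 (E, E)) (at E within {a..b})"
      using has_derivative_diagonal[OF D(1), of E] by simp
    moreover have "((\<lambda>E. avg E E) has_real_derivative 2 * pi * u' E w) (at E within {a..b})"
      using ray_avg_energy_deriv[OF u, of 0 E 0] E by (simp add: ray_avg_0)
    ultimately have "((\<lambda>E. \<sigma> E E * avg E E) has_real_derivative
        (D1 (E, E) + D2 (E, E)) * avg E E + 2 * pi * u' E w * \<sigma> E E) (at E within {a..b})"
      by (rule DERIV_mult)
    then show "((\<lambda>E. \<sigma> E E * avg E E) has_real_derivative F1 E E + F2 E E) (at E within {a..b})"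
      unfolding self[OF E(1)] avg_self by (simp add: mult_ac)
  qed
  then obtain P M L where PML: "has_pf1 (\<lambda>t. \<sigma> t E * avg t E) E b P" "has_pf2 (\<lambda>t. \<sigma> t E * avg t E) E b M"
    "has_pf1 (\<lambda>t. F2 t E) E b L"
    "((\<lambda>E. pf1 (\<lambda>t. \<sigma> t E * avg t E) E b) has_real_derivative M + L - F1 E E) (at E within {a..b})"
    by blast
  obtain L1 L2 where L1: "has_pf1 (\<lambda>t. \<sigma> t E * (slope t E * tan2_E t E)) E b L1"
    and L2: "has_pf1 (\<lambda>t. D2 (t, E) * avg t E) E b L2"
    using has_pf1_diag_holder(2)[OF hL1 E contF(3)[OF E]] has_pf1_diag_holder(2)[OF hL2 E contF(4)[OF E]]
    by blast
  \<comment> \<open>Both summands of \<open>F2\<close> have a finite part of their own, so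
    uniqueness splits the finite part of \<open>F2\<close> into the gradient term and the term with
    the energy derivative of \<sigma>.\<close>
  have "L = L2 + L1"
    using has_pf1_unique[OF PML(3)] has_pf1_add[OF L2 L1] unfolding F2_def by blast
  moreover have "F1 E E = 2 * pi * \<sigma>t E E * u E w + 2 * pi * \<sigma> E E * u' E w +
      \<sigma> E E * pi * laplace_S (u E) w / (E * (E + 2))"
  proof -
    have "tan2_t E E = 2 / (E * (E + 2))"
      using E a by (simp add: tan2_partials_self)
    then show ?thesis
      using E D1[of E E] slope_self[of E] unfolding F1_def avg_self by (simp add: algebra_simps)
  qed
  moreover have "has_pf1 (\<lambda>t. \<sigma>E t E * avg t E) E b L2"
    by (rule has_pf1_cong[OF E(2) _ L2]) (use E D2 in auto)
  ultimately have "((\<lambda>E. pf1 (\<lambda>t. \<sigma> t E * avg t E) E b) has_real_derivative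
      M + L1 + L2 - (2 * pi * \<sigma>t E E * u E w + 2 * pi * \<sigma> E E * u' E w +
        \<sigma> E E * pi * laplace_S (u E) w / (E * (E + 2)))) (at E within {a..b})"
    "has_pf1 (\<lambda>t. \<sigma>E t E * avg t E) E b L2"
    by (auto intro: DERIV_cong[OF PML(4)])
  with PML(1,2) L1 show ?thesis by blast
qed

lemma has_pf1_avg:
  assumes \<sigma>: "Ck_on 1 {a..b} \<sigma>" and E: "a \<le> E" "E < b"
  shows "\<exists>L. has_pf1 (\<lambda>t. \<sigma> t * avg t E) E b L"
proof -
  have "diag_holder a b (\<lambda>t E. \<sigma> t * avg t E)"
    using diag_holder_Ck_on_1[of 0] \<sigma> by (intro diag_holder_mult diag_holder_avg) simp
  moreover have "continuous_on {E<..b} (\<lambda>t. \<sigma> t * avg t E)"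
    using E by (intro continuous_on_mult avg_continuous continuous_on_subset[OF Ck_on_imp_continuous_on[OF \<sigma>]]) auto
  ultimately show ?thesis using has_pf1_diag_holder(2)[OF _ E] by blast
qed

end

section \<open>The transport operator\<close>

lemma C_into_Cm_Ck_sphereD:
  "C_into_Cm_Ck_sphere S m I k \<phi> \<Longrightarrow> x \<in> S \<Longrightarrow> Cm_into_Ck_sphere m I k (\<lambda>E \<omega>. \<phi> x \<omega> E)"
  unfolding C_into_Cm_Ck_sphere_def Let_def by blast

text \<open>Existence of the finite parts and differentiability are asserted together with the
  identity, because \<open>pf1\<close>, \<open>pf2\<close> and \<open>vector_derivative\<close> are
  total and would otherwise denote unspecified values. The coefficients \<open>a\<close> are chosen
  before all functions, positions and directions, so they form one differential operator.\<close>

theorem theorem4p17: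
  fixes G :: "(real^3) set" and E0 Em :: real
    and R :: "real^3 \<Rightarrow> real^3^3"
    and \<sigma>0 \<sigma>1 \<sigma>2 :: "real^3 \<Rightarrow> real \<Rightarrow> real \<Rightarrow> real"
    and Sig \<psi> :: "real^3 \<Rightarrow> real^3 \<Rightarrow> real \<Rightarrow> real"
  assumes G: "open G" "bounded G" "C1_manifold_with_boundary (closure G)"
    and energies: "0 < E0" "E0 < Em"
    and R: "\<And>\<omega>. \<omega> \<in> sphere 0 1 \<Longrightarrow> rotation_matrix (R \<omega>) \<and> R \<omega> *v axis 3 1 = \<omega>"
    and \<sigma>0: "Kr_bounded_L2 G {E0..Em} R \<sigma>0"
    and \<sigma>1: "C_into_Ck (closure G \<times> {E0..Em}) 1 {E0..Em} (\<lambda>(x, E) E'. \<sigma>1 x E' E)"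
    and \<sigma>2: "C_into_Ck (closure G) 2 ({E0..Em} \<times> {E0..Em}) (\<lambda>x (E', E). \<sigma>2 x E' E)"
    and \<psi>: "C_into_Cm_Ck_sphere (closure G) 2 {E0..Em} 3 \<psi>"
  shows "\<exists>a.
    (\<forall>\<phi> x \<omega> E. C_into_Cm_Ck_sphere (closure G) 2 {E0..Em} 3 \<phi> \<longrightarrow>
       x \<in> G \<longrightarrow> \<omega> \<in> sphere 0 1 \<longrightarrow> E \<in> {E0..Em} \<longrightarrow>
       diff_op2_S a \<phi> x \<omega> E
         = - pi * deriv (\<lambda>E'. mu E' E) E * laplace_S (\<lambda>\<omega>. \<phi> x \<omega> E) \<omega>) \<and>
    (\<forall>x\<in>G. \<forall>\<omega>\<in>sphere 0 1. \<forall>E\<in>{E0..<Em}.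
       (\<exists>L. has_pf2 (\<lambda>E'. Kbar R \<sigma>2 \<psi> x \<omega> E' E) E Em L) \<and>
       (\<exists>L. has_pf1 (\<lambda>E'. Kbar R \<sigma>1 \<psi> x \<omega> E' E) E Em L) \<and>
       (\<exists>L. has_pf1 (\<lambda>E'. Kbar R \<sigma>2 \<psi> x \<omega> E' E) E Em L) \<and>
       (\<lambda>E. pf1 (\<lambda>E'. Kbar R \<sigma>2 \<psi> x \<omega> E' E) E Em) differentiable (at E within {E0..Em}) \<and>
       (\<exists>L. has_pf1 (\<lambda>E'. \<sigma>2 x E' E * (LINT s:{0..2*pi}|lebesgue.
               grad_S (\<lambda>\<omega>. \<psi> x \<omega> E') (gam R E' E \<omega> s) \<bullet> dgam_dE R E' E \<omega> s)) E Em L) \<and>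
       (\<exists>L. has_pf1 (\<lambda>E'. vector_derivative (\<lambda>t. \<sigma>2 x E' t) (at E within {E0..Em}) *
               (LINT s:{0..2*pi}|lebesgue. \<psi> x (gam R E' E \<omega> s) E')) E Em L) \<and>
       transport_op E0 Em R \<sigma>0 \<sigma>1 \<sigma>2 Sig \<psi> x \<omega> E =
         - vector_derivative (\<lambda>E. pf1 (\<lambda>E'. Kbar R \<sigma>2 \<psi> x \<omega> E' E) E Em) (at E within {E0..Em})
         - 2 * pi * \<sigma>2 x E E * vector_derivative (\<lambda>t. \<psi> x \<omega> t) (at E within {E0..Em})
         - \<sigma>2 x E E * diff_op2_S a \<psi> x \<omega> E
         + pf1 (\<lambda>E'. \<sigma>2 x E' E * (LINT s:{0..2*pi}|lebesgue.
               grad_S (\<lambda>\<omega>. \<psi> x \<omega> E') (gam R E' E \<omega> s) \<bullet> dgam_dE R E' E \<omega> s)) E Em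
         + pf1 (\<lambda>E'. vector_derivative (\<lambda>t. \<sigma>2 x E' t) (at E within {E0..Em}) *
               (LINT s:{0..2*pi}|lebesgue. \<psi> x (gam R E' E \<omega> s) E')) E Em
         + pf1 (\<lambda>E'. Kbar R \<sigma>1 \<psi> x \<omega> E' E) E Em
         - 2 * pi * vector_derivative (\<lambda>t. \<sigma>2 x t E) (at E within {E0..Em}) * \<psi> x \<omega> E
         + \<omega> \<bullet> grad (\<lambda>y. \<psi> y \<omega> E) x
         + Sig x \<omega> E * \<psi> x \<omega> E
         - Kr R {E0..Em} \<sigma>0 \<psi> x \<omega> E)"
proof -
  define A :: "nat^3 \<Rightarrow> real \<Rightarrow> real^3 \<Rightarrow> real" where
    "A = (\<lambda>\<alpha> E \<omega>. if \<alpha> \<in> range (\<lambda>i. axis i 2) then - pi * deriv (\<lambda>E'. mu E' E) E else 0)"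
  have A: "diff_op2_S A \<phi> x \<omega> E = - pi * deriv (\<lambda>E'. mu E' E) E * laplace_S (\<lambda>\<omega>. \<phi> x \<omega> E) \<omega>"
    if "C_into_Cm_Ck_sphere (closure G) 2 {E0..Em} 3 \<phi>" "x \<in> G" "\<omega> \<in> sphere 0 1" "E \<in> {E0..Em}"
    for \<phi> x \<omega> E
  proof -
    have "x \<in> closure G" using that(2) closure_subset by blast
    from Cm_into_Ck_sphere_imp_Ck[OF C_into_Cm_Ck_sphereD[OF that(1) this] that(4)]
    have "Ck_sphere 3 (\<lambda>\<omega>. \<phi> x \<omega> E)" .
    then show ?thesis
      unfolding A_def
      using diff_op2_S_laplace[of 3 \<phi> x E \<omega> "\<lambda>E. - pi * deriv (\<lambda>E'. mu E' E) E"] that(3) by simp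
  qed
  show ?thesis
  proof (intro exI[of _ A] conjI[OF _ ballI[OF ballI[OF ballI]]])
    show "\<forall>\<phi> x \<omega> E. C_into_Cm_Ck_sphere (closure G) 2 {E0..Em} 3 \<phi> \<longrightarrow>
       x \<in> G \<longrightarrow> \<omega> \<in> sphere 0 1 \<longrightarrow> E \<in> {E0..Em} \<longrightarrow>
       diff_op2_S A \<phi> x \<omega> E
         = - pi * deriv (\<lambda>E'. mu E' E) E * laplace_S (\<lambda>\<omega>. \<phi> x \<omega> E) \<omega>"
      using A by blast
  next
    fix x \<omega> :: "real^3" and E :: real
    assume xG: "x \<in> G" and \<omega>: "\<omega> \<in> sphere 0 1" and "E \<in> {E0..<Em}"
    then have x: "x \<in> closure G" and E: "E0 \<le> E" "E < Em" and E0: "0 < E"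
      using closure_subset[of G] energies by auto
    let ?u = "\<lambda>E \<omega>. \<psi> x \<omega> E" and ?I = "{E0..Em}"
    let ?p = "R \<omega> *v axis 1 1" and ?q = "R \<omega> *v axis 2 1"
    have R\<omega>: "rotation_matrix (R \<omega>)" "R \<omega> *v axis 3 1 = \<omega>" using R[OF \<omega>] by auto
    have u2: "Cm_into_Ck_sphere 2 ?I 3 ?u" by (rule C_into_Cm_Ck_sphereD[OF \<psi> x])
    have u: "Cm_into_Ck_sphere (Suc (Suc 0)) ?I 3 ?u" using u2 unfolding numeral_2_eq_2 .
    interpret frame ?p ?q \<omega> by (rule rotation_frame[OF R\<omega>])
    interpret energy_frame ?p ?q \<omega> E0 Em ?u by unfold_locales (use energies u in auto)
    have s2: "Ck_on 2 (?I \<times> ?I) (\<lambda>(t, E). \<sigma>2 x t E)"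
      using \<sigma>2 x unfolding C_into_Ck_def by blast
    have "(x, E) \<in> closure G \<times> ?I" using x E by auto
    with \<sigma>1 have s1: "Ck_on 1 ?I (\<lambda>t. \<sigma>1 x t E)"
      unfolding C_into_Ck_def by fastforce
    have int: "(LINT s:{0..2*pi}|lebesgue. \<psi> x (gam R t E \<omega> s) t) = avg t E"
      if "E0 \<le> E" "E \<le> t" "t \<le> Em" for t E
      using integral_gam[of R, OF R\<omega>(2) refl refl u2, of t E] that energies by simp
    have K: "Kbar R \<sigma> \<psi> x \<omega> t E = \<sigma> x t E * avg t E" if "E0 \<le> E" "E \<le> t" "t \<le> Em" for \<sigma> t E
      unfolding Kbar_def int[OF that] ..
    \<comment> \<open>Only energies strictly above \<open>E\<close> occur, where
      \<open>\<tau> t E\<close> is nonzero and \<open>slope\<close> is an actual quotient.\<close>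
    have grad_int: "(LINT s:{0..2*pi}|lebesgue.
        grad_S (\<lambda>\<omega>. \<psi> x \<omega> t) (gam R t E \<omega> s) \<bullet> dgam_dE R t E \<omega> s) = slope t E * tan2_E t E"
      if t: "E < t" "t \<le> Em" for t
    proof -
      have "t \<in> ?I" "\<tau> t E \<noteq> 0" using E t tan2_pos[OF E0 t(1)] by auto
      then show ?thesis
        using integral_grad_S_dgam[of R, OF R\<omega>(2) refl refl u2 _ _ E0 t(1)]
        by (simp add: ray_slope_def)
    qed
    let ?\<sigma>t = "vector_derivative (\<lambda>t. \<sigma>2 x t E) (at E within ?I)"
    obtain P M L1 L2 where P: "has_pf1 (\<lambda>t. \<sigma>2 x t E * avg t E) E Em P"
      and M: "has_pf2 (\<lambda>t. \<sigma>2 x t E * avg t E) E Em M"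
      and L1: "has_pf1 (\<lambda>t. \<sigma>2 x t E * (slope t E * tan2_E t E)) E Em L1"
      and L2: "has_pf1 (\<lambda>t. vector_derivative (\<lambda>E. \<sigma>2 x t E) (at E within ?I) * avg t E) E Em L2"
      and D: "((\<lambda>E. pf1 (\<lambda>t. \<sigma>2 x t E * avg t E) E Em) has_real_derivative
        M + L1 + L2 - (2 * pi * ?\<sigma>t * \<psi> x \<omega> E + 2 * pi * \<sigma>2 x E E * u' E \<omega> +
          \<sigma>2 x E E * pi * laplace_S (?u E) \<omega> / (E * (E + 2)))) (at E within ?I)"
      using hadamard_pf1_derivative[OF s2 E] by blast
    obtain L where "has_pf1 (\<lambda>t. \<sigma>1 x t E * avg t E) E Em L"
      using has_pf1_avg[OF s1 E] by blast
    then have KL: "has_pf1 (\<lambda>t. Kbar R \<sigma>1 \<psi> x \<omega> t E) E Em L"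
      by (rule has_pf1_cong[OF E(2), rotated]) (use E K in auto)
    have KP: "has_pf1 (\<lambda>t. Kbar R \<sigma>2 \<psi> x \<omega> t E) E Em P"
      by (rule has_pf1_cong[OF E(2) _ P]) (use E K in auto)
    have KM: "has_pf2 (\<lambda>t. Kbar R \<sigma>2 \<psi> x \<omega> t E) E Em M"
      by (rule has_pf2_cong[OF E(2) _ M]) (use E K in auto)
    have GL1: "has_pf1 (\<lambda>t. \<sigma>2 x t E * (LINT s:{0..2*pi}|lebesgue.
        grad_S (\<lambda>\<omega>. \<psi> x \<omega> t) (gam R t E \<omega> s) \<bullet> dgam_dE R t E \<omega> s)) E Em L1"
      by (rule has_pf1_cong[OF E(2) _ L1]) (use grad_int in auto)
    have GL2: "has_pf1 (\<lambda>t. vector_derivative (\<lambda>E. \<sigma>2 x t E) (at E within ?I) *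
        (LINT s:{0..2*pi}|lebesgue. \<psi> x (gam R t E \<omega> s) t)) E Em L2"
      by (rule has_pf1_cong[OF E(2) _ L2]) (use E int in auto)
    let ?D = "M + L1 + L2 - (2 * pi * ?\<sigma>t * \<psi> x \<omega> E + 2 * pi * \<sigma>2 x E E * u' E \<omega> +
          \<sigma>2 x E E * pi * laplace_S (?u E) \<omega> / (E * (E + 2)))"
    have pf1_K: "pf1 (\<lambda>t. Kbar R \<sigma>2 \<psi> x \<omega> t e) e Em = pf1 (\<lambda>t. \<sigma>2 x t e * avg t e) e Em"
      if e: "E0 \<le> e" "e < Em" for e
    proof -
      obtain P where P: "has_pf1 (\<lambda>t. \<sigma>2 x t e * avg t e) e Em P"
        using hadamard_pf1_derivative[OF s2 e] by blast
      have "has_pf1 (\<lambda>t. Kbar R \<sigma>2 \<psi> x \<omega> t e) e Em P"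
        by (rule has_pf1_cong[OF e(2) _ P]) (use e K in auto)
      with P show ?thesis by (simp add: pf1_eq)
    qed
    \<comment> \<open>The derivative at \<open>E\<close> involves neighbouring energies; within
      distance \<open>Em - E\<close> they stay below \<open>Em\<close>, where the two finite parts
      agree.\<close>
    have KD: "((\<lambda>E. pf1 (\<lambda>t. Kbar R \<sigma>2 \<psi> x \<omega> t E) E Em) has_real_derivative ?D) (at E within ?I)"
      by (rule has_field_derivative_transform_within[OF D, of "Em - E"])
        (use E pf1_K in \<open>auto simp: dist_real_def\<close>)
    have vd: "vector_derivative (\<lambda>E. pf1 (\<lambda>t. Kbar R \<sigma>2 \<psi> x \<omega> t E) E Em) (at E within ?I) = ?D"
      using KD E energies
      by (intro vector_derivative_within_closed_interval)
        (auto simp: has_real_derivative_iff_has_vector_derivative)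
    have diff: "(\<lambda>E. pf1 (\<lambda>t. Kbar R \<sigma>2 \<psi> x \<omega> t E) E Em) differentiable (at E within ?I)"
      using KD real_differentiable_def by blast
    have op: "diff_op2_S A \<psi> x \<omega> E = pi * laplace_S (?u E) \<omega> / (E * (E + 2))"
      using A[OF \<psi> xG \<omega>, of E] E deriv_mu[OF E0] by simp
    have u'E: "u' E \<omega> = vector_derivative (\<lambda>t. \<psi> x \<omega> t) (at E within ?I)"
      by (simp add: energy_deriv_def)
    show "(\<exists>L. has_pf2 (\<lambda>E'. Kbar R \<sigma>2 \<psi> x \<omega> E' E) E Em L) \<and>
       (\<exists>L. has_pf1 (\<lambda>E'. Kbar R \<sigma>1 \<psi> x \<omega> E' E) E Em L) \<and>
       (\<exists>L. has_pf1 (\<lambda>E'. Kbar R \<sigma>2 \<psi> x \<omega> E' E) E Em L) \<and>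
       (\<lambda>E. pf1 (\<lambda>E'. Kbar R \<sigma>2 \<psi> x \<omega> E' E) E Em) differentiable (at E within {E0..Em}) \<and>
       (\<exists>L. has_pf1 (\<lambda>E'. \<sigma>2 x E' E * (LINT s:{0..2*pi}|lebesgue.
               grad_S (\<lambda>\<omega>. \<psi> x \<omega> E') (gam R E' E \<omega> s) \<bullet> dgam_dE R E' E \<omega> s)) E Em L) \<and>
       (\<exists>L. has_pf1 (\<lambda>E'. vector_derivative (\<lambda>t. \<sigma>2 x E' t) (at E within {E0..Em}) *
               (LINT s:{0..2*pi}|lebesgue. \<psi> x (gam R E' E \<omega> s) E')) E Em L) \<and>
       transport_op E0 Em R \<sigma>0 \<sigma>1 \<sigma>2 Sig \<psi> x \<omega> E =
         - vector_derivative (\<lambda>E. pf1 (\<lambda>E'. Kbar R \<sigma>2 \<psi> x \<omega> E' E) E Em) (at E within {E0..Em})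
         - 2 * pi * \<sigma>2 x E E * vector_derivative (\<lambda>t. \<psi> x \<omega> t) (at E within {E0..Em})
         - \<sigma>2 x E E * diff_op2_S A \<psi> x \<omega> E
         + pf1 (\<lambda>E'. \<sigma>2 x E' E * (LINT s:{0..2*pi}|lebesgue.
               grad_S (\<lambda>\<omega>. \<psi> x \<omega> E') (gam R E' E \<omega> s) \<bullet> dgam_dE R E' E \<omega> s)) E Em
         + pf1 (\<lambda>E'. vector_derivative (\<lambda>t. \<sigma>2 x E' t) (at E within {E0..Em}) *
               (LINT s:{0..2*pi}|lebesgue. \<psi> x (gam R E' E \<omega> s) E')) E Em
         + pf1 (\<lambda>E'. Kbar R \<sigma>1 \<psi> x \<omega> E' E) E Em
         - 2 * pi * vector_derivative (\<lambda>t. \<sigma>2 x t E) (at E within {E0..Em}) * \<psi> x \<omega> E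
         + \<omega> \<bullet> grad (\<lambda>y. \<psi> y \<omega> E) x
         + Sig x \<omega> E * \<psi> x \<omega> E
         - Kr R {E0..Em} \<sigma>0 \<psi> x \<omega> E"
      \<comment> \<open>The derivative formula is solved for \<open>M\<close>, the finite part of
        second order; the remaining terms of the transport operator occur unchanged on both
        sides.\<close>
      by (intro conjI, (rule exI, rule KM), (rule exI, rule KL), (rule exI, rule KP),
          rule diff,
          (rule exI, rule GL1), (rule exI, rule GL2),
          simp add: transport_op_def pf1_eq[OF KL] pf1_eq[OF GL1] pf1_eq[OF GL2] pf2_eq[OF KM] vd op u'E)
  qed
qed

end
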